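(* Let $G$ be a finite group. For every prime $p$, denote by $G_p$ the quotient of $G$ by the subgroup of $G$ generated by all the elements of order coprime to $p$, and by $\varepsilon_p:\mathbf{Z}_{(p)}[G_p]\to\mathbf{Z}_{(p)}$ the augmentation map. Then the Cohn localization ring $\Lambda=L(\mathbf{Z}[G]\to\mathbf{Z})$ of the augmentation map $\mathbf{Z}[G]\to\mathbf{Z}$ is given by the following pull-back diagram of rings (with the canonical maps out of $\Lambda$): $$\begin{array}{ccc}\Lambda&\longrightarrow&\prod_p\mathbf{Z}_{(p)}[G_p]\\ \downarrow&&\downarrow{\scriptstyle\prod_p\varepsilon_p}\\ \mathbf{Z}&\stackrel{\Delta}{\longrightarrow}&\prod_p\mathbf{Z}_{(p)}\end{array}$$ where $\Delta$ is the diagonal inclusion and the products are over all primes $p$ such that $G_p$ is non-trivial.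
   Context: For a ring homomorphism $A\to B$, the Cohn localization $L(A\to B)$ is the ring obtained from $A$ by formally inverting all matrices with entries in $A$ which become invertible over $B$: it comes with a ring homomorphism $A\to L(A\to B)$ sending each such matrix to an invertible matrix, and it is universal (initial) among ring homomorphisms out of $A$ with this property. By universality $A\to B$ factors through $L(A\to B)$. $\mathbf{Z}_{(p)}$ is the localization of $\mathbf{Z}$ at the prime ideal $(p)$. The canonical maps out of $\Lambda$ are the ones compatible with the maps from $\mathbf{Z}[G]$: the map $\Lambda\to\mathbf{Z}$ through which the augmentation $\mathbf{Z}[G]\to\mathbf{Z}$ factors, and the maps $\Lambda\to\mathbf{Z}_{(p)}[G_p]$ through which $\mathbf{Z}[G]\to\mathbf{Z}[G_p]\to\mathbf{Z}_{(p)}[G_p]$ factors. *)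

theory Defs
  imports
    "HOL-Algebra.IntRing"
    "HOL-Algebra.Generated_Groups"
    "HOL-Algebra.Multiplicative_Group"
    "HOL-Algebra.Chinese_Remainder"
begin

section \<open>Matrices over a ring\<close>

text \<open>
  An \<open>m \<times> n\<close> matrix is a function of a row and a column index; only its values
  at \<open>i < m\<close>, \<open>j < n\<close> matter.  Matrices are not required to be square.
\<close>

definition matrices :: "('a, 'r) ring_scheme \<Rightarrow> nat \<Rightarrow> nat \<Rightarrow> (nat \<Rightarrow> nat \<Rightarrow> 'a) set" where
  "matrices R m n = {M. \<forall>i<m. \<forall>j<n. M i j \<in> carrier R}"

definition mutually_inverse ::
    "('a, 'r) ring_scheme \<Rightarrow> nat \<Rightarrow> nat \<Rightarrow> (nat \<Rightarrow> nat \<Rightarrow> 'a) \<Rightarrow> (nat \<Rightarrow> nat \<Rightarrow> 'a) \<Rightarrow> bool" where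
  "mutually_inverse R m n M N \<longleftrightarrow>
    (\<forall>i<m. \<forall>j<m. (\<Oplus>\<^bsub>R\<^esub>k\<in>{..<n}. M i k \<otimes>\<^bsub>R\<^esub> N k j) = (if i = j then \<one>\<^bsub>R\<^esub> else \<zero>\<^bsub>R\<^esub>)) \<and>
    (\<forall>i<n. \<forall>j<n. (\<Oplus>\<^bsub>R\<^esub>k\<in>{..<m}. N i k \<otimes>\<^bsub>R\<^esub> M k j) = (if i = j then \<one>\<^bsub>R\<^esub> else \<zero>\<^bsub>R\<^esub>))"

definition invertible_matrix ::
    "('a, 'r) ring_scheme \<Rightarrow> nat \<Rightarrow> nat \<Rightarrow> (nat \<Rightarrow> nat \<Rightarrow> 'a) \<Rightarrow> bool" where
  "invertible_matrix R m n M \<longleftrightarrow>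
    M \<in> matrices R m n \<and> (\<exists>N \<in> matrices R n m. mutually_inverse R m n M N)"

definition inverted_matrices ::
    "('a, 'r) ring_scheme \<Rightarrow> ('b, 's) ring_scheme \<Rightarrow> ('a \<Rightarrow> 'b) \<Rightarrow> nat \<Rightarrow> nat
      \<Rightarrow> (nat \<Rightarrow> nat \<Rightarrow> 'a) set" where
  "inverted_matrices A B f m n =
    {M \<in> matrices A m n. invertible_matrix B m n (\<lambda>i j. f (M i j))}"


section \<open>Cohn localization\<close>

text \<open>
  The ring \<open>L(A \<rightarrow> B)\<close> is presented by generators and relations: it is generated by
  the elements of \<open>A\<close> and by the entries of a formal inverse of every matrix over \<open>A\<close>
  that becomes invertible over \<open>B\<close>.  Its universal property, with respect to target
  rings over an arbitrary type, is the lemma \<open>cohn_localization_universal\<close> below.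
\<close>

datatype 'a cohn_term =
    Emb 'a
  | InvEntry nat nat "nat \<Rightarrow> nat \<Rightarrow> 'a" nat nat
  | Add "'a cohn_term" "'a cohn_term"
  | Mul "'a cohn_term" "'a cohn_term"
  | Neg "'a cohn_term"

text \<open>\<open>InvEntry m n M i j\<close> is the entry \<open>(i, j)\<close> of the formal inverse, of size \<open>n \<times> m\<close>,
  of the \<open>m \<times> n\<close> matrix \<open>M\<close>.\<close>

inductive_set cohn_terms ::
    "('a, 'r) ring_scheme \<Rightarrow> ('b, 's) ring_scheme \<Rightarrow> ('a \<Rightarrow> 'b) \<Rightarrow> 'a cohn_term set"
  for A :: "('a, 'r) ring_scheme" and B :: "('b, 's) ring_scheme" and f :: "'a \<Rightarrow> 'b" where
  Emb: "a \<in> carrier A \<Longrightarrow> Emb a \<in> cohn_terms A B f"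
| InvEntry: "\<lbrakk>M \<in> inverted_matrices A B f m n; i < n; j < m\<rbrakk>
    \<Longrightarrow> InvEntry m n M i j \<in> cohn_terms A B f"
| Add: "\<lbrakk>s \<in> cohn_terms A B f; t \<in> cohn_terms A B f\<rbrakk> \<Longrightarrow> Add s t \<in> cohn_terms A B f"
| Mul: "\<lbrakk>s \<in> cohn_terms A B f; t \<in> cohn_terms A B f\<rbrakk> \<Longrightarrow> Mul s t \<in> cohn_terms A B f"
| Neg: "s \<in> cohn_terms A B f \<Longrightarrow> Neg s \<in> cohn_terms A B f"

primrec sum_term :: "'a cohn_term \<Rightarrow> (nat \<Rightarrow> 'a cohn_term) \<Rightarrow> nat \<Rightarrow> 'a cohn_term" where
  "sum_term z u 0 = z"
| "sum_term z u (Suc n) = Add (sum_term z u n) (u n)"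

text \<open>The smallest congruence that makes the terms into a ring, \<open>Emb\<close> into a ring
  homomorphism and the formal inverses into inverses.\<close>

inductive cohn_eq ::
    "('a, 'r) ring_scheme \<Rightarrow> ('b, 's) ring_scheme \<Rightarrow> ('a \<Rightarrow> 'b)
      \<Rightarrow> 'a cohn_term \<Rightarrow> 'a cohn_term \<Rightarrow> bool"
  for A :: "('a, 'r) ring_scheme" and B :: "('b, 's) ring_scheme" and f :: "'a \<Rightarrow> 'b" where
  refl: "s \<in> cohn_terms A B f \<Longrightarrow> cohn_eq A B f s s"
| sym: "cohn_eq A B f s t \<Longrightarrow> cohn_eq A B f t s"
| trans: "\<lbrakk>cohn_eq A B f s t; cohn_eq A B f t u\<rbrakk> \<Longrightarrow> cohn_eq A B f s u"
| add_cong: "\<lbrakk>cohn_eq A B f s s'; cohn_eq A B f t t'\<rbrakk> \<Longrightarrow> cohn_eq A B f (Add s t) (Add s' t')"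
| mul_cong: "\<lbrakk>cohn_eq A B f s s'; cohn_eq A B f t t'\<rbrakk> \<Longrightarrow> cohn_eq A B f (Mul s t) (Mul s' t')"
| neg_cong: "cohn_eq A B f s s' \<Longrightarrow> cohn_eq A B f (Neg s) (Neg s')"
| add_assoc: "\<lbrakk>s \<in> cohn_terms A B f; t \<in> cohn_terms A B f; u \<in> cohn_terms A B f\<rbrakk>
    \<Longrightarrow> cohn_eq A B f (Add (Add s t) u) (Add s (Add t u))"
| add_comm: "\<lbrakk>s \<in> cohn_terms A B f; t \<in> cohn_terms A B f\<rbrakk>
    \<Longrightarrow> cohn_eq A B f (Add s t) (Add t s)"
| add_zero: "s \<in> cohn_terms A B f \<Longrightarrow> cohn_eq A B f (Add (Emb \<zero>\<^bsub>A\<^esub>) s) s"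
| add_neg: "s \<in> cohn_terms A B f \<Longrightarrow> cohn_eq A B f (Add (Neg s) s) (Emb \<zero>\<^bsub>A\<^esub>)"
| mul_assoc: "\<lbrakk>s \<in> cohn_terms A B f; t \<in> cohn_terms A B f; u \<in> cohn_terms A B f\<rbrakk>
    \<Longrightarrow> cohn_eq A B f (Mul (Mul s t) u) (Mul s (Mul t u))"
| mul_one_left: "s \<in> cohn_terms A B f \<Longrightarrow> cohn_eq A B f (Mul (Emb \<one>\<^bsub>A\<^esub>) s) s"
| mul_one_right: "s \<in> cohn_terms A B f \<Longrightarrow> cohn_eq A B f (Mul s (Emb \<one>\<^bsub>A\<^esub>)) s"
| distrib_left: "\<lbrakk>s \<in> cohn_terms A B f; t \<in> cohn_terms A B f; u \<in> cohn_terms A B f\<rbrakk>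
    \<Longrightarrow> cohn_eq A B f (Mul s (Add t u)) (Add (Mul s t) (Mul s u))"
| distrib_right: "\<lbrakk>s \<in> cohn_terms A B f; t \<in> cohn_terms A B f; u \<in> cohn_terms A B f\<rbrakk>
    \<Longrightarrow> cohn_eq A B f (Mul (Add s t) u) (Add (Mul s u) (Mul t u))"
| emb_add: "\<lbrakk>a \<in> carrier A; b \<in> carrier A\<rbrakk>
    \<Longrightarrow> cohn_eq A B f (Emb (a \<oplus>\<^bsub>A\<^esub> b)) (Add (Emb a) (Emb b))"
| emb_mul: "\<lbrakk>a \<in> carrier A; b \<in> carrier A\<rbrakk>
    \<Longrightarrow> cohn_eq A B f (Emb (a \<otimes>\<^bsub>A\<^esub> b)) (Mul (Emb a) (Emb b))"
| inv_right: "\<lbrakk>M \<in> inverted_matrices A B f m n; i < m; j < m\<rbrakk>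
    \<Longrightarrow> cohn_eq A B f
          (sum_term (Emb \<zero>\<^bsub>A\<^esub>) (\<lambda>k. Mul (Emb (M i k)) (InvEntry m n M k j)) n)
          (Emb (if i = j then \<one>\<^bsub>A\<^esub> else \<zero>\<^bsub>A\<^esub>))"
| inv_left: "\<lbrakk>M \<in> inverted_matrices A B f m n; i < n; j < n\<rbrakk>
    \<Longrightarrow> cohn_eq A B f
          (sum_term (Emb \<zero>\<^bsub>A\<^esub>) (\<lambda>k. Mul (InvEntry m n M i k) (Emb (M k j))) m)
          (Emb (if i = j then \<one>\<^bsub>A\<^esub> else \<zero>\<^bsub>A\<^esub>))"

definition cohn_class ::
    "('a, 'r) ring_scheme \<Rightarrow> ('b, 's) ring_scheme \<Rightarrow> ('a \<Rightarrow> 'b) \<Rightarrow> 'a cohn_term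
      \<Rightarrow> 'a cohn_term set" where
  "cohn_class A B f t = {s. cohn_eq A B f t s}"

definition cohn_localization ::
    "('a, 'r) ring_scheme \<Rightarrow> ('b, 's) ring_scheme \<Rightarrow> ('a \<Rightarrow> 'b) \<Rightarrow> 'a cohn_term set ring" where
  "cohn_localization A B f =
    \<lparr>carrier = cohn_class A B f ` cohn_terms A B f,
     monoid.mult = (\<lambda>U V. \<Union>s\<in>U. \<Union>t\<in>V. cohn_class A B f (Mul s t)),
     one = cohn_class A B f (Emb \<one>\<^bsub>A\<^esub>),
     ring.zero = cohn_class A B f (Emb \<zero>\<^bsub>A\<^esub>),
     add = (\<lambda>U V. \<Union>s\<in>U. \<Union>t\<in>V. cohn_class A B f (Add s t))\<rparr>"

definition cohn_map ::
    "('a, 'r) ring_scheme \<Rightarrow> ('b, 's) ring_scheme \<Rightarrow> ('a \<Rightarrow> 'b) \<Rightarrow> 'a \<Rightarrow> 'a cohn_term set" where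
  "cohn_map A B f a = cohn_class A B f (Emb a)"

text \<open>\<open>k : L(A \<rightarrow> B) \<rightarrow> S\<close> is a ring homomorphism through which \<open>h : A \<rightarrow> S\<close> factors.
  Extensionality makes equality of such maps mean equality on the carrier.\<close>

definition cohn_factor ::
    "('a, 'r) ring_scheme \<Rightarrow> ('b, 's) ring_scheme \<Rightarrow> ('a \<Rightarrow> 'b) \<Rightarrow> ('c, 't) ring_scheme
      \<Rightarrow> ('a \<Rightarrow> 'c) \<Rightarrow> ('a cohn_term set \<Rightarrow> 'c) \<Rightarrow> bool" where
  "cohn_factor A B f S h k \<longleftrightarrow>
    k \<in> ring_hom (cohn_localization A B f) S \<and>
    k \<in> extensional (carrier (cohn_localization A B f)) \<and>
    (\<forall>a\<in>carrier A. k (cohn_map A B f a) = h a)"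


subsection \<open>The universal property\<close>

lemma sum_term_closed:
  assumes "z \<in> cohn_terms A B f" "\<And>k. k < n \<Longrightarrow> u k \<in> cohn_terms A B f"
  shows "sum_term z u n \<in> cohn_terms A B f"
  using assms by (induction n) (auto intro: cohn_terms.Add)

lemma cohn_eq_closed:
  assumes "ring A" "cohn_eq A B f s t"
  shows "s \<in> cohn_terms A B f \<and> t \<in> cohn_terms A B f"
proof -
  interpret ring A by fact
  show ?thesis
    using assms(2)
  proof (induction rule: cohn_eq.induct)
    case (inv_right M m n i j)
    then show ?case
      by (auto intro!: sum_term_closed cohn_terms.intros simp: inverted_matrices_def matrices_def)
  next
    case (inv_left M m n i j)
    then show ?case
      by (auto intro!: sum_term_closed cohn_terms.intros simp: inverted_matrices_def matrices_def)
  qed (auto intro: cohn_terms.intros)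
qed

lemma cohn_class_eq_iff:
  assumes "s \<in> cohn_terms A B f"
  shows "cohn_class A B f s = cohn_class A B f t \<longleftrightarrow> cohn_eq A B f s t"
  unfolding cohn_class_def
  using assms by (blast intro: cohn_eq.refl cohn_eq.sym cohn_eq.trans)

lemma cohn_class_eqI: "cohn_eq A B f s t \<Longrightarrow> cohn_class A B f s = cohn_class A B f t"
  unfolding cohn_class_def by (blast intro: cohn_eq.sym cohn_eq.trans)

lemma UN_UN_const:
  assumes "s \<in> U" "t \<in> V" "\<And>s' t'. s' \<in> U \<Longrightarrow> t' \<in> V \<Longrightarrow> F s' t' = C"
  shows "(\<Union>s'\<in>U. \<Union>t'\<in>V. F s' t') = C"
  using assms by (intro equalityI UN_least) (blast+)

lemma cohn_add_class:
  assumes "s \<in> cohn_terms A B f" "t \<in> cohn_terms A B f"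
  shows "cohn_class A B f s \<oplus>\<^bsub>cohn_localization A B f\<^esub> cohn_class A B f t
    = cohn_class A B f (Add s t)"
proof -
  have *: "cohn_class A B f (Add s' t') = cohn_class A B f (Add s t)"
    if "s' \<in> cohn_class A B f s" "t' \<in> cohn_class A B f t" for s' t'
    using that cohn_class_eqI[OF cohn_eq.add_cong, of A B f s s' t t'] by (simp add: cohn_class_def)
  have "s \<in> cohn_class A B f s" "t \<in> cohn_class A B f t"
    using assms by (auto simp: cohn_class_def intro: cohn_eq.refl)
  then have "(\<Union>s'\<in>cohn_class A B f s. \<Union>t'\<in>cohn_class A B f t. cohn_class A B f (Add s' t'))
      = cohn_class A B f (Add s t)"
    using * by (rule UN_UN_const)
  then show ?thesis
    by (simp add: cohn_localization_def)
qed

lemma cohn_mult_class: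
  assumes "s \<in> cohn_terms A B f" "t \<in> cohn_terms A B f"
  shows "cohn_class A B f s \<otimes>\<^bsub>cohn_localization A B f\<^esub> cohn_class A B f t
    = cohn_class A B f (Mul s t)"
proof -
  have *: "cohn_class A B f (Mul s' t') = cohn_class A B f (Mul s t)"
    if "s' \<in> cohn_class A B f s" "t' \<in> cohn_class A B f t" for s' t'
    using that cohn_class_eqI[OF cohn_eq.mul_cong, of A B f s s' t t'] by (simp add: cohn_class_def)
  have "s \<in> cohn_class A B f s" "t \<in> cohn_class A B f t"
    using assms by (auto simp: cohn_class_def intro: cohn_eq.refl)
  then have "(\<Union>s'\<in>cohn_class A B f s. \<Union>t'\<in>cohn_class A B f t. cohn_class A B f (Mul s' t'))
      = cohn_class A B f (Mul s t)"
    using * by (rule UN_UN_const)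
  then show ?thesis
    by (simp add: cohn_localization_def)
qed

lemma cohn_carrier: "carrier (cohn_localization A B f) = cohn_class A B f ` cohn_terms A B f"
  and cohn_one: "\<one>\<^bsub>cohn_localization A B f\<^esub> = cohn_class A B f (Emb \<one>\<^bsub>A\<^esub>)"
  and cohn_zero: "\<zero>\<^bsub>cohn_localization A B f\<^esub> = cohn_class A B f (Emb \<zero>\<^bsub>A\<^esub>)"
  by (simp_all add: cohn_localization_def)

theorem cohn_localization_ring:
  fixes A :: "('a, 'r) ring_scheme" and B :: "('b, 's) ring_scheme"
  assumes "ring A"
  shows "ring (cohn_localization A B f)"
proof -
  interpret A: ring A by fact
  let ?L = "cohn_localization A B f"
  let ?c = "cohn_class A B f"
  let ?T = "cohn_terms A B f"
  note T = cohn_terms.intros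
  have E: "Emb \<zero>\<^bsub>A\<^esub> \<in> ?T" "Emb \<one>\<^bsub>A\<^esub> \<in> ?T" by (auto intro: T)
  have C: "x \<in> carrier ?L \<longleftrightarrow> (\<exists>s\<in>?T. x = ?c s)" for x
    by (auto simp: cohn_carrier)
  have Cc: "?c s \<in> carrier ?L" if "s \<in> ?T" for s
    using that by (auto simp: cohn_carrier)
  note simps = cohn_add_class cohn_mult_class cohn_one cohn_zero E T Cc
  show ?thesis
  proof (rule ringI)
    show "abelian_group ?L"
    proof (rule abelian_groupI)
      fix x assume "x \<in> carrier ?L"
      then obtain s where s: "s \<in> ?T" "x = ?c s" by (auto simp: C)
      show "\<exists>y\<in>carrier ?L. y \<oplus>\<^bsub>?L\<^esub> x = \<zero>\<^bsub>?L\<^esub>"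
      proof
        show "?c (Neg s) \<oplus>\<^bsub>?L\<^esub> x = \<zero>\<^bsub>?L\<^esub>"
          using s cohn_class_eqI[OF cohn_eq.add_neg[OF s(1)]] by (simp add: simps)
        show "?c (Neg s) \<in> carrier ?L" using s by (simp add: simps)
      qed
      show "\<zero>\<^bsub>?L\<^esub> \<oplus>\<^bsub>?L\<^esub> x = x"
        using s cohn_class_eqI[OF cohn_eq.add_zero[OF s(1)]] by (simp add: simps)
    next
      fix x y assume "x \<in> carrier ?L" "y \<in> carrier ?L"
      then obtain s t where s: "s \<in> ?T" "t \<in> ?T" "x = ?c s" "y = ?c t" by (auto simp: C)
      show "x \<oplus>\<^bsub>?L\<^esub> y \<in> carrier ?L" using s by (simp add: simps)
      show "x \<oplus>\<^bsub>?L\<^esub> y = y \<oplus>\<^bsub>?L\<^esub> x"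
        using s cohn_class_eqI[OF cohn_eq.add_comm[OF s(1,2)]] by (simp add: simps)
    next
      fix x y z assume "x \<in> carrier ?L" "y \<in> carrier ?L" "z \<in> carrier ?L"
      then obtain s t u where s: "s \<in> ?T" "t \<in> ?T" "u \<in> ?T" "x = ?c s" "y = ?c t" "z = ?c u"
        by (auto simp: C)
      show "x \<oplus>\<^bsub>?L\<^esub> y \<oplus>\<^bsub>?L\<^esub> z = x \<oplus>\<^bsub>?L\<^esub> (y \<oplus>\<^bsub>?L\<^esub> z)"
        using s cohn_class_eqI[OF cohn_eq.add_assoc[OF s(1-3)]] by (simp add: simps)
    qed (simp add: simps)
    show "monoid ?L"
    proof (rule monoidI)
      fix x assume "x \<in> carrier ?L"
      then obtain s where s: "s \<in> ?T" "x = ?c s" by (auto simp: C)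
      show "\<one>\<^bsub>?L\<^esub> \<otimes>\<^bsub>?L\<^esub> x = x"
        using s cohn_class_eqI[OF cohn_eq.mul_one_left[OF s(1)]] by (simp add: simps)
      show "x \<otimes>\<^bsub>?L\<^esub> \<one>\<^bsub>?L\<^esub> = x"
        using s cohn_class_eqI[OF cohn_eq.mul_one_right[OF s(1)]] by (simp add: simps)
    next
      fix x y assume "x \<in> carrier ?L" "y \<in> carrier ?L"
      then obtain s t where s: "s \<in> ?T" "t \<in> ?T" "x = ?c s" "y = ?c t" by (auto simp: C)
      show "x \<otimes>\<^bsub>?L\<^esub> y \<in> carrier ?L" using s by (simp add: simps)
    next
      fix x y z assume "x \<in> carrier ?L" "y \<in> carrier ?L" "z \<in> carrier ?L"
      then obtain s t u where s: "s \<in> ?T" "t \<in> ?T" "u \<in> ?T" "x = ?c s" "y = ?c t" "z = ?c u"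
        by (auto simp: C)
      show "x \<otimes>\<^bsub>?L\<^esub> y \<otimes>\<^bsub>?L\<^esub> z = x \<otimes>\<^bsub>?L\<^esub> (y \<otimes>\<^bsub>?L\<^esub> z)"
        using s cohn_class_eqI[OF cohn_eq.mul_assoc[OF s(1-3)]] by (simp add: simps)
    qed (simp add: simps)
  next
    fix x y z assume "x \<in> carrier ?L" "y \<in> carrier ?L" "z \<in> carrier ?L"
    then obtain s t u where s: "s \<in> ?T" "t \<in> ?T" "u \<in> ?T" "x = ?c s" "y = ?c t" "z = ?c u"
      by (auto simp: C)
    show "(x \<oplus>\<^bsub>?L\<^esub> y) \<otimes>\<^bsub>?L\<^esub> z = x \<otimes>\<^bsub>?L\<^esub> z \<oplus>\<^bsub>?L\<^esub> y \<otimes>\<^bsub>?L\<^esub> z"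
      using s cohn_class_eqI[OF cohn_eq.distrib_right[OF s(1-3)]] by (simp add: simps)
    show "z \<otimes>\<^bsub>?L\<^esub> (x \<oplus>\<^bsub>?L\<^esub> y) = z \<otimes>\<^bsub>?L\<^esub> x \<oplus>\<^bsub>?L\<^esub> z \<otimes>\<^bsub>?L\<^esub> y"
      using s cohn_class_eqI[OF cohn_eq.distrib_left[OF s(3,1,2)]] by (simp add: simps)
  qed
qed

theorem cohn_map_ring_hom:
  assumes "ring A"
  shows "cohn_map A B f \<in> ring_hom A (cohn_localization A B f)"
proof -
  interpret A: ring A by fact
  show ?thesis
    by (rule ring_hom_memI)
      (auto simp: cohn_map_def cohn_carrier cohn_one cohn_add_class cohn_mult_class
        cohn_terms.intros intro!: cohn_class_eqI intro: cohn_eq.emb_add cohn_eq.emb_mul)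
qed

lemma cohn_class_sum_term:
  assumes "ring A" "\<And>k. k < n \<Longrightarrow> u k \<in> cohn_terms A B f"
  shows "cohn_class A B f (sum_term (Emb \<zero>\<^bsub>A\<^esub>) u n)
    = (\<Oplus>\<^bsub>cohn_localization A B f\<^esub>k\<in>{..<n}. cohn_class A B f (u k))"
  using assms(2)
proof (induction n)
  case 0
  interpret L: ring "cohn_localization A B f" by (rule cohn_localization_ring[OF assms(1)])
  show ?case by (simp add: cohn_zero)
next
  case (Suc n)
  interpret A: ring A by fact
  interpret L: ring "cohn_localization A B f" by (rule cohn_localization_ring[OF assms(1)])
  have "(\<Oplus>\<^bsub>cohn_localization A B f\<^esub>k\<in>{..<Suc n}. cohn_class A B f (u k))
    = cohn_class A B f (u n) \<oplus>\<^bsub>cohn_localization A B f\<^esub>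
      (\<Oplus>\<^bsub>cohn_localization A B f\<^esub>k\<in>{..<n}. cohn_class A B f (u k))"
    unfolding lessThan_Suc
    by (rule L.finsum_insert) (use Suc.prems in \<open>auto simp: cohn_carrier\<close>)
  also have "\<dots> = cohn_class A B f (u n) \<oplus>\<^bsub>cohn_localization A B f\<^esub>
      cohn_class A B f (sum_term (Emb \<zero>\<^bsub>A\<^esub>) u n)"
    using Suc by simp
  also have "\<dots> = cohn_class A B f (sum_term (Emb \<zero>\<^bsub>A\<^esub>) u n) \<oplus>\<^bsub>cohn_localization A B f\<^esub>
      cohn_class A B f (u n)"
    by (rule L.a_comm)
      (use Suc.prems in \<open>auto simp: cohn_carrier intro!: imageI sum_term_closed cohn_terms.Emb\<close>)
  also have "\<dots> = cohn_class A B f (sum_term (Emb \<zero>\<^bsub>A\<^esub>) u (Suc n))"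
    using Suc.prems by (simp add: cohn_add_class sum_term_closed cohn_terms.Emb)
  finally show ?case by simp
qed

lemma cohn_mutually_inverse:
  fixes A :: "('a, 'r) ring_scheme" and B :: "('b, 's) ring_scheme"
  assumes "ring A" "M \<in> inverted_matrices A B f m n"
  shows "mutually_inverse (cohn_localization A B f) m n (\<lambda>i j. cohn_map A B f (M i j))
    (\<lambda>i j. cohn_class A B f (InvEntry m n M i j))"
proof -
  let ?L = "cohn_localization A B f"
  let ?c = "cohn_class A B f"
  interpret A: ring A by fact
  interpret L: ring ?L by (rule cohn_localization_ring[OF assms(1)])
  have M: "M i j \<in> carrier A" if "i < m" "j < n" for i j
    using assms(2) that by (auto simp: inverted_matrices_def matrices_def)
  have I: "InvEntry m n M i j \<in> cohn_terms A B f" if "i < n" "j < m" for i j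
    using assms(2) that by (rule cohn_terms.InvEntry)
  have r: "(\<Oplus>\<^bsub>?L\<^esub>k\<in>{..<n}. ?c (Emb (M i k)) \<otimes>\<^bsub>?L\<^esub> ?c (InvEntry m n M k j))
      = ?c (Emb (if i = j then \<one>\<^bsub>A\<^esub> else \<zero>\<^bsub>A\<^esub>))" if "i < m" "j < m" for i j
  proof -
    have "(\<Oplus>\<^bsub>?L\<^esub>k\<in>{..<n}. ?c (Emb (M i k)) \<otimes>\<^bsub>?L\<^esub> ?c (InvEntry m n M k j))
      = (\<Oplus>\<^bsub>?L\<^esub>k\<in>{..<n}. ?c (Mul (Emb (M i k)) (InvEntry m n M k j)))"
      by (rule L.finsum_cong')
        (use that M I in \<open>simp_all add: Pi_def cohn_carrier cohn_mult_class cohn_terms.Emb cohn_terms.Mul\<close>)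
    also have "\<dots> = ?c (sum_term (Emb \<zero>\<^bsub>A\<^esub>) (\<lambda>k. Mul (Emb (M i k)) (InvEntry m n M k j)) n)"
      by (rule cohn_class_sum_term[symmetric, OF assms(1)])
        (use that M I in \<open>auto intro!: cohn_terms.Emb cohn_terms.Mul\<close>)
    also have "\<dots> = ?c (Emb (if i = j then \<one>\<^bsub>A\<^esub> else \<zero>\<^bsub>A\<^esub>))"
      by (rule cohn_class_eqI[OF cohn_eq.inv_right[OF assms(2) that]])
    finally show ?thesis .
  qed
  have l: "(\<Oplus>\<^bsub>?L\<^esub>k\<in>{..<m}. ?c (InvEntry m n M i k) \<otimes>\<^bsub>?L\<^esub> ?c (Emb (M k j)))
      = ?c (Emb (if i = j then \<one>\<^bsub>A\<^esub> else \<zero>\<^bsub>A\<^esub>))" if "i < n" "j < n" for i j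
  proof -
    have "(\<Oplus>\<^bsub>?L\<^esub>k\<in>{..<m}. ?c (InvEntry m n M i k) \<otimes>\<^bsub>?L\<^esub> ?c (Emb (M k j)))
      = (\<Oplus>\<^bsub>?L\<^esub>k\<in>{..<m}. ?c (Mul (InvEntry m n M i k) (Emb (M k j))))"
      by (rule L.finsum_cong')
        (use that M I in \<open>simp_all add: Pi_def cohn_carrier cohn_mult_class cohn_terms.Emb cohn_terms.Mul\<close>)
    also have "\<dots> = ?c (sum_term (Emb \<zero>\<^bsub>A\<^esub>) (\<lambda>k. Mul (InvEntry m n M i k) (Emb (M k j))) m)"
      by (rule cohn_class_sum_term[symmetric, OF assms(1)])
        (use that M I in \<open>auto intro!: cohn_terms.Emb cohn_terms.Mul\<close>)
    also have "\<dots> = ?c (Emb (if i = j then \<one>\<^bsub>A\<^esub> else \<zero>\<^bsub>A\<^esub>))"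
      by (rule cohn_class_eqI[OF cohn_eq.inv_left[OF assms(2) that]])
    finally show ?thesis .
  qed
  show ?thesis
    using r l unfolding mutually_inverse_def cohn_map_def cohn_one cohn_zero by auto
qed

theorem cohn_map_inverts:
  fixes A :: "('a, 'r) ring_scheme" and B :: "('b, 's) ring_scheme"
  assumes "ring A" "M \<in> inverted_matrices A B f m n"
  shows "invertible_matrix (cohn_localization A B f) m n (\<lambda>i j. cohn_map A B f (M i j))"
  unfolding invertible_matrix_def
proof (intro conjI bexI)
  show "(\<lambda>i j. cohn_map A B f (M i j)) \<in> matrices (cohn_localization A B f) m n"
    using assms(2) ring_hom_closed[OF cohn_map_ring_hom[OF assms(1)], of _ B f]
    by (auto simp: inverted_matrices_def matrices_def)
  show "(\<lambda>i j. cohn_class A B f (InvEntry m n M i j)) \<in> matrices (cohn_localization A B f) n m"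
    using assms(2) by (auto simp: matrices_def cohn_carrier intro: cohn_terms.InvEntry)
qed (rule cohn_mutually_inverse[OF assms])

lemma finsum_swap_lessThan:
  fixes R (structure)
  assumes "abelian_monoid R" "\<And>i j. \<lbrakk>i < m; j < n\<rbrakk> \<Longrightarrow> g i j \<in> carrier R"
  shows "(\<Oplus>i\<in>{..<m::nat}. \<Oplus>j\<in>{..<n::nat}. g i j) = (\<Oplus>j\<in>{..<n}. \<Oplus>i\<in>{..<m}. g i j)"
  using assms(2)
proof (induction m)
  case 0
  interpret abelian_monoid R by fact
  show ?case by simp
next
  case (Suc m)
  interpret abelian_monoid R by fact
  have "(\<Oplus>i\<in>{..<Suc m}. \<Oplus>j\<in>{..<n}. g i j)
      = (\<Oplus>j\<in>{..<n}. g m j) \<oplus> (\<Oplus>i\<in>{..<m}. \<Oplus>j\<in>{..<n}. g i j)"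
    unfolding lessThan_Suc
    by (rule finsum_insert) (use Suc.prems in \<open>auto intro!: finsum_closed\<close>)
  also have "\<dots> = (\<Oplus>j\<in>{..<n}. g m j) \<oplus> (\<Oplus>j\<in>{..<n}. \<Oplus>i\<in>{..<m}. g i j)"
    using Suc by simp
  also have "\<dots> = (\<Oplus>j\<in>{..<n}. g m j \<oplus> (\<Oplus>i\<in>{..<m}. g i j))"
    by (rule finsum_addf[symmetric]) (use Suc.prems in \<open>auto intro!: finsum_closed\<close>)
  also have "\<dots> = (\<Oplus>j\<in>{..<n}. \<Oplus>i\<in>{..<Suc m}. g i j)"
    by (rule finsum_cong', simp)
      (use Suc.prems in \<open>auto simp: lessThan_Suc intro!: finsum_insert[symmetric] finsum_closed\<close>)
  finally show ?case .
qed

lemma finsum_delta_left: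
  fixes R (structure)
  assumes "ring R" "i < n" "\<And>k. k < n \<Longrightarrow> g k \<in> carrier R"
  shows "(\<Oplus>k\<in>{..<n::nat}. (if i = k then \<one> else \<zero>) \<otimes> g k) = g i"
proof -
  interpret ring R by fact
  have "(\<Oplus>k\<in>{..<n}. (if i = k then \<one> else \<zero>) \<otimes> g k) = (\<Oplus>k\<in>{..<n}. if i = k then g k else \<zero>)"
    by (rule finsum_cong') (use assms(3) in auto)
  then show ?thesis
    using add.finprod_singleton[of i "{..<n}" g] assms by (simp add: finsum_def Pi_def)
qed

lemma finsum_delta_right:
  fixes R (structure)
  assumes "ring R" "i < n" "\<And>k. k < n \<Longrightarrow> g k \<in> carrier R"
  shows "(\<Oplus>k\<in>{..<n::nat}. g k \<otimes> (if k = i then \<one> else \<zero>)) = g i"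
proof -
  interpret ring R by fact
  have "(\<Oplus>k\<in>{..<n}. g k \<otimes> (if k = i then \<one> else \<zero>)) = (\<Oplus>k\<in>{..<n}. if i = k then g k else \<zero>)"
    by (rule finsum_cong') (use assms(3) in auto)
  then show ?thesis
    using add.finprod_singleton[of i "{..<n}" g] assms by (simp add: finsum_def Pi_def)
qed

lemma matrix_inverse_unique:
  fixes R (structure)
  assumes "ring R" and M: "M \<in> matrices R m n" and N: "N \<in> matrices R n m" and N': "N' \<in> matrices R n m"
    and "mutually_inverse R m n M N" "mutually_inverse R m n M N'" and ij: "i < n" "j < m"
  shows "N i j = N' i j"
proof -
  interpret ring R by fact
  have cl: "M k l \<in> carrier R" "N l k \<in> carrier R" "N' l k \<in> carrier R" if "k < m" "l < n" for k l
    using M N N' that by (auto simp: matrices_def)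
  have "N i j = (\<Oplus>k\<in>{..<m}. N i k \<otimes> (if k = j then \<one> else \<zero>))"
    by (rule finsum_delta_right[symmetric, OF assms(1)]) (use cl ij in auto)
  also have "\<dots> = (\<Oplus>k\<in>{..<m}. N i k \<otimes> (\<Oplus>l\<in>{..<n}. M k l \<otimes> N' l j))"
    by (rule finsum_cong', simp)
      (use cl ij assms(6) in \<open>auto simp: mutually_inverse_def intro!: m_closed finsum_closed\<close>)
  also have "\<dots> = (\<Oplus>k\<in>{..<m}. \<Oplus>l\<in>{..<n}. N i k \<otimes> (M k l \<otimes> N' l j))"
    by (rule finsum_cong', simp)
      (use cl ij in \<open>auto intro!: finsum_rdistr finsum_closed\<close>)
  also have "\<dots> = (\<Oplus>l\<in>{..<n}. \<Oplus>k\<in>{..<m}. N i k \<otimes> (M k l \<otimes> N' l j))"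
    by (rule finsum_swap_lessThan[OF abelian_monoid_axioms]) (use cl ij in auto)
  also have "\<dots> = (\<Oplus>l\<in>{..<n}. \<Oplus>k\<in>{..<m}. (N i k \<otimes> M k l) \<otimes> N' l j)"
    by (intro finsum_cong', simp)
      (use cl ij in \<open>auto intro!: finsum_cong' finsum_closed simp: m_assoc\<close>)
  also have "\<dots> = (\<Oplus>l\<in>{..<n}. (\<Oplus>k\<in>{..<m}. N i k \<otimes> M k l) \<otimes> N' l j)"
    by (rule finsum_cong', simp)
      (use cl ij in \<open>auto intro!: finsum_ldistr[symmetric] finsum_closed m_closed\<close>)
  also have "\<dots> = (\<Oplus>l\<in>{..<n}. (if i = l then \<one> else \<zero>) \<otimes> N' l j)"
    by (rule finsum_cong', simp)
      (use cl ij assms(5) in \<open>auto simp: mutually_inverse_def\<close>)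
  also have "\<dots> = N' i j"
    by (rule finsum_delta_left[OF assms(1)]) (use cl ij in auto)
  finally show ?thesis .
qed

primrec cohn_eval ::
    "('c, 't) ring_scheme \<Rightarrow> ('a \<Rightarrow> 'c) \<Rightarrow> (nat \<Rightarrow> nat \<Rightarrow> (nat \<Rightarrow> nat \<Rightarrow> 'a) \<Rightarrow> nat \<Rightarrow> nat \<Rightarrow> 'c)
      \<Rightarrow> 'a cohn_term \<Rightarrow> 'c" where
  "cohn_eval S h N (Emb a) = h a"
| "cohn_eval S h N (InvEntry m n M i j) = N m n M i j"
| "cohn_eval S h N (Add s t) = cohn_eval S h N s \<oplus>\<^bsub>S\<^esub> cohn_eval S h N t"
| "cohn_eval S h N (Mul s t) = cohn_eval S h N s \<otimes>\<^bsub>S\<^esub> cohn_eval S h N t"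
| "cohn_eval S h N (Neg s) = \<ominus>\<^bsub>S\<^esub> cohn_eval S h N s"

theorem cohn_localization_universal:
  fixes A :: "('a, 'r) ring_scheme" and B :: "('b, 's) ring_scheme" and S :: "('c, 't) ring_scheme"
  assumes A: "ring A" and S: "ring S" and h: "h \<in> ring_hom A S"
    and inverts: "\<And>m n M. M \<in> inverted_matrices A B f m n
      \<Longrightarrow> invertible_matrix S m n (\<lambda>i j. h (M i j))"
  shows "\<exists>!k. cohn_factor A B f S h k"
proof -
  let ?L = "cohn_localization A B f"
  let ?T = "cohn_terms A B f"
  let ?c = "cohn_class A B f"
  interpret A: ring A by fact
  interpret S: ring S by fact
  interpret L: ring ?L by (rule cohn_localization_ring[OF A])
  have h0: "h \<zero>\<^bsub>A\<^esub> = \<zero>\<^bsub>S\<^esub>" by (rule ring_hom_zero[OF h A S])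
  define N where "N m n M = (SOME N. N \<in> matrices S n m \<and> mutually_inverse S m n (\<lambda>i j. h (M i j)) N)"
    for m n M
  have N: "N m n M \<in> matrices S n m" "mutually_inverse S m n (\<lambda>i j. h (M i j)) (N m n M)"
    if "M \<in> inverted_matrices A B f m n" for m n M
  proof -
    have "\<exists>N. N \<in> matrices S n m \<and> mutually_inverse S m n (\<lambda>i j. h (M i j)) N"
      using inverts[OF that] by (auto simp: invertible_matrix_def)
    from someI_ex[OF this]
    show "N m n M \<in> matrices S n m" "mutually_inverse S m n (\<lambda>i j. h (M i j)) (N m n M)"
      by (auto simp: N_def)
  qed
  let ?e = "cohn_eval S h N"
  have ecl: "?e t \<in> carrier S" if "t \<in> ?T" for t
    using that
  proof (induction rule: cohn_terms.induct)
    case (Emb a) then show ?case by (simp add: ring_hom_closed[OF h])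
  next
    case (InvEntry M m n i j) then show ?case using N(1)[OF InvEntry(1)] by (simp add: matrices_def)
  qed auto
  have esum: "?e (sum_term (Emb \<zero>\<^bsub>A\<^esub>) u n) = (\<Oplus>\<^bsub>S\<^esub>k\<in>{..<n}. ?e (u k))"
    if "\<And>k. k < n \<Longrightarrow> ?e (u k) \<in> carrier S" for u n
    using that
  proof (induction n)
    case (Suc n)
    have "(\<Oplus>\<^bsub>S\<^esub>k\<in>{..<Suc n}. ?e (u k)) = ?e (u n) \<oplus>\<^bsub>S\<^esub> (\<Oplus>\<^bsub>S\<^esub>k\<in>{..<n}. ?e (u k))"
      unfolding lessThan_Suc by (rule S.finsum_insert) (use Suc.prems in auto)
    also have "\<dots> = (\<Oplus>\<^bsub>S\<^esub>k\<in>{..<n}. ?e (u k)) \<oplus>\<^bsub>S\<^esub> ?e (u n)"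
      by (rule S.a_comm) (use Suc.prems in \<open>auto intro!: S.finsum_closed\<close>)
    finally show ?case using Suc by simp
  qed (simp add: h0)
  have eeq: "?e s = ?e t" if "cohn_eq A B f s t" for s t
    using that
  proof (induction rule: cohn_eq.induct)
    case (inv_right M m n i j)
    have M: "h (M i j) \<in> carrier S" if "i < m" "j < n" for i j
      using inv_right(1) that by (auto simp: inverted_matrices_def matrices_def ring_hom_closed[OF h])
    have "?e (sum_term (Emb \<zero>\<^bsub>A\<^esub>) (\<lambda>k. Mul (Emb (M i k)) (InvEntry m n M k j)) n)
      = (\<Oplus>\<^bsub>S\<^esub>k\<in>{..<n}. h (M i k) \<otimes>\<^bsub>S\<^esub> N m n M k j)"
      by (subst esum) (use M inv_right N(1)[OF inv_right(1)] in \<open>auto simp: matrices_def\<close>)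
    then show ?case
      using N(2)[OF inv_right(1)] inv_right h0 ring_hom_one[OF h] by (simp add: mutually_inverse_def)
  next
    case (inv_left M m n i j)
    have M: "h (M i j) \<in> carrier S" if "i < m" "j < n" for i j
      using inv_left(1) that by (auto simp: inverted_matrices_def matrices_def ring_hom_closed[OF h])
    have "?e (sum_term (Emb \<zero>\<^bsub>A\<^esub>) (\<lambda>k. Mul (InvEntry m n M i k) (Emb (M k j))) m)
      = (\<Oplus>\<^bsub>S\<^esub>k\<in>{..<m}. N m n M i k \<otimes>\<^bsub>S\<^esub> h (M k j))"
      by (subst esum) (use M inv_left N(1)[OF inv_left(1)] in \<open>auto simp: matrices_def\<close>)
    then show ?case
      using N(2)[OF inv_left(1)] inv_left h0 ring_hom_one[OF h] by (simp add: mutually_inverse_def)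
  qed (auto simp: ecl h0 ring_hom_one[OF h] ring_hom_add[OF h] ring_hom_mult[OF h]
        S.a_assoc S.m_assoc S.l_distr S.r_distr S.l_neg intro: S.a_comm)
  define k where "k = (\<lambda>U\<in>carrier ?L. ?e (SOME t. t \<in> U))"
  have k_class: "k (?c t) = ?e t" if "t \<in> ?T" for t
  proof -
    have "t \<in> ?c t" using that by (auto simp: cohn_class_def intro: cohn_eq.refl)
    then have "(SOME u. u \<in> ?c t) \<in> ?c t" by (rule someI)
    then have "?e t = ?e (SOME u. u \<in> ?c t)" by (intro eeq) (simp add: cohn_class_def)
    then show ?thesis using that by (simp add: k_def cohn_carrier)
  qed
  have "cohn_factor A B f S h k"
    unfolding cohn_factor_def
  proof (intro conjI ballI)
    show "k \<in> ring_hom ?L S"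
      by (rule ring_hom_memI)
        (auto simp: cohn_carrier cohn_one cohn_add_class cohn_mult_class k_class ecl
          ring_hom_one[OF h] cohn_terms.intros)
    show "k \<in> extensional (carrier ?L)" by (simp add: k_def)
    show "k (cohn_map A B f a) = h a" if "a \<in> carrier A" for a
      using that by (simp add: cohn_map_def k_class cohn_terms.Emb)
  qed
  moreover have "k1 = k2" if "cohn_factor A B f S h k1" "cohn_factor A B f S h k2" for k1 k2
  proof -
    note k1 = that(1)[unfolded cohn_factor_def] and k2 = that(2)[unfolded cohn_factor_def]
    have inv: "mutually_inverse S m n (\<lambda>i j. h (M i j)) (\<lambda>i j. k' (?c (InvEntry m n M i j)))
        \<and> (\<lambda>i j. k' (?c (InvEntry m n M i j))) \<in> matrices S n m"
      if k': "cohn_factor A B f S h k'" and M: "M \<in> inverted_matrices A B f m n" for k' m n M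
    proof -
      have hom: "k' \<in> ring_hom ?L S" and kA: "\<And>a. a \<in> carrier A \<Longrightarrow> k' (cohn_map A B f a) = h a"
        using k' by (auto simp: cohn_factor_def)
      interpret K: ring_hom_ring ?L S k'
        by (rule ring_hom_ringI2[OF L.ring_axioms S.ring_axioms hom])
      have Mc: "M i j \<in> carrier A" if "i < m" "j < n" for i j
        using M that by (auto simp: inverted_matrices_def matrices_def)
      have Ic: "?c (InvEntry m n M i j) \<in> carrier ?L" if "i < n" "j < m" for i j
        using M that by (auto simp: cohn_carrier intro: cohn_terms.InvEntry)
      have mc: "cohn_map A B f a \<in> carrier ?L" if "a \<in> carrier A" for a
        by (rule ring_hom_closed[OF cohn_map_ring_hom[OF A] that])
      note mi = cohn_mutually_inverse[OF A M, unfolded mutually_inverse_def]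
      have "(\<Oplus>\<^bsub>S\<^esub>l\<in>{..<n}. h (M i l) \<otimes>\<^bsub>S\<^esub> k' (?c (InvEntry m n M l j)))
          = (if i = j then \<one>\<^bsub>S\<^esub> else \<zero>\<^bsub>S\<^esub>)" if "i < m" "j < m" for i j
      proof -
        have "(\<Oplus>\<^bsub>S\<^esub>l\<in>{..<n}. h (M i l) \<otimes>\<^bsub>S\<^esub> k' (?c (InvEntry m n M l j)))
          = (\<Oplus>\<^bsub>S\<^esub>l\<in>{..<n}. k' (cohn_map A B f (M i l) \<otimes>\<^bsub>?L\<^esub> ?c (InvEntry m n M l j)))"
          by (rule S.finsum_cong', simp) (use that Mc Ic mc kA in \<open>auto simp: ring_hom_closed[OF h]\<close>)
        also have "\<dots> = k' (\<Oplus>\<^bsub>?L\<^esub>l\<in>{..<n}. cohn_map A B f (M i l) \<otimes>\<^bsub>?L\<^esub> ?c (InvEntry m n M l j))"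
          by (subst K.hom_finsum) (use that Mc Ic mc in \<open>auto simp: comp_def\<close>)
        also have "\<dots> = (if i = j then \<one>\<^bsub>S\<^esub> else \<zero>\<^bsub>S\<^esub>)"
          using mi that by simp
        finally show ?thesis .
      qed
      moreover have "(\<Oplus>\<^bsub>S\<^esub>l\<in>{..<m}. k' (?c (InvEntry m n M i l)) \<otimes>\<^bsub>S\<^esub> h (M l j))
          = (if i = j then \<one>\<^bsub>S\<^esub> else \<zero>\<^bsub>S\<^esub>)" if "i < n" "j < n" for i j
      proof -
        have "(\<Oplus>\<^bsub>S\<^esub>l\<in>{..<m}. k' (?c (InvEntry m n M i l)) \<otimes>\<^bsub>S\<^esub> h (M l j))
          = (\<Oplus>\<^bsub>S\<^esub>l\<in>{..<m}. k' (?c (InvEntry m n M i l) \<otimes>\<^bsub>?L\<^esub> cohn_map A B f (M l j)))"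
          by (rule S.finsum_cong', simp) (use that Mc Ic mc kA in \<open>auto simp: ring_hom_closed[OF h]\<close>)
        also have "\<dots> = k' (\<Oplus>\<^bsub>?L\<^esub>l\<in>{..<m}. ?c (InvEntry m n M i l) \<otimes>\<^bsub>?L\<^esub> cohn_map A B f (M l j))"
          by (subst K.hom_finsum) (use that Mc Ic mc in \<open>auto simp: comp_def\<close>)
        also have "\<dots> = (if i = j then \<one>\<^bsub>S\<^esub> else \<zero>\<^bsub>S\<^esub>)"
          using mi that by simp
        finally show ?thesis .
      qed
      ultimately show ?thesis
        using Ic by (auto simp: mutually_inverse_def matrices_def)
    qed
    have "k1 (?c t) = k2 (?c t)" if "t \<in> ?T" for t
      using that
    proof (induction rule: cohn_terms.induct)
      case (Emb a)
      then show ?case using k1 k2 by (simp add: cohn_map_def)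
    next
      case (InvEntry M m n i j)
      have hM: "(\<lambda>i j. h (M i j)) \<in> matrices S m n"
        using InvEntry(1) by (auto simp: inverted_matrices_def matrices_def ring_hom_closed[OF h])
      show ?case
        using matrix_inverse_unique[OF S hM _ _ _ _ InvEntry(2,3)]
          inv[OF \<open>cohn_factor A B f S h k1\<close> InvEntry(1)] inv[OF \<open>cohn_factor A B f S h k2\<close> InvEntry(1)]
        by blast
    next
      case (Add s t)
      have "k' (?c (Add s t)) = k' (?c s) \<oplus>\<^bsub>S\<^esub> k' (?c t)" if "k' \<in> ring_hom ?L S" for k'
        using ring_hom_add[OF that, of "?c s" "?c t"] Add(1,2) by (simp add: cohn_carrier cohn_add_class)
      then show ?case using Add k1 k2 by metis
    next
      case (Mul s t)
      have "k' (?c (Mul s t)) = k' (?c s) \<otimes>\<^bsub>S\<^esub> k' (?c t)" if "k' \<in> ring_hom ?L S" for k'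
        using ring_hom_mult[OF that, of "?c s" "?c t"] Mul(1,2) by (simp add: cohn_carrier cohn_mult_class)
      then show ?case using Mul k1 k2 by metis
    next
      case (Neg s)
      have "k' (?c (Neg s)) = \<ominus>\<^bsub>S\<^esub> k' (?c s)" if "k' \<in> ring_hom ?L S" for k'
      proof -
        interpret K: ring_hom_ring ?L S k'
          by (rule ring_hom_ringI2[OF L.ring_axioms S.ring_axioms that])
        have cl: "?c s \<in> carrier ?L" "?c (Neg s) \<in> carrier ?L"
          using Neg(1) by (auto simp: cohn_carrier intro: cohn_terms.Neg)
        have "?c (Neg s) \<oplus>\<^bsub>?L\<^esub> ?c s = \<zero>\<^bsub>?L\<^esub>"
          using Neg(1) cohn_class_eqI[OF cohn_eq.add_neg[OF Neg(1)]]
          by (simp add: cohn_add_class cohn_terms.Neg cohn_zero)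
        then have "?c (Neg s) = \<ominus>\<^bsub>?L\<^esub> ?c s"
          using cl L.minus_equality by metis
        then show ?thesis using cl by simp
      qed
      then show ?case using Neg k1 k2 by metis
    qed
    then have "\<forall>x\<in>carrier ?L. k1 x = k2 x" by (auto simp: cohn_carrier)
    then show ?thesis using k1 k2 by (blast intro: extensionalityI)
  qed
  ultimately show ?thesis by blast
qed


section \<open>Group rings\<close>

text \<open>The group ring of a finite group: all functions from \<open>G\<close> to \<open>R\<close>, with convolution.
  For an infinite group this would not be the group ring.\<close>

definition group_ring ::
    "('a, 'r) ring_scheme \<Rightarrow> ('g, 'm) monoid_scheme \<Rightarrow> ('g \<Rightarrow> 'a) ring" where
  "group_ring R G =
    \<lparr>carrier = carrier G \<rightarrow>\<^sub>E carrier R,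
     monoid.mult = (\<lambda>u v. \<lambda>g\<in>carrier G. \<Oplus>\<^bsub>R\<^esub>x\<in>carrier G. u x \<otimes>\<^bsub>R\<^esub> v (inv\<^bsub>G\<^esub> x \<otimes>\<^bsub>G\<^esub> g)),
     one = (\<lambda>g\<in>carrier G. if g = \<one>\<^bsub>G\<^esub> then \<one>\<^bsub>R\<^esub> else \<zero>\<^bsub>R\<^esub>),
     ring.zero = (\<lambda>g\<in>carrier G. \<zero>\<^bsub>R\<^esub>),
     add = (\<lambda>u v. \<lambda>g\<in>carrier G. u g \<oplus>\<^bsub>R\<^esub> v g)\<rparr>"

definition augmentation ::
    "('a, 'r) ring_scheme \<Rightarrow> ('g, 'm) monoid_scheme \<Rightarrow> ('g \<Rightarrow> 'a) \<Rightarrow> 'a" where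
  "augmentation R G u = (\<Oplus>\<^bsub>R\<^esub>g\<in>carrier G. u g)"

text \<open>The map \<open>R[G] \<rightarrow> R[H]\<close> induced by a group homomorphism \<open>\<pi> : G \<rightarrow> H\<close>, and the map
  \<open>R[G] \<rightarrow> S[G]\<close> induced by a ring homomorphism \<open>\<phi> : R \<rightarrow> S\<close>.\<close>

definition group_ring_push ::
    "('a, 'r) ring_scheme \<Rightarrow> ('g, 'm) monoid_scheme \<Rightarrow> ('h, 'n) monoid_scheme \<Rightarrow> ('g \<Rightarrow> 'h)
      \<Rightarrow> ('g \<Rightarrow> 'a) \<Rightarrow> ('h \<Rightarrow> 'a)" where
  "group_ring_push R G H \<pi> u = (\<lambda>y\<in>carrier H. \<Oplus>\<^bsub>R\<^esub>g\<in>{g \<in> carrier G. \<pi> g = y}. u g)"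

definition group_ring_coeff :: "('g, 'm) monoid_scheme \<Rightarrow> ('a \<Rightarrow> 'b) \<Rightarrow> ('g \<Rightarrow> 'a) \<Rightarrow> ('g \<Rightarrow> 'b)" where
  "group_ring_coeff G \<phi> u = (\<lambda>g\<in>carrier G. \<phi> (u g))"


section \<open>The rings in the pull-back square\<close>

text \<open>\<open>Z\<^sub>(\<^sub>p\<^sub>)\<close> as a subring of the rationals; \<open>b \<noteq> 0\<close> is implied, as \<open>p\<close> divides \<open>0\<close>.\<close>

definition Z_localized :: "nat \<Rightarrow> rat ring" where
  "Z_localized p =
    \<lparr>carrier = {rat_of_int a / rat_of_int b |a b. \<not> int p dvd b},
     monoid.mult = (*), one = 1, ring.zero = 0, add = (+)\<rparr>"

definition prime_to_p_subgroup :: "('g, 'm) monoid_scheme \<Rightarrow> nat \<Rightarrow> 'g set" where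
  "prime_to_p_subgroup G p = generate G {g \<in> carrier G. coprime (group.ord G g) p}"

definition p_quotient :: "('g, 'm) monoid_scheme \<Rightarrow> nat \<Rightarrow> 'g set monoid" where
  "p_quotient G p = G Mod prime_to_p_subgroup G p"

definition relevant_primes :: "('g, 'm) monoid_scheme \<Rightarrow> nat set" where
  "relevant_primes G = {p. Factorial_Ring.prime p \<and> carrier (p_quotient G p) \<noteq> {\<one>\<^bsub>p_quotient G p\<^esub>}}"

definition to_p_group_ring :: "('g, 'm) monoid_scheme \<Rightarrow> nat \<Rightarrow> ('g \<Rightarrow> int) \<Rightarrow> ('g set \<Rightarrow> rat)" where
  "to_p_group_ring G p =
    group_ring_coeff (p_quotient G p) rat_of_int \<circ>
    group_ring_push \<Z> G (p_quotient G p) (\<lambda>g. prime_to_p_subgroup G p #>\<^bsub>G\<^esub> g)"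

definition product_ring :: "'i set \<Rightarrow> ('i \<Rightarrow> ('a, 'r) ring_scheme) \<Rightarrow> ('i \<Rightarrow> 'a) ring" where
  "product_ring I R =
    \<lparr>carrier = (\<Pi>\<^sub>E i\<in>I. carrier (R i)),
     monoid.mult = (\<lambda>u v. \<lambda>i\<in>I. u i \<otimes>\<^bsub>R i\<^esub> v i),
     one = (\<lambda>i\<in>I. \<one>\<^bsub>R i\<^esub>),
     ring.zero = (\<lambda>i\<in>I. \<zero>\<^bsub>R i\<^esub>),
     add = (\<lambda>u v. \<lambda>i\<in>I. u i \<oplus>\<^bsub>R i\<^esub> v i)\<rparr>"

definition fibre_product ::
    "('a, 'r) ring_scheme \<Rightarrow> ('b, 's) ring_scheme \<Rightarrow> ('a \<Rightarrow> 'c) \<Rightarrow> ('b \<Rightarrow> 'c) \<Rightarrow> ('a \<times> 'b) ring" where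
  "fibre_product V W f g =
    (RDirProd V W)\<lparr>carrier := {(x, y). x \<in> carrier V \<and> y \<in> carrier W \<and> f x = g y}\<rparr>"

text \<open>The square with corners \<open>P\<close> (top left), \<open>W\<close> (top right), \<open>V\<close> (bottom left) and \<open>Z\<close>
  (bottom right), and maps \<open>a : P \<rightarrow> V\<close>, \<open>b : P \<rightarrow> W\<close>, \<open>f : V \<rightarrow> Z\<close>, \<open>g : W \<rightarrow> Z\<close>.
  Commutativity is implied by the last condition.\<close>

definition pullback_square ::
    "('p, 'q) ring_scheme \<Rightarrow> ('a, 'r) ring_scheme \<Rightarrow> ('b, 's) ring_scheme \<Rightarrow> ('c, 't) ring_scheme
      \<Rightarrow> ('p \<Rightarrow> 'a) \<Rightarrow> ('p \<Rightarrow> 'b) \<Rightarrow> ('a \<Rightarrow> 'c) \<Rightarrow> ('b \<Rightarrow> 'c) \<Rightarrow> bool" where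
  "pullback_square P V W Z a b f g \<longleftrightarrow>
    ring P \<and> ring V \<and> ring W \<and> ring Z \<and>
    a \<in> ring_hom P V \<and> b \<in> ring_hom P W \<and> f \<in> ring_hom V Z \<and> g \<in> ring_hom W Z \<and>
    (\<lambda>x. (a x, b x)) \<in> ring_iso P (fibre_product V W f g)"

end

theory Submission
  imports Defs "HOL-Algebra.Sylow" "HOL-Algebra.Group_Action"
begin

text \<open>
  Write \<open>A = Z[G]\<close>, let \<open>K\<^sub>p\<close> be the subgroup generated by the elements of order prime to \<open>p\<close>, and
  let \<open>D\<^sub>p\<close> be the right ideal of the localization generated by the \<open>1 - h\<close> for such elements \<open>h\<close>.

  As \<open>G\<^sub>p\<close> is a \<open>p\<close>-group, a matrix over \<open>Z\<^sub>(\<^sub>p\<^sub>)[G\<^sub>p]\<close> is invertible as soon as its augmentation is, so the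
  canonical maps exist.  If \<open>h\<close> has order \<open>m\<close> prime to \<open>q\<close>, with norm \<open>N = 1 + h + \<dots> + h^(m - 1)\<close> and
  \<open>a m + b q = 1\<close>, then \<open>a N + b q\<close> is invertible in the localization and multiplies \<open>1 - h\<close> by \<open>b q\<close>;
  hence \<open>1 - h\<close> is divisible by \<open>q\<close>.  Applied to elements \<open>h\<close> of \<open>p\<close>-power order this gives
  surjectivity onto the fibre product.

  Up to integers prime to \<open>p\<close>, the localization is generated by \<open>A\<close> modulo \<open>D\<^sub>p\<close>, so that \<open>D\<^sub>p\<close> is the
  kernel of the \<open>p\<close>-th canonical map up to such integers.  Divisibility of \<open>D\<^sub>p\<close> by \<open>p\<close>, together with the
  norm of \<open>K\<^sub>p\<close> annihilating \<open>D\<^sub>p\<close>, shows that the localization is torsion free.  An element \<open>x\<close> in the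
  kernel of all canonical maps is therefore annihilated by the norms of all the \<open>K\<^sub>p\<close>, and then \<open>A x\<close>
  has a submodule of finite index which is equal to its product with the augmentation ideal.  Finitely
  generated submodules with this property vanish, because matrices congruent to the identity modulo
  the augmentation ideal become invertible.
\<close>

section \<open>Linear systems over the localization of the integers at a prime\<close>

text \<open>The localization is known only through a presentation: it need not be commutative, and
  nothing says in advance that its elements have controlled denominators or that it is finitely
  generated. So no determinant is available, and the vanishing lemma can only be used for submodules
  of some \<open>A x\<close>. The hard point is a submodule of \<open>A x\<close> that is perfect,
  that is, equal to its product with the augmentation ideal, at all primes simultaneously. For
  \<open>h\<close> of order \<open>m\<close> with norm \<open>N\<close>, the element
  \<open>m - N\<close> has augmentation zero and multiplies \<open>1 - h\<close> by
  \<open>m\<close>; hence products with such \<open>1 - h\<close> are perfect at \<open>p\<close>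
  when \<open>m\<close> is prime to \<open>p\<close>. This yields one candidate for each
  \<open>p\<close>, with no control at the other primes. The candidates are glued by weighting the
  one for \<open>p\<close> with the part of the order of \<open>G\<close> prime to \<open>p\<close>,
  so that at another prime \<open>l\<close> it is absorbed by the candidate for \<open>l\<close>.
  That needs finite index: as the norm of \<open>K_p\<close> kills \<open>x\<close>, the sum of the
  \<open>(1 - k) x\<close> over \<open>K_p\<close> is the order of \<open>K_p\<close> times
  \<open>x\<close>.\<close>

abbreviation Zp :: "nat \<Rightarrow> rat set" where "Zp p \<equiv> carrier (Z_localized p)"

lemma Zp_iff: "x \<in> Zp p \<longleftrightarrow> (\<exists>a b. x = rat_of_int a / rat_of_int b \<and> \<not> int p dvd b)"
  by (auto simp: Z_localized_def)

lemma Zp_ring_simps [simp]: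
  "\<zero>\<^bsub>Z_localized p\<^esub> = 0" "\<one>\<^bsub>Z_localized p\<^esub> = 1"
  "x \<oplus>\<^bsub>Z_localized p\<^esub> y = x + y" "x \<otimes>\<^bsub>Z_localized p\<^esub> y = x * y"
  by (simp_all add: Z_localized_def)

locale prime_nat =
  fixes p :: nat
  assumes prime_p: "Factorial_Ring.prime p"
begin

lemma prime_int_p: "Factorial_Ring.prime (int p)"
  using prime_p by simp

lemma p_gt_1: "1 < p" using prime_p by (rule prime_gt_1_nat)

lemma not_dvd_mult: "\<not> int p dvd a \<Longrightarrow> \<not> int p dvd b \<Longrightarrow> \<not> int p dvd a * b"
  using prime_int_p by (simp add: prime_dvd_mult_iff)

lemma Zp_of_int [simp]: "rat_of_int a \<in> Zp p"
  unfolding Zp_iff using p_gt_1 by (intro exI[of _ a] exI[of _ 1]) auto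

lemma Zp_0 [simp]: "0 \<in> Zp p" and Zp_1 [simp]: "1 \<in> Zp p"
  using Zp_of_int[of 0] Zp_of_int[of 1] by simp_all

lemma Zp_add [simp]: "x \<in> Zp p \<Longrightarrow> y \<in> Zp p \<Longrightarrow> x + y \<in> Zp p"
proof -
  assume "x \<in> Zp p" "y \<in> Zp p"
  then obtain a b c d where *: "x = rat_of_int a / rat_of_int b" "\<not> int p dvd b"
    "y = rat_of_int c / rat_of_int d" "\<not> int p dvd d" by (auto simp: Zp_iff)
  then have "b \<noteq> 0" "d \<noteq> 0" by auto
  then have "x + y = rat_of_int (a * d + c * b) / rat_of_int (b * d)"
    using * by (simp add: field_simps)
  then show ?thesis using not_dvd_mult * unfolding Zp_iff by blast
qed

lemma Zp_mult [simp]: "x \<in> Zp p \<Longrightarrow> y \<in> Zp p \<Longrightarrow> x * y \<in> Zp p"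
proof -
  assume "x \<in> Zp p" "y \<in> Zp p"
  then obtain a b c d where *: "x = rat_of_int a / rat_of_int b" "\<not> int p dvd b"
    "y = rat_of_int c / rat_of_int d" "\<not> int p dvd d" by (auto simp: Zp_iff)
  then have "x * y = rat_of_int (a * c) / rat_of_int (b * d)" by simp
  then show ?thesis using not_dvd_mult * unfolding Zp_iff by blast
qed

lemma Zp_minus [simp]: "x \<in> Zp p \<Longrightarrow> - x \<in> Zp p"
  using Zp_mult[OF Zp_of_int[of "-1"]] by simp

lemma Zp_diff [simp]: "x \<in> Zp p \<Longrightarrow> y \<in> Zp p \<Longrightarrow> x - y \<in> Zp p"
  using Zp_add[OF _ Zp_minus] by fastforce

lemma Zp_sum [simp]: "(\<And>i. i \<in> A \<Longrightarrow> f i \<in> Zp p) \<Longrightarrow> sum f A \<in> Zp p"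
  by (induction A rule: infinite_finite_induct) auto

lemma inverse_p_notin_Zp: "1 / rat_of_nat p \<notin> Zp p"
proof
  assume "1 / rat_of_nat p \<in> Zp p"
  then obtain a b where *: "1 / rat_of_nat p = rat_of_int a / rat_of_int b" "\<not> int p dvd b"
    by (auto simp: Zp_iff)
  then have "b \<noteq> 0" by auto
  then have "rat_of_int b = rat_of_int (a * int p)"
    using * p_gt_1 by (simp add: field_simps)
  then show False using * by (simp only: of_int_eq_iff) simp
qed

text \<open>Divisibility by \<open>p\<close> is expressed throughout by
  \<open>x / rat_of_nat p \<in> Zp p\<close>, so that no residue field has to be formed; in this
  local ring its failure means being a unit.\<close>

lemma Zp_unit: "x \<in> Zp p \<Longrightarrow> x / rat_of_nat p \<notin> Zp p \<Longrightarrow> x \<noteq> 0 \<and> 1 / x \<in> Zp p"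
proof -
  assume "x \<in> Zp p" and n: "x / rat_of_nat p \<notin> Zp p"
  then obtain a b where *: "x = rat_of_int a / rat_of_int b" "\<not> int p dvd b"
    by (auto simp: Zp_iff)
  have "\<not> int p dvd a"
  proof
    assume "int p dvd a"
    then obtain c where "a = int p * c" by auto
    then have "x / rat_of_nat p = rat_of_int c / rat_of_int b" using * p_gt_1 by simp
    then show False using n * unfolding Zp_iff by blast
  qed
  moreover have "1 / x = rat_of_int b / rat_of_int a" using * by simp
  moreover have "x \<noteq> 0" using n by auto
  ultimately show ?thesis unfolding Zp_iff by blast
qed

text \<open>Brings the finitely many coefficients of an element of Z_(p)[G_p] back to the integers,
  at the cost of a factor \<open>q\<close> prime to \<open>p\<close>.\<close>

lemma Zp_common_denominator:
  assumes "finite A" "\<And>i. i \<in> A \<Longrightarrow> f i \<in> Zp p"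
  shows "\<exists>q. \<not> int p dvd q \<and> (\<forall>i\<in>A. \<exists>a. rat_of_int q * f i = rat_of_int a)"
  using assms
proof (induction A)
  case empty
  then show ?case using p_gt_1 by (intro exI[of _ 1]) auto
next
  case (insert x A)
  then obtain q where q: "\<not> int p dvd q" "\<forall>i\<in>A. \<exists>a. rat_of_int q * f i = rat_of_int a" by auto
  obtain a b where ab: "f x = rat_of_int a / rat_of_int b" "\<not> int p dvd b"
    using insert.prems[of x] unfolding Zp_iff by blast
  then have b0: "b \<noteq> 0" by auto
  have "\<exists>c. rat_of_int (q * b) * f i = rat_of_int c" if "i \<in> insert x A" for i
  proof (cases "i = x")
    case True
    then show ?thesis using ab b0 by (intro exI[of _ "q * a"]) simp
  next
    case False
    then have "i \<in> A" using that by simp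
    with q(2) obtain a where "rat_of_int q * f i = rat_of_int a" by auto
    then show ?thesis by (intro exI[of _ "b * a"]) (simp add: ac_simps)
  qed
  then show ?case using not_dvd_mult[OF q(1) ab(2)] by blast
qed

text \<open>The representative is \<open>a u mod p\<close>, where \<open>u\<close> inverts the
  denominator modulo \<open>p\<close>. Such representatives make the solutions of a linear system
  modulo \<open>p\<close> a finite set, which can be counted.\<close>

lemma Zp_residue:
  assumes "x \<in> Zp p"
  shows "\<exists>r\<in>{0..<int p}. (x - rat_of_int r) / rat_of_nat p \<in> Zp p"
proof -
  obtain a b where ab: "x = rat_of_int a / rat_of_int b" "\<not> int p dvd b"
    using assms by (auto simp: Zp_iff)
  then have b0: "b \<noteq> 0" by auto
  have "coprime b (int p)"
    using prime_imp_coprime[OF prime_int_p ab(2)] by (simp add: coprime_commute)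
  then obtain u v where uv: "u * b + v * int p = 1"
    by (metis bezout_int coprime_imp_gcd_eq_1)
  define r d where "r = (a * u) mod int p" and "d = (a * u) div int p"
  have au: "a * u = int p * d + r" by (simp add: r_def d_def)
  have "a = a * (u * b + v * int p)" using uv by simp
  also have "\<dots> = (a * u) * b + a * v * int p" by (simp add: algebra_simps)
  also have "\<dots> = (int p * d + r) * b + a * v * int p" by (metis au)
  finally have "a - r * b = int p * (d * b + a * v)" by (simp add: algebra_simps)
  then have "rat_of_int a - rat_of_int r * rat_of_int b = rat_of_nat p * rat_of_int (d * b + a * v)"
    by (metis of_int_diff of_int_mult of_int_of_nat_eq)
  then have "(x - rat_of_int r) / rat_of_nat p = rat_of_int (d * b + a * v) / rat_of_int b"
    using ab b0 p_gt_1 by (simp add: field_simps)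
  moreover have "r \<in> {0..<int p}" using p_gt_1 by (simp add: r_def)
  ultimately show ?thesis using ab(2) unfolding Zp_iff by blast
qed

lemma Zp_int_div_p: "rat_of_int a / rat_of_nat p \<in> Zp p \<Longrightarrow> int p dvd a"
proof -
  assume "rat_of_int a / rat_of_nat p \<in> Zp p"
  then obtain c d where *: "rat_of_int a / rat_of_nat p = rat_of_int c / rat_of_int d" "\<not> int p dvd d"
    by (auto simp: Zp_iff)
  then have "d \<noteq> 0" by auto
  then have "rat_of_int (a * d) = rat_of_int (c * int p)"
    using * p_gt_1 by (simp add: field_simps)
  then have "int p dvd a * d" by (simp only: of_int_eq_iff) simp
  then show ?thesis using * prime_int_p by (simp add: prime_dvd_mult_iff)
qed

text \<open>Gaussian elimination: the matrix is injective modulo \<open>p\<close>, so each column contains a pivot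
  that is a unit.\<close>

lemma Zp_linear_system:
  assumes "finite J" "finite I" "card I = card J"
    and "\<And>i j. i \<in> I \<Longrightarrow> j \<in> J \<Longrightarrow> D i j \<in> Zp p"
    and "\<And>w. \<lbrakk>\<And>j. j \<in> J \<Longrightarrow> w j \<in> Zp p; \<And>i. i \<in> I \<Longrightarrow> (\<Sum>j\<in>J. D i j * w j) / rat_of_nat p \<in> Zp p\<rbrakk>
      \<Longrightarrow> \<forall>j\<in>J. w j / rat_of_nat p \<in> Zp p"
    and "\<And>i. i \<in> I \<Longrightarrow> c i \<in> Zp p"
  shows "\<exists>w. (\<forall>j\<in>J. w j \<in> Zp p) \<and> (\<forall>i\<in>I. (\<Sum>j\<in>J. D i j * w j) = c i)"
  using assms
proof (induction J arbitrary: I D c)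
  case empty
  then show ?case by auto
next
  case (insert j0 J)
  have D: "D i j \<in> Zp p" if "i \<in> I" "j \<in> insert j0 J" for i j using insert.prems(3) that by blast
  \<comment> \<open>If the column \<open>j0\<close> were divisible by \<open>p\<close>, the unit
    vector at \<open>j0\<close> would be a solution modulo \<open>p\<close> that is not divisible by
    \<open>p\<close>.\<close>
  have "\<exists>i\<in>I. D i j0 / rat_of_nat p \<notin> Zp p"
  proof (rule ccontr)
    assume "\<not> ?thesis"
    then have *: "D i j0 / rat_of_nat p \<in> Zp p" if "i \<in> I" for i using that by blast
    have s: "(\<Sum>j\<in>insert j0 J. D i j * (if j = j0 then 1 else 0)) = D i j0" for i
      unfolding sum.insert[OF insert.hyps]
      using insert.hyps by (auto intro!: sum.neutral)
    have "\<forall>j\<in>insert j0 J. (if j = j0 then 1 else 0) / rat_of_nat p \<in> Zp p"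
      by (rule insert.prems(4)) (use * s in auto)
    then show False using inverse_p_notin_Zp by auto
  qed
  then obtain i0 where i0: "i0 \<in> I" "D i0 j0 / rat_of_nat p \<notin> Zp p" by blast
  define u where "u = D i0 j0"
  have u: "u \<noteq> 0" "1 / u \<in> Zp p" using Zp_unit[OF D[of i0 j0]] i0 by (auto simp: u_def)
  have divu: "x / u \<in> Zp p" if "x \<in> Zp p" for x using Zp_mult[OF that u(2)] by simp
  \<comment> \<open>\<open>E\<close> and \<open>d\<close> result from clearing the column
    \<open>j0\<close> with the pivot row. \<open>ext e w\<close> adds to \<open>w\<close> the
    coordinate at \<open>j0\<close> that gives the pivot row the value \<open>e\<close>: with
    \<open>e = 0\<close> it transports kernel vectors modulo \<open>p\<close>, with
    \<open>e = c i0\<close> solutions.\<close>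
  define I' where "I' = I - {i0}"
  define E where "E = (\<lambda>i j. D i j - D i j0 * (D i0 j / u))"
  define d where "d = (\<lambda>i. c i - D i j0 * (c i0 / u))"
  define ext where "ext = (\<lambda>e w j. if j = j0 then (e - (\<Sum>j\<in>J. D i0 j * w j)) / u else w j)"
  have sum_ext: "(\<Sum>j\<in>insert j0 J. D i j * ext e w j)
      = D i j0 * ((e - (\<Sum>j\<in>J. D i0 j * w j)) / u) + (\<Sum>j\<in>J. D i j * w j)" for i e w
    unfolding sum.insert[OF insert.hyps] ext_def using insert.hyps(2) by (simp cong: sum.cong) (auto intro!: sum.cong)
  have sum_E: "(\<Sum>j\<in>J. E i j * w j) = (\<Sum>j\<in>J. D i j * w j) - D i j0 * ((\<Sum>j\<in>J. D i0 j * w j) / u)" for i w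
    by (simp add: E_def left_diff_distrib sum_subtractf sum_distrib_left sum_divide_distrib mult.assoc)
  have row: "(\<Sum>j\<in>insert j0 J. D i j * ext e w j) = (\<Sum>j\<in>J. E i j * w j) + D i j0 * (e / u)" for i e w
    unfolding sum_ext sum_E by (simp add: diff_divide_distrib right_diff_distrib)
  have row0: "(\<Sum>j\<in>insert j0 J. D i0 j * ext e w j) = e" for e w
    unfolding sum_ext u_def[symmetric] using u by simp
  have ext: "ext e w j \<in> Zp p" if "e \<in> Zp p" "\<And>j. j \<in> J \<Longrightarrow> w j \<in> Zp p" "j \<in> insert j0 J" for e w j
    using that i0 insert.hyps unfolding ext_def by (auto intro!: divu Zp_diff Zp_sum Zp_mult D)
  have "\<exists>w. (\<forall>j\<in>J. w j \<in> Zp p) \<and> (\<forall>i\<in>I'. (\<Sum>j\<in>J. E i j * w j) = d i)"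
  proof (rule insert.IH)
    show "finite I'" "card I' = card J"
      using insert.prems(1,2) insert.hyps i0(1) by (auto simp: I'_def)
    show "E i j \<in> Zp p" if "i \<in> I'" "j \<in> J" for i j
      using that i0 unfolding E_def I'_def by (auto intro!: divu Zp_diff Zp_sum Zp_mult D)
    show "d i \<in> Zp p" if "i \<in> I'" for i
      using that i0 insert.prems(5) unfolding d_def I'_def by (auto intro!: divu Zp_diff Zp_sum Zp_mult D)
  next
    fix w assume w: "\<And>j. j \<in> J \<Longrightarrow> w j \<in> Zp p"
      and Ew: "\<And>i. i \<in> I' \<Longrightarrow> (\<Sum>j\<in>J. E i j * w j) / rat_of_nat p \<in> Zp p"
    have "\<forall>j\<in>insert j0 J. ext 0 w j / rat_of_nat p \<in> Zp p"
    proof (rule insert.prems(4))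
      show "ext 0 w j \<in> Zp p" if "j \<in> insert j0 J" for j using ext w that by auto
      show "(\<Sum>j\<in>insert j0 J. D i j * ext 0 w j) / rat_of_nat p \<in> Zp p" if "i \<in> I" for i
        using that Ew[of i] row[of i 0 w] row0[of 0 w] by (cases "i = i0") (auto simp: I'_def)
    qed
    then show "\<forall>j\<in>J. w j / rat_of_nat p \<in> Zp p" using insert.hyps(2) by (auto simp: ext_def split: if_splits)
  qed
  then obtain w where w: "\<forall>j\<in>J. w j \<in> Zp p" "\<forall>i\<in>I'. (\<Sum>j\<in>J. E i j * w j) = d i" by blast
  have "(\<Sum>j\<in>insert j0 J. D i j * ext (c i0) w j) = c i" if "i \<in> I" for i
    using that w(2) row[of i "c i0" w] row0[of "c i0" w] by (cases "i = i0") (auto simp: I'_def d_def)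
  moreover have "\<forall>j\<in>insert j0 J. ext (c i0) w j \<in> Zp p"
    using ext w(1) insert.prems(5)[OF i0(1)] by blast
  ultimately show ?case by blast
qed

end

section \<open>Congruences modulo the augmentation ideal of a finite p-group\<close>

text \<open>Orbit sizes divide \<open>p ^ k\<close>, so an orbit other than a single fixed point
  contributes a multiple of \<open>p\<close>. The function \<open>?f\<close> is the indicator of the
  points that are not fixed, summed orbit by orbit.\<close>

lemma (in group_action) card_fixed_points_mod:
  assumes "finite E" "order G = p ^ k" "Factorial_Ring.prime p"
  shows "card E mod p = card {x \<in> E. \<forall>g\<in>carrier G. \<phi> g x = x} mod p"
proof -
  let ?F = "{x \<in> E. \<forall>g\<in>carrier G. \<phi> g x = x}"
  let ?f = "\<lambda>x. if x \<in> ?F then 0 else 1 :: nat"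
  have "p dvd (\<Sum>x\<in>orb. ?f x)" if orb: "orb \<in> orbits G E \<phi>" for orb
  proof -
    obtain x where x: "x \<in> E" "orb = orbit G \<phi> x" using orb by (auto simp: orbits_def)
    have xo: "x \<in> orb" using x orbit_refl by simp
    have oE: "orb \<subseteq> E" using x element_image by (auto simp: orbit_def)
    then have fin: "finite orb" using assms(1) finite_subset by blast
    show ?thesis
    proof (cases "\<exists>y\<in>orb. y \<in> ?F")
      case True
      then obtain y where y: "y \<in> orb" "y \<in> ?F" by blast
      then have "x \<in> orbit G \<phi> y" using x orbit_sym[of x y] by auto
      then have "x = y" using y by (auto simp: orbit_def)
      then have "orb = {y}" using x y by (auto simp: orbit_def)
      then show ?thesis using y by simp
    next
      case False
      then have "(\<Sum>x\<in>orb. ?f x) = (\<Sum>x\<in>orb. 1)" by (intro sum.cong) auto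
      then have eq: "(\<Sum>x\<in>orb. ?f x) = card orb" by simp
      have "card orb dvd p ^ k"
        using orbit_stabilizer_theorem[OF x(1)] assms(2) x(2) by (metis dvd_triv_left)
      then obtain i where i: "card orb = p ^ i" using assms(3) divides_primepow_nat by blast
      have "card orb \<noteq> 1"
      proof
        assume "card orb = 1"
        then have "orb = {x}" using xo by (metis card_1_singletonE singletonD)
        then have "x \<in> ?F" using x by (auto simp: orbit_def)
        then show False using False xo by blast
      qed
      then have "i \<noteq> 0" using i by (cases i) auto
      then show ?thesis using eq i by (metis dvd_power not_gr0)
    qed
  qed
  then have "p dvd (\<Sum>orb\<in>orbits G E \<phi>. \<Sum>x\<in>orb. ?f x)" by (rule dvd_sum)
  then have "p dvd (\<Sum>x\<in>E. ?f x)" by (simp only: disjoint_sum[OF assms(1)])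
  moreover have "(\<Sum>x\<in>E. ?f x) = (\<Sum>x\<in>E - ?F. 1)"
    by (rule sum.mono_neutral_cong_right) (use assms(1) in auto)
  ultimately obtain c where c: "card (E - ?F) = p * c" by auto
  have "card E = card (E - ?F) + card ?F"
    by (subst card_Un_disjoint[symmetric]) (use assms(1) in \<open>auto intro: arg_cong[where f = card]\<close>)
  then show ?thesis using c by simp
qed

locale finite_p_group = prime_nat p + group G for p and G (structure) +
  fixes k :: nat
  assumes finite_G: "finite (carrier G)" and order_G: "order G = p ^ k"
begin

text \<open>The product of the matrix \<open>X\<close> over the group ring with a column
  \<open>w\<close>. The column is flattened to a function of pairs, so that it is also a vector of
  unknowns over Z_(p).\<close>

definition conv_op :: "nat \<Rightarrow> (nat \<Rightarrow> nat \<Rightarrow> 'a \<Rightarrow> rat) \<Rightarrow> (nat \<times> 'a \<Rightarrow> rat) \<Rightarrow> nat \<Rightarrow> 'a \<Rightarrow> rat" where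
  "conv_op n X w i x = (\<Sum>j<n. \<Sum>y\<in>carrier G. X i j y * w (j, inv y \<otimes> x))"

lemma conv_op_add: "conv_op n X (\<lambda>z. u z + v z) i x = conv_op n X u i x + conv_op n X v i x"
  by (simp add: conv_op_def sum.distrib ring_distribs)

lemma conv_op_scale: "conv_op n X (\<lambda>z. a * u z) i x = a * conv_op n X u i x"
  by (simp add: conv_op_def sum_distrib_left mult.left_commute)

lemma conv_op_closed:
  assumes "\<And>j y. j < n \<Longrightarrow> y \<in> carrier G \<Longrightarrow> X i j y \<in> Zp p"
    and "\<And>j y. j < n \<Longrightarrow> y \<in> carrier G \<Longrightarrow> w (j, y) \<in> Zp p" and "x \<in> carrier G"
  shows "conv_op n X w i x \<in> Zp p"
  unfolding conv_op_def using assms by (auto intro!: Zp_sum Zp_mult)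

section \<open>The kernel of 1 - X modulo p for a matrix X of augmentation zero\<close>

context
  fixes n :: nat and X :: "nat \<Rightarrow> nat \<Rightarrow> 'a \<Rightarrow> rat"
  assumes X: "\<And>i j y. i < n \<Longrightarrow> j < n \<Longrightarrow> y \<in> carrier G \<Longrightarrow> X i j y \<in> Zp p"
    and aug: "\<And>i j. i < n \<Longrightarrow> j < n \<Longrightarrow> (\<Sum>y\<in>carrier G. X i j y) = 0"
begin

text \<open>The kernel of \<open>1 - X\<close> modulo \<open>p\<close>, without passing to a
  quotient; for columns over Z_(p) the condition depends only on the residues of the
  entries.\<close>

definition mod_fixed :: "(nat \<times> 'a \<Rightarrow> rat) \<Rightarrow> bool" where
  "mod_fixed w \<longleftrightarrow>
    (\<forall>i<n. \<forall>x\<in>carrier G. (w (i, x) - conv_op n X w i x) / rat_of_nat p \<in> Zp p)"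

lemma mod_fixed_add: "mod_fixed u \<Longrightarrow> mod_fixed v \<Longrightarrow> mod_fixed (\<lambda>z. u z + v z)"
  unfolding mod_fixed_def conv_op_add
  by (metis (no_types, opaque_lifting) Zp_add add_diff_add add_divide_distrib)

lemma mod_fixed_scale:
  assumes "mod_fixed u" "a \<in> Zp p"
  shows "mod_fixed (\<lambda>z. a * u z)"
  unfolding mod_fixed_def conv_op_scale
proof (intro allI impI ballI)
  fix i x assume "i < n" "x \<in> carrier G"
  then have "a * ((u (i, x) - conv_op n X u i x) / rat_of_nat p) \<in> Zp p"
    using assms by (intro Zp_mult) (auto simp: mod_fixed_def)
  then show "(a * u (i, x) - a * conv_op n X u i x) / rat_of_nat p \<in> Zp p"
    by (simp add: right_diff_distrib)
qed

lemma mod_fixed_p: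
  assumes "\<And>j y. j < n \<Longrightarrow> y \<in> carrier G \<Longrightarrow> u (j, y) \<in> Zp p"
  shows "mod_fixed (\<lambda>z. rat_of_nat p * u z)"
  unfolding mod_fixed_def conv_op_scale
proof (intro allI impI ballI)
  fix i x assume ix: "i < n" "x \<in> carrier G"
  have "u (i, x) - conv_op n X u i x \<in> Zp p"
    using assms ix X by (intro Zp_diff conv_op_closed) auto
  then show "(rat_of_nat p * u (i, x) - rat_of_nat p * conv_op n X u i x) / rat_of_nat p \<in> Zp p"
    using p_gt_1 by (simp flip: right_diff_distrib)
qed

lemma mod_fixed_cong:
  assumes "mod_fixed u"
    and v: "\<And>j y. j < n \<Longrightarrow> y \<in> carrier G \<Longrightarrow> (v (j, y) - u (j, y)) / rat_of_nat p \<in> Zp p"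
  shows "mod_fixed v"
proof -
  let ?d = "\<lambda>z. (v z - u z) / rat_of_nat p"
  have "mod_fixed (\<lambda>z. u z + rat_of_nat p * ?d z)"
    using assms by (intro mod_fixed_add mod_fixed_p) auto
  then show ?thesis using p_gt_1 by simp
qed

text \<open>The same kernel with each class represented by integers in \<open>{0..<int p}\<close>,
  hence a finite set.\<close>

definition residue_solutions :: "(nat \<times> 'a \<Rightarrow> int) set" where
  "residue_solutions =
    {w \<in> ({..<n} \<times> carrier G) \<rightarrow>\<^sub>E {0..<int p}. mod_fixed (\<lambda>z. rat_of_int (w z))}"

text \<open>Right translation commutes with the left multiplication by \<open>X\<close> and
  therefore preserves the kernel. The outer restriction makes it extensional, as membership in
  \<open>Bij residue_solutions\<close> demands.\<close>

definition translate :: "'a \<Rightarrow> (nat \<times> 'a \<Rightarrow> int) \<Rightarrow> (nat \<times> 'a \<Rightarrow> int)" where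
  "translate g = (\<lambda>w\<in>residue_solutions. \<lambda>z\<in>{..<n} \<times> carrier G. w (fst z, snd z \<otimes> g))"

lemma finite_residue_solutions: "finite residue_solutions"
  by (rule finite_subset[of _ "({..<n} \<times> carrier G) \<rightarrow>\<^sub>E {0..<int p}"])
    (auto simp: residue_solutions_def finite_G intro!: finite_PiE)

lemma translate_closed:
  assumes "g \<in> carrier G" "w \<in> residue_solutions"
  shows "translate g w \<in> residue_solutions"
proof -
  have w: "w \<in> ({..<n} \<times> carrier G) \<rightarrow>\<^sub>E {0..<int p}" "mod_fixed (\<lambda>z. rat_of_int (w z))"
    using assms(2) by (auto simp: residue_solutions_def)
  have "mod_fixed (\<lambda>z. rat_of_int (translate g w z))"
    unfolding mod_fixed_def
  proof (intro allI impI ballI)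
    fix i x assume ix: "i < n" "x \<in> carrier G"
    have "conv_op n X (\<lambda>z. rat_of_int (translate g w z)) i x
        = conv_op n X (\<lambda>z. rat_of_int (w z)) i (x \<otimes> g)"
      unfolding conv_op_def using assms ix by (auto intro!: sum.cong simp: translate_def m_assoc)
    then show "(rat_of_int (translate g w (i, x)) - conv_op n X (\<lambda>z. rat_of_int (translate g w z)) i x)
        / rat_of_nat p \<in> Zp p"
      using w(2) ix assms by (simp add: mod_fixed_def translate_def)
  qed
  moreover have "translate g w \<in> ({..<n} \<times> carrier G) \<rightarrow>\<^sub>E {0..<int p}"
    using w(1) assms by (auto simp: translate_def PiE_iff)
  ultimately show ?thesis by (simp add: residue_solutions_def)
qed

lemma translate_mult:
  assumes "g \<in> carrier G" "h \<in> carrier G" "w \<in> residue_solutions"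
  shows "translate (g \<otimes> h) w = translate g (translate h w)"
  using assms translate_closed[OF assms(2,3)]
  by (auto simp: translate_def m_assoc fun_eq_iff)

lemma translate_one: "w \<in> residue_solutions \<Longrightarrow> translate \<one> w = w"
  by (rule PiE_ext[of _ "{..<n} \<times> carrier G" "\<lambda>_. UNIV" _]) (auto simp: translate_def residue_solutions_def PiE_iff)

lemma translate_action: "group_action G residue_solutions translate"
  unfolding group_action_def
proof (rule group_hom.intro)
  show "group G" by (rule is_group)
  show "group (BijGroup residue_solutions)" by (rule group_BijGroup)
  have bij: "translate g \<in> Bij residue_solutions" if "g \<in> carrier G" for g
  proof -
    have "bij_betw (translate g) residue_solutions residue_solutions"
      by (rule bij_betw_byWitness[where f' = "translate (inv g)"])
        (use that in \<open>auto simp: translate_closed translate_one simp flip: translate_mult\<close>)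
    then show ?thesis by (simp add: Bij_def translate_def)
  qed
  have "translate (g \<otimes> h) = compose residue_solutions (translate g) (translate h)"
    if "g \<in> carrier G" "h \<in> carrier G" for g h
  proof
    fix w
    show "translate (g \<otimes> h) w = compose residue_solutions (translate g) (translate h) w"
      by (cases "w \<in> residue_solutions")
        (use that in \<open>simp_all add: compose_def translate_mult, simp add: translate_def\<close>)
  qed
  then show "group_hom_axioms G (BijGroup residue_solutions) translate"
    by (intro group_hom_axioms.intro homI) (use bij in \<open>auto simp: BijGroup_def\<close>)
qed

text \<open>An invariant column is constant in the group coordinate, so \<open>X\<close> acts on it
  through its augmentations, which vanish. Then \<open>w - X w = w\<close> is divisible by
  \<open>p\<close>, and a representative in \<open>{0..<int p}\<close> divisible by \<open>p\<close>
  is zero.\<close>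

lemma translate_fixed:
  assumes "w \<in> residue_solutions" "\<And>g. g \<in> carrier G \<Longrightarrow> translate g w = w"
  shows "w = (\<lambda>z\<in>{..<n} \<times> carrier G. 0)"
proof -
  have const: "w (j, x) = w (j, \<one>)" if "j < n" "x \<in> carrier G" for j x
  proof -
    have "w (j, \<one>) = translate x w (j, \<one>)" using assms(2)[OF that(2)] by simp
    then show ?thesis using that assms(1) by (simp add: translate_def)
  qed
  have w: "w \<in> ({..<n} \<times> carrier G) \<rightarrow>\<^sub>E {0..<int p}" "mod_fixed (\<lambda>z. rat_of_int (w z))"
    using assms(1) by (auto simp: residue_solutions_def)
  have "w (i, x) = 0" if ix: "i < n" "x \<in> carrier G" for i x
  proof -
    have "conv_op n X (\<lambda>z. rat_of_int (w z)) i x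
        = (\<Sum>j<n. \<Sum>y\<in>carrier G. X i j y * rat_of_int (w (j, \<one>)))"
      unfolding conv_op_def
      by (intro sum.cong HOL.refl arg_cong2[where f = "(*)"] arg_cong[where f = rat_of_int] const)
        (use ix in auto)
    also have "\<dots> = 0" using aug ix by (simp flip: sum_distrib_right)
    finally have conv0: "conv_op n X (\<lambda>z. rat_of_int (w z)) i x = 0" .
    have "(rat_of_int (w (i, x)) - conv_op n X (\<lambda>z. rat_of_int (w z)) i x) / rat_of_nat p \<in> Zp p"
      using w(2) ix unfolding mod_fixed_def by blast
    then have "rat_of_int (w (i, x)) / rat_of_nat p \<in> Zp p"
      unfolding conv0 by simp
    then have "int p dvd w (i, x)" by (rule Zp_int_div_p)
    moreover have "w (i, x) \<in> {0..<int p}" using w(1) ix by (auto simp: PiE_iff)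
    ultimately show ?thesis by (auto dest: zdvd_imp_le)
  qed
  then show ?thesis
    by (intro PiE_ext[OF w(1)]) (use p_gt_1 in auto)
qed

text \<open>The kernel as an elementary abelian group: its only purpose is that a nonzero element
  has order \<open>p\<close>, so that \<open>p\<close> divides the number of solutions.\<close>

definition residue_group :: "(nat \<times> 'a \<Rightarrow> int) monoid" where
  "residue_group = \<lparr>carrier = residue_solutions,
    monoid.mult = (\<lambda>u v. \<lambda>z\<in>{..<n} \<times> carrier G. (u z + v z) mod int p),
    one = (\<lambda>z\<in>{..<n} \<times> carrier G. 0)\<rparr>"

lemma residue_solutionsI:
  assumes "mod_fixed (\<lambda>z. rat_of_int (f z))"
  shows "(\<lambda>z\<in>{..<n} \<times> carrier G. f z mod int p) \<in> residue_solutions"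
proof -
  have "(rat_of_int (a mod int p) - rat_of_int a) / rat_of_nat p \<in> Zp p" for a
  proof -
    have "a mod int p - a = int p * - (a div int p)" by (simp add: minus_div_mult_eq_mod[symmetric])
    then have "rat_of_int (a mod int p) - rat_of_int a = rat_of_nat p * rat_of_int (- (a div int p))"
      by (metis of_int_diff of_int_mult of_int_of_nat_eq)
    then show ?thesis using p_gt_1 by simp
  qed
  then have "mod_fixed (\<lambda>z. rat_of_int ((\<lambda>z\<in>{..<n} \<times> carrier G. f z mod int p) z))"
    by (intro mod_fixed_cong[OF assms]) auto
  then show ?thesis using p_gt_1 by (auto simp: residue_solutions_def)
qed

lemma residue_group: "group residue_group"
proof (rule groupI)
  have mf: "mod_fixed (\<lambda>z. rat_of_int (u z))" if "u \<in> residue_solutions" for u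
    using that by (simp add: residue_solutions_def)
  show "u \<otimes>\<^bsub>residue_group\<^esub> v \<in> carrier residue_group"
    if "u \<in> carrier residue_group" "v \<in> carrier residue_group" for u v
    using residue_solutionsI[of "\<lambda>z. u z + v z"] mod_fixed_add[OF mf mf] that
    by (simp add: residue_group_def)
  have zero: "(\<lambda>z\<in>{..<n} \<times> carrier G. 0) \<in> residue_solutions"
    using residue_solutionsI[of "\<lambda>z. 0"] by (simp add: mod_fixed_def conv_op_def)
  then show "\<one>\<^bsub>residue_group\<^esub> \<in> carrier residue_group" by (simp add: residue_group_def)
  show "\<one>\<^bsub>residue_group\<^esub> \<otimes>\<^bsub>residue_group\<^esub> u = u" if "u \<in> carrier residue_group" for u
  proof (rule PiE_ext[of _ "{..<n} \<times> carrier G" "\<lambda>_. UNIV"])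
    show "u \<in> ({..<n} \<times> carrier G) \<rightarrow>\<^sub>E UNIV"
      using that by (auto simp: residue_group_def residue_solutions_def PiE_iff)
  qed (use that in \<open>auto simp: residue_group_def residue_solutions_def PiE_iff\<close>)
  show "\<exists>v\<in>carrier residue_group. v \<otimes>\<^bsub>residue_group\<^esub> u = \<one>\<^bsub>residue_group\<^esub>"
    if "u \<in> carrier residue_group" for u
  proof
    have "mod_fixed (\<lambda>z. rat_of_int (- u z))"
      using mod_fixed_scale[OF mf[of u], of "-1"] Zp_of_int[of "-1"] that by (simp add: residue_group_def)
    then show "(\<lambda>z\<in>{..<n} \<times> carrier G. (- u z) mod int p) \<in> carrier residue_group"
      by (simp add: residue_group_def residue_solutionsI)
  qed (auto simp: residue_group_def mod_add_left_eq fun_eq_iff)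
qed (auto simp: residue_group_def fun_eq_iff mod_add_left_eq mod_add_right_eq add.assoc)

lemma residue_group_pow:
  "u \<in> residue_solutions \<Longrightarrow> u [^]\<^bsub>residue_group\<^esub> (m::nat) = (\<lambda>z\<in>{..<n} \<times> carrier G. (int m * u z) mod int p)"
proof (induction m)
  case (Suc m)
  then show ?case
    by (auto simp: residue_group_def nat_pow_def fun_eq_iff mod_add_left_eq mod_add_right_eq algebra_simps)
qed (auto simp: residue_group_def nat_pow_def fun_eq_iff)

text \<open>Counting orbits of translations: a nonzero kernel of \<open>1 - X\<close> modulo \<open>p\<close> would contain
  a nonzero translation invariant element, and \<open>X\<close> annihilates such elements.\<close>

lemma residue_solutions_trivial: "residue_solutions = {\<lambda>z\<in>{..<n} \<times> carrier G. 0}"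
proof -
  let ?z = "\<lambda>z\<in>{..<n} \<times> carrier G. 0 :: int"
  interpret M: group residue_group by (rule residue_group)
  interpret T: group_action G residue_solutions translate by (rule translate_action)
  have z: "?z \<in> residue_solutions" using M.one_closed by (simp add: residue_group_def)
  have "translate g ?z = ?z" if "g \<in> carrier G" for g
    using z that by (auto simp: translate_def fun_eq_iff)
  then have "{w \<in> residue_solutions. \<forall>g\<in>carrier G. translate g w = w} = {?z}"
    using translate_fixed z by blast
  \<comment> \<open>There is exactly one fixed point, so the number of solutions is prime to
    \<open>p\<close>; a nonzero solution would have order \<open>p\<close> and contradict
    this.\<close>
  then have "card residue_solutions mod p = 1"
    using T.card_fixed_points_mod[OF finite_residue_solutions order_G prime_p] p_gt_1 by simp
  then have nd: "\<not> p dvd card residue_solutions" by auto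
  have "u = ?z" if u: "u \<in> residue_solutions" for u
  proof -
    have uc: "u \<in> carrier residue_group" using u by (simp add: residue_group_def)
    have "u [^]\<^bsub>residue_group\<^esub> p = \<one>\<^bsub>residue_group\<^esub>"
      using residue_group_pow[OF u] by (simp add: residue_group_def)
    then have "M.ord u dvd p" using M.pow_eq_id[OF uc] by simp
    moreover have "M.ord u dvd card residue_solutions"
      using M.ord_dvd_group_order[OF uc] by (simp add: order_def residue_group_def)
    ultimately have "M.ord u = 1" using nd prime_p by (metis prime_nat_iff)
    then show ?thesis using M.ord_eq_1[OF uc] by (simp add: residue_group_def)
  qed
  then show ?thesis using z by blast
qed

text \<open>Passes from the finite kernel to columns over Z_(p), replacing each entry by its residue
  in \<open>{0..<int p}\<close>.\<close>

lemma mod_fixed_trivial: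
  assumes "mod_fixed w" and w: "\<And>j y. j < n \<Longrightarrow> y \<in> carrier G \<Longrightarrow> w (j, y) \<in> Zp p"
    and "i < n" "x \<in> carrier G"
  shows "w (i, x) / rat_of_nat p \<in> Zp p"
proof -
  have "\<forall>z\<in>{..<n} \<times> carrier G. \<exists>r. r \<in> {0..<int p} \<and> (w z - rat_of_int r) / rat_of_nat p \<in> Zp p"
  proof
    fix z assume "z \<in> {..<n} \<times> carrier G"
    then have "w z \<in> Zp p" by (cases z) (simp add: w)
    from Zp_residue[OF this]
    show "\<exists>r. r \<in> {0..<int p} \<and> (w z - rat_of_int r) / rat_of_nat p \<in> Zp p" by (rule bexE) (intro exI conjI)
  qed
  from bchoice[OF this] obtain r where r0: "\<forall>z\<in>{..<n} \<times> carrier G.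
      r z \<in> {0..<int p} \<and> (w z - rat_of_int (r z)) / rat_of_nat p \<in> Zp p"
    by (rule exE)
  note r = bspec[OF r0]
  have r': "(rat_of_int (r z) - w z) / rat_of_nat p \<in> Zp p" if "z \<in> {..<n} \<times> carrier G" for z
  proof -
    have eq: "(rat_of_int (r z) - w z) / rat_of_nat p = - ((w z - rat_of_int (r z)) / rat_of_nat p)"
      by (metis minus_diff_eq minus_divide_left)
    show ?thesis unfolding eq by (rule Zp_minus[OF conjunct2[OF r[OF that]]])
  qed
  have "mod_fixed (\<lambda>z. rat_of_int (r z))"
  proof (rule mod_fixed_cong[OF assms(1)])
    fix j y assume "j < n" "y \<in> carrier G"
    then have z: "(j, y) \<in> {..<n} \<times> carrier G" by simp
    show "(rat_of_int (r (j, y)) - w (j, y)) / rat_of_nat p \<in> Zp p" by (rule r'[OF z])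
  qed
  then have "(\<lambda>z\<in>{..<n} \<times> carrier G. r z mod int p) \<in> residue_solutions" by (rule residue_solutionsI)
  then have "(\<lambda>z\<in>{..<n} \<times> carrier G. r z mod int p) = (\<lambda>z\<in>{..<n} \<times> carrier G. 0)"
    unfolding residue_solutions_trivial by (rule singletonD)
  from fun_cong[OF this, of "(i, x)"] have m: "r (i, x) mod int p = 0"
    using assms(3,4) by simp
  have ix: "(i, x) \<in> {..<n} \<times> carrier G" using assms(3,4) by simp
  have "r (i, x) \<in> {0..<int p}" by (rule conjunct1[OF r[OF ix]])
  then have "r (i, x) mod int p = r (i, x)" by (intro mod_pos_pos_trivial) simp_all
  then have "r (i, x) = 0" using m by simp
  then show ?thesis using conjunct2[OF r[OF ix]] by simp
qed

text \<open>\<open>D\<close> is the matrix of \<open>1 - X\<close> with respect to pairs: after the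
  substitution \<open>y = x \<otimes> inv y'\<close> the coefficient of \<open>w (j, y')\<close> in
  the convolution at \<open>(i, x)\<close> is \<open>X i j (x \<otimes> inv y')\<close>. Its
  injectivity modulo \<open>p\<close>, as required by \<open>Zp_linear_system\<close>, is
  \<open>mod_fixed_trivial\<close>.\<close>

lemma conv_op_solvable:
  assumes c: "\<And>i x. i < n \<Longrightarrow> x \<in> carrier G \<Longrightarrow> c (i, x) \<in> Zp p"
  shows "\<exists>w. (\<forall>i<n. \<forall>x\<in>carrier G. w (i, x) \<in> Zp p \<and> w (i, x) - conv_op n X w i x = c (i, x))"
proof -
  let ?J = "{..<n} \<times> carrier G"
  define D where "D = (\<lambda>z z' :: nat \<times> 'a. (if z' = z then 1 else 0) - X (fst z) (fst z') (snd z \<otimes> inv (snd z')))"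
  have D: "(\<Sum>z'\<in>?J. D (i, x) z' * w z') = w (i, x) - conv_op n X w i x" if "i < n" "x \<in> carrier G" for i x w
  proof -
    have "(\<Sum>z'\<in>?J. D (i, x) z' * w z') = (\<Sum>z'\<in>?J. if z' = (i, x) then w z' else 0)
        - (\<Sum>z'\<in>?J. X i (fst z') (x \<otimes> inv (snd z')) * w z')"
      unfolding D_def sum_subtractf[symmetric] by (intro sum.cong) (auto simp: left_diff_distrib)
    moreover have "(\<Sum>z'\<in>?J. if z' = (i, x) then w z' else 0) = w (i, x)"
      using that finite_G by simp
    moreover have "(\<Sum>z'\<in>?J. X i (fst z') (x \<otimes> inv (snd z')) * w z')
        = (\<Sum>j<n. \<Sum>y\<in>carrier G. X i j (x \<otimes> inv y) * w (j, y))"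
      unfolding sum.cartesian_product by (rule sum.cong) auto
    moreover have "\<dots> = conv_op n X w i x"
      unfolding conv_op_def
    proof (rule sum.cong[OF HOL.refl])
      fix j assume "j \<in> {..<n}"
      show "(\<Sum>y\<in>carrier G. X i j (x \<otimes> inv y) * w (j, y)) = (\<Sum>y\<in>carrier G. X i j y * w (j, inv y \<otimes> x))"
        by (rule sum.reindex_bij_witness[where i = "\<lambda>y. inv y \<otimes> x" and j = "\<lambda>y. x \<otimes> inv y"])
          (use that in \<open>auto simp: inv_mult_group m_assoc\<close>, simp_all flip: m_assoc)
    qed
    ultimately show ?thesis by simp
  qed
  have "\<exists>w. (\<forall>z\<in>?J. w z \<in> Zp p) \<and> (\<forall>z\<in>?J. (\<Sum>z'\<in>?J. D z z' * w z') = c z)"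
  proof (rule Zp_linear_system)
    show "D z z' \<in> Zp p" if "z \<in> ?J" "z' \<in> ?J" for z z'
    proof -
      have "X (fst z) (fst z') (snd z \<otimes> inv (snd z')) \<in> Zp p"
        using that by (intro X) auto
      then show ?thesis unfolding D_def by (intro Zp_diff) simp_all
    qed
  next
    fix w assume w: "\<And>j. j \<in> ?J \<Longrightarrow> w j \<in> Zp p"
      and *: "\<And>i. i \<in> ?J \<Longrightarrow> (\<Sum>j\<in>?J. D i j * w j) / rat_of_nat p \<in> Zp p"
    have "mod_fixed w"
      unfolding mod_fixed_def
    proof (intro allI impI ballI)
      fix i x assume "i < n" "x \<in> carrier G"
      then show "(w (i, x) - conv_op n X w i x) / rat_of_nat p \<in> Zp p"
        using *[of "(i, x)"] unfolding D[OF \<open>i < n\<close> \<open>x \<in> carrier G\<close>] by simp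
    qed
    show "\<forall>j\<in>?J. w j / rat_of_nat p \<in> Zp p"
    proof
      fix z assume "z \<in> ?J"
      then obtain i x where z: "z = (i, x)" "i < n" "x \<in> carrier G" by blast
      show "w z / rat_of_nat p \<in> Zp p"
        unfolding z(1) by (rule mod_fixed_trivial[OF \<open>mod_fixed w\<close> _ z(2,3)]) (rule w, simp)
    qed
  next
    show "c z \<in> Zp p" if "z \<in> ?J" for z using that by (cases z) (simp add: c)
  qed (simp_all add: finite_G)
  then obtain w where w: "\<forall>z\<in>?J. w z \<in> Zp p" "\<forall>z\<in>?J. (\<Sum>z'\<in>?J. D z z' * w z') = c z" by blast
  show ?thesis
  proof (intro exI[of _ w] allI impI ballI conjI)
    fix i x assume ix: "i < n" "x \<in> carrier G"
    then have z: "(i, x) \<in> ?J" by simp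
    show "w (i, x) \<in> Zp p" by (rule bspec[OF w(1) z])
    show "w (i, x) - conv_op n X w i x = c (i, x)"
      using bspec[OF w(2) z] unfolding D[OF ix] .
  qed
qed

end

end

section \<open>Matrix products\<close>

text \<open>Only the inner dimension is a parameter. Entries outside the range are arbitrary, which
  is why identities between products are stated entrywise.\<close>

definition mat_prod :: "('a, 'r) ring_scheme \<Rightarrow> nat \<Rightarrow> (nat \<Rightarrow> nat \<Rightarrow> 'a) \<Rightarrow> (nat \<Rightarrow> nat \<Rightarrow> 'a) \<Rightarrow> nat \<Rightarrow> nat \<Rightarrow> 'a" where
  "mat_prod R k M N i j = (\<Oplus>\<^bsub>R\<^esub>l\<in>{..<k}. M i l \<otimes>\<^bsub>R\<^esub> N l j)"

definition mat_one :: "('a, 'r) ring_scheme \<Rightarrow> nat \<Rightarrow> nat \<Rightarrow> 'a" where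
  "mat_one R i j = (if i = j then \<one>\<^bsub>R\<^esub> else \<zero>\<^bsub>R\<^esub>)"

lemma mutually_inverse_iff:
  "mutually_inverse R m n M N \<longleftrightarrow>
    (\<forall>i<m. \<forall>j<m. mat_prod R n M N i j = mat_one R i j) \<and>
    (\<forall>i<n. \<forall>j<n. mat_prod R m N M i j = mat_one R i j)"
  by (simp add: mutually_inverse_def mat_prod_def mat_one_def)

lemma matricesD: "M \<in> matrices R m n \<Longrightarrow> i < m \<Longrightarrow> j < n \<Longrightarrow> M i j \<in> carrier R"
  by (simp add: matrices_def)

context ring
begin

lemma mat_one_closed: "mat_one R \<in> matrices R n n"
  by (simp add: matrices_def mat_one_def)

lemma mat_prod_closed:
  assumes "M \<in> matrices R m k" "N \<in> matrices R k n"
  shows "mat_prod R k M N \<in> matrices R m n"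
  using assms by (auto simp: matrices_def mat_prod_def intro!: finsum_closed)

lemma mat_prod_cong:
  assumes "\<And>l. l < k \<Longrightarrow> M i l = M' i l" "\<And>l. l < k \<Longrightarrow> N l j = N' l j"
    and "\<And>l. l < k \<Longrightarrow> M' i l \<in> carrier R" "\<And>l. l < k \<Longrightarrow> N' l j \<in> carrier R"
  shows "mat_prod R k M N i j = mat_prod R k M' N' i j"
  unfolding mat_prod_def by (rule finsum_cong') (use assms in auto)

lemma mat_prod_assoc:
  assumes M: "M \<in> matrices R m k" and N: "N \<in> matrices R k l" and P: "P \<in> matrices R l n"
    and "i < m" "j < n"
  shows "mat_prod R l (mat_prod R k M N) P i j = mat_prod R k M (mat_prod R l N P) i j"
proof -
  note c = matricesD[OF M] matricesD[OF N] matricesD[OF P] assms(4,5)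
  have "mat_prod R l (mat_prod R k M N) P i j = (\<Oplus>b\<in>{..<l}. \<Oplus>a\<in>{..<k}. M i a \<otimes> N a b \<otimes> P b j)"
    unfolding mat_prod_def by (rule finsum_cong') (use c in \<open>auto intro!: finsum_ldistr finsum_closed\<close>)
  also have "\<dots> = (\<Oplus>a\<in>{..<k}. \<Oplus>b\<in>{..<l}. M i a \<otimes> N a b \<otimes> P b j)"
    by (rule finsum_swap_lessThan[OF abelian_monoid_axioms]) (use c in auto)
  also have "\<dots> = (\<Oplus>a\<in>{..<k}. \<Oplus>b\<in>{..<l}. M i a \<otimes> (N a b \<otimes> P b j))"
    by (rule finsum_cong', simp) (use c in \<open>auto intro!: finsum_closed finsum_cong' simp: m_assoc\<close>)
  also have "\<dots> = mat_prod R k M (mat_prod R l N P) i j"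
    unfolding mat_prod_def
    by (rule finsum_cong', simp) (use c in \<open>auto intro!: finsum_closed finsum_rdistr[symmetric]\<close>)
  finally show ?thesis .
qed

lemma mat_prod_one_left:
  assumes "M \<in> matrices R m n" "i < m" "j < n"
  shows "mat_prod R m (mat_one R) M i j = M i j"
  unfolding mat_prod_def mat_one_def
  by (rule finsum_delta_left[OF ring_axioms]) (use assms in \<open>auto simp: matrices_def\<close>)

lemma mat_prod_one_right:
  assumes "M \<in> matrices R m n" "i < m" "j < n"
  shows "mat_prod R n M (mat_one R) i j = M i j"
  unfolding mat_prod_def mat_one_def
  by (rule finsum_delta_right[OF ring_axioms]) (use assms in \<open>auto simp: matrices_def\<close>)

lemma mat_prod_left_cancel:
  assumes L: "L \<in> matrices R n m" and B: "B \<in> matrices R m n" and C: "C \<in> matrices R n k"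
    and LB: "\<And>i j. i < n \<Longrightarrow> j < n \<Longrightarrow> mat_prod R m L B i j = mat_one R i j"
    and ij: "i < n" "j < k"
  shows "mat_prod R m L (mat_prod R n B C) i j = C i j"
proof -
  have "mat_prod R m L (mat_prod R n B C) i j = mat_prod R n (mat_prod R m L B) C i j"
    by (rule mat_prod_assoc[symmetric, OF L B C ij])
  also have "\<dots> = mat_prod R n (mat_one R) C i j"
    by (rule mat_prod_cong) (use LB ij C matricesD[OF mat_one_closed[of n]] in \<open>auto simp: matrices_def\<close>)
  also have "\<dots> = C i j" by (rule mat_prod_one_left[OF C ij])
  finally show ?thesis .
qed

text \<open>\<open>L = L (B C) = (L B) C = C\<close>; the shape of \<open>B\<close> may be
  rectangular.\<close>

lemma mat_left_right_inverse_eq: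
  assumes L: "L \<in> matrices R n m" and B: "B \<in> matrices R m n" and C: "C \<in> matrices R n m"
    and LB: "\<And>i j. i < n \<Longrightarrow> j < n \<Longrightarrow> mat_prod R m L B i j = mat_one R i j"
    and BC: "\<And>i j. i < m \<Longrightarrow> j < m \<Longrightarrow> mat_prod R n B C i j = mat_one R i j"
    and ij: "i < n" "j < m"
  shows "L i j = C i j"
proof -
  have "L i j = mat_prod R m L (mat_one R) i j" by (rule mat_prod_one_right[symmetric, OF L ij])
  also have "\<dots> = mat_prod R m L (mat_prod R n B C) i j"
    by (rule mat_prod_cong) (use BC ij L matricesD[OF mat_prod_closed[OF B C]] in \<open>auto simp: matrices_def\<close>)
  also have "\<dots> = C i j" by (rule mat_prod_left_cancel[OF L B C LB ij])
  finally show ?thesis .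
qed

lemma mutually_inverse_of_left_right:
  assumes L: "L \<in> matrices R n m" and B: "B \<in> matrices R m n" and C: "C \<in> matrices R n m"
    and LB: "\<And>i j. i < n \<Longrightarrow> j < n \<Longrightarrow> mat_prod R m L B i j = mat_one R i j"
    and BC: "\<And>i j. i < m \<Longrightarrow> j < m \<Longrightarrow> mat_prod R n B C i j = mat_one R i j"
  shows "mutually_inverse R m n B L"
proof -
  have "mat_prod R n B L i j = mat_one R i j" if ij: "i < m" "j < m" for i j
  proof -
    have "mat_prod R n B L i j = mat_prod R n B C i j"
      by (rule mat_prod_cong)
        (use mat_left_right_inverse_eq[OF L B C LB BC] matricesD[OF B] matricesD[OF C] ij in auto)
    then show ?thesis using BC[OF ij] by simp
  qed
  then show ?thesis using LB by (simp add: mutually_inverse_iff)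
qed

end

lemma ring_hom_mat_prod:
  assumes "ring R" "ring S" "h \<in> ring_hom R S"
    and M: "M \<in> matrices R m k" and N: "N \<in> matrices R k n" and "i < m" "j < n"
  shows "h (mat_prod R k M N i j) = mat_prod S k (\<lambda>i j. h (M i j)) (\<lambda>i j. h (N i j)) i j"
proof -
  interpret ring_hom_ring R S h by (rule ring_hom_ringI2[OF assms(1-3)])
  note c = matricesD[OF M] matricesD[OF N] assms(6,7)
  have "h (mat_prod R k M N i j) = (\<Oplus>\<^bsub>S\<^esub>l\<in>{..<k}. h (M i l \<otimes>\<^bsub>R\<^esub> N l j))"
    unfolding mat_prod_def by (subst hom_finsum) (use c in \<open>auto simp: comp_def\<close>)
  also have "\<dots> = mat_prod S k (\<lambda>i j. h (M i j)) (\<lambda>i j. h (N i j)) i j"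
    unfolding mat_prod_def by (rule S.finsum_cong') (use c in auto)
  finally show ?thesis .
qed

lemma ring_hom_mat_one:
  assumes "ring R" "ring S" "h \<in> ring_hom R S"
  shows "h (mat_one R i j) = mat_one S i j"
  using ring_hom_one[OF assms(3)] ring_hom_zero[OF assms(3,1,2)] by (simp add: mat_one_def)

lemma ring_hom_matrices:
  "h \<in> ring_hom R S \<Longrightarrow> M \<in> matrices R m n \<Longrightarrow> (\<lambda>i j. h (M i j)) \<in> matrices S m n"
  by (auto simp: matrices_def ring_hom_closed)


section \<open>Group rings over subrings of commutative rings\<close>

text \<open>Covers \<open>\<Z>\<close> and \<open>Z_localized p\<close> at once: the ring operations
  are those of the type, so that \<open>finsum\<close> becomes \<open>sum\<close> and group ring
  identities are manipulations of ordinary finite sums.\<close>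

locale std_ring = ring R for R :: "('a::comm_ring_1, 'r) ring_scheme" (structure) +
  assumes std_add: "x \<oplus> y = x + y" and std_mult: "x \<otimes> y = x * y"
    and std_zero: "\<zero> = 0" and std_one: "\<one> = 1"
begin

lemma std_finsum: "f \<in> A \<rightarrow> carrier R \<Longrightarrow> finsum R f A = sum f A"
proof (induction A rule: infinite_finite_induct)
  case (insert x A)
  then show ?case by (subst finsum_insert) (auto simp: std_add)
qed (auto simp: std_zero finsum_infinite)

lemma std_sum_closed: "(\<And>x. x \<in> A \<Longrightarrow> f x \<in> carrier R) \<Longrightarrow> sum f A \<in> carrier R"
  using finsum_closed[of f A] std_finsum[of f A] by auto

lemma std_closed: "0 \<in> carrier R" "1 \<in> carrier R"
  "x \<in> carrier R \<Longrightarrow> y \<in> carrier R \<Longrightarrow> x + y \<in> carrier R"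
  "x \<in> carrier R \<Longrightarrow> y \<in> carrier R \<Longrightarrow> x * y \<in> carrier R"
  using zero_closed one_closed a_closed[of x y] m_closed[of x y]
  by (simp_all add: std_add std_mult std_zero std_one)

lemma std_minus: "x \<in> carrier R \<Longrightarrow> - x \<in> carrier R"
proof -
  assume x: "x \<in> carrier R"
  have "\<ominus> x + x = 0" using l_neg[OF x] by (simp add: std_add std_zero)
  then have "\<ominus> x = - x" by (simp add: eq_neg_iff_add_eq_0)
  then show ?thesis using a_inv_closed[OF x] by simp
qed

end

lemma std_ring_int: "std_ring \<Z>"
  by (intro std_ring.intro std_ring_axioms.intro int.ring_axioms) auto

lemma (in prime_nat) std_ring_Z_localized: "std_ring (Z_localized p)"
proof (intro std_ring.intro std_ring_axioms.intro)
  show "ring (Z_localized p)"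
  proof (rule ringI)
    show "abelian_group (Z_localized p)"
    proof (rule abelian_groupI)
      fix x assume "x \<in> Zp p"
      then show "\<exists>y\<in>Zp p. y \<oplus>\<^bsub>Z_localized p\<^esub> x = \<zero>\<^bsub>Z_localized p\<^esub>"
        by (intro bexI[of _ "- x"]) auto
    qed auto
    show "monoid (Z_localized p)" by (rule monoidI) auto
  qed (auto simp: ring_distribs)
qed auto

definition group_elt :: "('g, 'm) monoid_scheme \<Rightarrow> 'g \<Rightarrow> 'g \<Rightarrow> 'a::comm_ring_1" where
  "group_elt G g = (\<lambda>x\<in>carrier G. if x = g then 1 else 0)"

locale std_group_ring = std_ring R + G: group G
  for R :: "('a::comm_ring_1, 'r) ring_scheme" (structure) and G :: "('g, 'm) monoid_scheme" +
  assumes finite_G: "finite (carrier G)"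
begin

abbreviation RG where "RG \<equiv> group_ring R G"

lemma gr_carrier: "carrier RG = carrier G \<rightarrow>\<^sub>E carrier R"
  by (simp add: group_ring_def)

lemma gr_closed: "u \<in> carrier RG \<Longrightarrow> g \<in> carrier G \<Longrightarrow> u g \<in> carrier R"
  by (auto simp: gr_carrier)

lemma gr_ext: "u \<in> carrier RG \<Longrightarrow> v \<in> carrier RG \<Longrightarrow> (\<And>g. g \<in> carrier G \<Longrightarrow> u g = v g) \<Longrightarrow> u = v"
  unfolding gr_carrier by (rule PiE_ext)

lemma gr_mult_apply:
  assumes "u \<in> carrier RG" "v \<in> carrier RG" "g \<in> carrier G"
  shows "(u \<otimes>\<^bsub>RG\<^esub> v) g = (\<Sum>x\<in>carrier G. u x * v (inv\<^bsub>G\<^esub> x \<otimes>\<^bsub>G\<^esub> g))"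
proof -
  have "(u \<otimes>\<^bsub>RG\<^esub> v) g = (\<Oplus>x\<in>carrier G. u x * v (inv\<^bsub>G\<^esub> x \<otimes>\<^bsub>G\<^esub> g))"
    using assms(3) by (simp add: group_ring_def std_mult)
  also have "\<dots> = (\<Sum>x\<in>carrier G. u x * v (inv\<^bsub>G\<^esub> x \<otimes>\<^bsub>G\<^esub> g))"
    by (rule std_finsum) (use assms gr_closed in \<open>auto intro!: std_closed\<close>)
  finally show ?thesis .
qed

lemma gr_add_apply: "g \<in> carrier G \<Longrightarrow> (u \<oplus>\<^bsub>RG\<^esub> v) g = u g + v g"
  by (simp add: group_ring_def std_add)

lemma gr_zero_apply: "g \<in> carrier G \<Longrightarrow> \<zero>\<^bsub>RG\<^esub> g = 0"
  by (simp add: group_ring_def std_zero)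

lemma gr_one: "\<one>\<^bsub>RG\<^esub> = group_elt G \<one>\<^bsub>G\<^esub>"
  by (auto simp: group_ring_def std_one std_zero group_elt_def fun_eq_iff)

lemma gr_zero_closed: "\<zero>\<^bsub>RG\<^esub> \<in> carrier RG"
  by (simp add: group_ring_def)

lemma gr_add_closed: "u \<in> carrier RG \<Longrightarrow> v \<in> carrier RG \<Longrightarrow> u \<oplus>\<^bsub>RG\<^esub> v \<in> carrier RG"
  by (auto simp: group_ring_def)

lemma gr_mult_closed: "u \<in> carrier RG \<Longrightarrow> v \<in> carrier RG \<Longrightarrow> u \<otimes>\<^bsub>RG\<^esub> v \<in> carrier RG"
  by (auto simp: group_ring_def intro!: finsum_closed)

lemma group_elt_closed: "group_elt G g \<in> carrier RG"
  by (auto simp: gr_carrier group_elt_def std_closed)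

lemma sum_group_elt:
  assumes "h \<in> carrier G"
  shows "(\<Sum>x\<in>carrier G. group_elt G h x * f x) = (f h :: 'a)"
proof -
  have "(\<Sum>x\<in>carrier G. group_elt G h x * f x) = (\<Sum>x\<in>carrier G. if x = h then f x else 0)"
    by (intro sum.cong) (auto simp: group_elt_def)
  also have "\<dots> = f h" using assms finite_G by simp
  finally show ?thesis .
qed

lemma group_elt_mult_apply:
  assumes "h \<in> carrier G" "v \<in> carrier RG" "g \<in> carrier G"
  shows "(group_elt G h \<otimes>\<^bsub>RG\<^esub> v) g = v (inv\<^bsub>G\<^esub> h \<otimes>\<^bsub>G\<^esub> g)"
  by (simp add: gr_mult_apply[OF group_elt_closed assms(2,3)] sum_group_elt[OF assms(1)])

lemma group_elt_mult:
  assumes "g \<in> carrier G" "h \<in> carrier G"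
  shows "group_elt G g \<otimes>\<^bsub>RG\<^esub> group_elt G h = group_elt G (g \<otimes>\<^bsub>G\<^esub> h)"
proof (rule gr_ext)
  fix x assume x: "x \<in> carrier G"
  have "inv\<^bsub>G\<^esub> g \<otimes>\<^bsub>G\<^esub> x = h \<longleftrightarrow> x = g \<otimes>\<^bsub>G\<^esub> h"
    using assms x by (metis G.inv_solve_left G.m_closed)
  then show "(group_elt G g \<otimes>\<^bsub>RG\<^esub> group_elt G h) x = group_elt G (g \<otimes>\<^bsub>G\<^esub> h) x"
    using assms x by (simp add: group_elt_mult_apply[OF assms(1) group_elt_closed x]) (simp add: group_elt_def)
qed (use assms in \<open>auto intro!: gr_mult_closed group_elt_closed\<close>)

text \<open>The convolution as a sum over the second factor. With one form for the outer product and
  the other for the inner one, associativity becomes an interchange of two sums.\<close>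

lemma gr_mult_apply':
  assumes "u \<in> carrier RG" "v \<in> carrier RG" "g \<in> carrier G"
  shows "(u \<otimes>\<^bsub>RG\<^esub> v) g = (\<Sum>y\<in>carrier G. u (g \<otimes>\<^bsub>G\<^esub> inv\<^bsub>G\<^esub> y) * v y)"
  unfolding gr_mult_apply[OF assms]
  by (rule sum.reindex_bij_witness[where i = "\<lambda>y. g \<otimes>\<^bsub>G\<^esub> inv\<^bsub>G\<^esub> y" and j = "\<lambda>x. inv\<^bsub>G\<^esub> x \<otimes>\<^bsub>G\<^esub> g"])
    (use assms(3) in \<open>auto simp: G.inv_mult_group G.m_assoc\<close>, simp_all add: G.m_assoc[symmetric])

lemma gr_mult_assoc:
  assumes "u \<in> carrier RG" "v \<in> carrier RG" "w \<in> carrier RG"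
  shows "u \<otimes>\<^bsub>RG\<^esub> v \<otimes>\<^bsub>RG\<^esub> w = u \<otimes>\<^bsub>RG\<^esub> (v \<otimes>\<^bsub>RG\<^esub> w)"
proof (rule gr_ext)
  fix g assume g: "g \<in> carrier G"
  have "(u \<otimes>\<^bsub>RG\<^esub> v \<otimes>\<^bsub>RG\<^esub> w) g
      = (\<Sum>y\<in>carrier G. \<Sum>x\<in>carrier G. u x * v (inv\<^bsub>G\<^esub> x \<otimes>\<^bsub>G\<^esub> (g \<otimes>\<^bsub>G\<^esub> inv\<^bsub>G\<^esub> y)) * w y)"
    using g by (simp add: gr_mult_apply'[OF gr_mult_closed[OF assms(1,2)] assms(3)]
        gr_mult_apply[OF assms(1,2)] sum_distrib_right)
  also have "\<dots> = (\<Sum>x\<in>carrier G. \<Sum>y\<in>carrier G. u x * v (inv\<^bsub>G\<^esub> x \<otimes>\<^bsub>G\<^esub> (g \<otimes>\<^bsub>G\<^esub> inv\<^bsub>G\<^esub> y)) * w y)"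
    by (rule sum.swap)
  also have "\<dots> = (u \<otimes>\<^bsub>RG\<^esub> (v \<otimes>\<^bsub>RG\<^esub> w)) g"
    using g by (simp add: gr_mult_apply[OF assms(1) gr_mult_closed[OF assms(2,3)]]
        gr_mult_apply'[OF assms(2,3)] sum_distrib_left mult.assoc G.m_assoc)
  finally show "(u \<otimes>\<^bsub>RG\<^esub> v \<otimes>\<^bsub>RG\<^esub> w) g = (u \<otimes>\<^bsub>RG\<^esub> (v \<otimes>\<^bsub>RG\<^esub> w)) g" .
qed (use assms in \<open>auto intro!: gr_mult_closed\<close>)

lemma gr_ring: "ring RG"
proof (rule ringI)
  show "abelian_group RG"
  proof (rule abelian_groupI)
    fix u assume u: "u \<in> carrier RG"
    show "\<zero>\<^bsub>RG\<^esub> \<oplus>\<^bsub>RG\<^esub> u = u"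
      by (rule gr_ext) (use u in \<open>auto simp: gr_add_closed gr_zero_closed gr_add_apply gr_zero_apply\<close>)
    have m: "(\<lambda>g\<in>carrier G. - u g) \<in> carrier RG"
      using gr_closed[OF u] by (auto simp: gr_carrier std_minus)
    have "(\<lambda>g\<in>carrier G. - u g) \<oplus>\<^bsub>RG\<^esub> u = \<zero>\<^bsub>RG\<^esub>"
      by (rule gr_ext) (use u m in \<open>auto simp: gr_add_closed gr_zero_closed gr_add_apply gr_zero_apply\<close>)
    with m show "\<exists>v\<in>carrier RG. v \<oplus>\<^bsub>RG\<^esub> u = \<zero>\<^bsub>RG\<^esub>" by blast
  next
    fix u v w assume uvw: "u \<in> carrier RG" "v \<in> carrier RG" "w \<in> carrier RG"
    show "u \<oplus>\<^bsub>RG\<^esub> v \<oplus>\<^bsub>RG\<^esub> w = u \<oplus>\<^bsub>RG\<^esub> (v \<oplus>\<^bsub>RG\<^esub> w)"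
      by (rule gr_ext) (use uvw in \<open>auto simp: gr_add_closed gr_add_apply add.assoc\<close>)
  next
    fix u v assume uv: "u \<in> carrier RG" "v \<in> carrier RG"
    show "u \<oplus>\<^bsub>RG\<^esub> v = v \<oplus>\<^bsub>RG\<^esub> u"
      by (rule gr_ext) (use uv in \<open>auto simp: gr_add_closed gr_add_apply add.commute\<close>)
  qed (auto simp: gr_add_closed gr_zero_closed)
  show "monoid RG"
  proof (rule monoidI)
    fix u assume u: "u \<in> carrier RG"
    show "\<one>\<^bsub>RG\<^esub> \<otimes>\<^bsub>RG\<^esub> u = u"
      unfolding gr_one
      by (rule gr_ext) (use u in \<open>auto simp: gr_mult_closed group_elt_closed group_elt_mult_apply\<close>)
    show "u \<otimes>\<^bsub>RG\<^esub> \<one>\<^bsub>RG\<^esub> = u"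
      unfolding gr_one
    proof (rule gr_ext)
      fix g assume g: "g \<in> carrier G"
      show "(u \<otimes>\<^bsub>RG\<^esub> group_elt G \<one>\<^bsub>G\<^esub>) g = u g"
        using sum_group_elt[of "\<one>\<^bsub>G\<^esub>" "\<lambda>y. u (g \<otimes>\<^bsub>G\<^esub> inv\<^bsub>G\<^esub> y)"] g
        by (simp add: gr_mult_apply'[OF u group_elt_closed g] mult.commute)
    qed (use u in \<open>auto simp: gr_mult_closed group_elt_closed\<close>)
  qed (auto simp: gr_mult_closed gr_mult_assoc group_elt_closed gr_one)
next
  fix u v w assume uvw: "u \<in> carrier RG" "v \<in> carrier RG" "w \<in> carrier RG"
  show "(u \<oplus>\<^bsub>RG\<^esub> v) \<otimes>\<^bsub>RG\<^esub> w = u \<otimes>\<^bsub>RG\<^esub> w \<oplus>\<^bsub>RG\<^esub> v \<otimes>\<^bsub>RG\<^esub> w"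
    by (rule gr_ext) (use uvw in \<open>auto simp: gr_add_closed gr_mult_closed gr_add_apply gr_mult_apply
        ring_distribs sum.distrib\<close>)
  show "w \<otimes>\<^bsub>RG\<^esub> (u \<oplus>\<^bsub>RG\<^esub> v) = w \<otimes>\<^bsub>RG\<^esub> u \<oplus>\<^bsub>RG\<^esub> w \<otimes>\<^bsub>RG\<^esub> v"
    by (rule gr_ext) (use uvw in \<open>auto simp: gr_add_closed gr_mult_closed gr_add_apply gr_mult_apply
        ring_distribs sum.distrib\<close>)
qed

lemma augmentation_sum: "u \<in> carrier RG \<Longrightarrow> augmentation R G u = (\<Sum>g\<in>carrier G. u g)"
  unfolding augmentation_def by (rule std_finsum) (auto intro: gr_closed)

lemma augmentation_group_elt: "g \<in> carrier G \<Longrightarrow> augmentation R G (group_elt G g) = 1"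
  using sum_group_elt[of g "\<lambda>_. 1"] by (simp add: augmentation_sum group_elt_closed)

lemma augmentation_hom: "augmentation R G \<in> ring_hom RG R"
proof (rule ring_hom_memI)
  fix u v assume uv: "u \<in> carrier RG" "v \<in> carrier RG"
  show "augmentation R G u \<in> carrier R"
    using uv by (auto simp: augmentation_sum intro!: std_sum_closed gr_closed)
  show "augmentation R G (u \<oplus>\<^bsub>RG\<^esub> v) = augmentation R G u \<oplus> augmentation R G v"
    using uv by (simp add: augmentation_sum gr_add_closed gr_add_apply std_add sum.distrib)
  have "augmentation R G (u \<otimes>\<^bsub>RG\<^esub> v) = (\<Sum>g\<in>carrier G. \<Sum>x\<in>carrier G. u x * v (inv\<^bsub>G\<^esub> x \<otimes>\<^bsub>G\<^esub> g))"
    using uv by (simp add: augmentation_sum gr_mult_closed gr_mult_apply)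
  also have "\<dots> = (\<Sum>x\<in>carrier G. u x * (\<Sum>g\<in>carrier G. v (inv\<^bsub>G\<^esub> x \<otimes>\<^bsub>G\<^esub> g)))"
    by (subst sum.swap) (simp add: sum_distrib_left)
  also have "\<dots> = (\<Sum>x\<in>carrier G. u x * (\<Sum>g\<in>carrier G. v g))"
  proof (rule sum.cong)
    fix x assume x: "x \<in> carrier G"
    have "(\<Sum>g\<in>carrier G. v (inv\<^bsub>G\<^esub> x \<otimes>\<^bsub>G\<^esub> g)) = (\<Sum>g\<in>carrier G. v g)"
      by (rule sum.reindex_bij_witness[where i = "\<lambda>g. x \<otimes>\<^bsub>G\<^esub> g" and j = "\<lambda>g. inv\<^bsub>G\<^esub> x \<otimes>\<^bsub>G\<^esub> g"])
        (use x in \<open>simp_all add: G.m_assoc[symmetric]\<close>)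
    then show "u x * (\<Sum>g\<in>carrier G. v (inv\<^bsub>G\<^esub> x \<otimes>\<^bsub>G\<^esub> g)) = u x * (\<Sum>g\<in>carrier G. v g)"
      by simp
  qed simp
  finally show "augmentation R G (u \<otimes>\<^bsub>RG\<^esub> v) = augmentation R G u \<otimes> augmentation R G v"
    using uv by (simp add: augmentation_sum std_mult sum_distrib_right)
next
  show "augmentation R G \<one>\<^bsub>RG\<^esub> = \<one>" by (simp add: gr_one augmentation_group_elt std_one)
qed

definition scalar :: "'a \<Rightarrow> 'g \<Rightarrow> 'a" where
  "scalar c = (\<lambda>g\<in>carrier G. if g = \<one>\<^bsub>G\<^esub> then c else 0)"

lemma scalar_closed: "c \<in> carrier R \<Longrightarrow> scalar c \<in> carrier RG"
  by (auto simp: scalar_def gr_carrier std_closed)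

lemma scalar_mult_apply:
  assumes "c \<in> carrier R" "u \<in> carrier RG" "g \<in> carrier G"
  shows "(scalar c \<otimes>\<^bsub>RG\<^esub> u) g = c * u g"
proof -
  have "(scalar c \<otimes>\<^bsub>RG\<^esub> u) g = (\<Sum>x\<in>carrier G. if x = \<one>\<^bsub>G\<^esub> then c * u g else 0)"
    unfolding gr_mult_apply[OF scalar_closed[OF assms(1)] assms(2,3)]
    by (intro sum.cong) (use assms(3) in \<open>auto simp: scalar_def\<close>)
  then show ?thesis using finite_G by simp
qed

lemma augmentation_scalar: "c \<in> carrier R \<Longrightarrow> augmentation R G (scalar c) = c"
  using finite_G by (simp add: augmentation_sum scalar_closed) (simp add: scalar_def)

end

context std_group_ring
begin

lemma gr_finsum_apply:
  assumes "f \<in> A \<rightarrow> carrier RG" "g \<in> carrier G" "finite A"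
  shows "(\<Oplus>\<^bsub>RG\<^esub>a\<in>A. f a) g = (\<Sum>a\<in>A. f a g)"
proof -
  interpret RG: ring RG by (rule gr_ring)
  show ?thesis
    using assms(3,1)
  proof (induction A)
    case (insert a A)
    then show ?case using assms(2) by (subst RG.finsum_insert) (auto simp: gr_add_apply)
  qed (use assms(2) in \<open>simp add: gr_zero_apply\<close>)
qed

lemma gr_minus_apply:
  assumes "u \<in> carrier RG" "g \<in> carrier G"
  shows "(\<ominus>\<^bsub>RG\<^esub> u) g = - u g"
proof -
  interpret RG: ring RG by (rule gr_ring)
  have "(\<ominus>\<^bsub>RG\<^esub> u \<oplus>\<^bsub>RG\<^esub> u) g = 0" using assms by (simp add: RG.l_neg gr_zero_apply)
  then show ?thesis using assms by (simp add: gr_add_apply eq_neg_iff_add_eq_0)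
qed

end

lemma std_group_ring_int: "group G \<Longrightarrow> finite (carrier G) \<Longrightarrow> std_group_ring \<Z> G"
  by (intro std_group_ring.intro std_group_ring_axioms.intro std_ring_int)

lemma (in prime_nat) std_group_ring_Zp:
  "group G \<Longrightarrow> finite (carrier G) \<Longrightarrow> std_group_ring (Z_localized p) G"
  by (intro std_group_ring.intro std_group_ring_axioms.intro std_ring_Z_localized)

text \<open>The group elements generate the integral group ring additively. The multiples
  \<open>f g k\<close> are reached by induction on the integer \<open>k\<close>, and then the
  support is enlarged one element at a time.\<close>

lemma int_group_ring_induct [consumes 3, case_names zero elt add minus]:
  fixes G :: "('g, 'm) monoid_scheme"
  assumes "group G" "finite (carrier G)" and u: "u \<in> carrier (group_ring \<Z> G)"
    and zero: "P \<zero>\<^bsub>group_ring \<Z> G\<^esub>"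
    and elt: "\<And>g. g \<in> carrier G \<Longrightarrow> P (group_elt G g)"
    and add: "\<And>u v. \<lbrakk>u \<in> carrier (group_ring \<Z> G); v \<in> carrier (group_ring \<Z> G); P u; P v\<rbrakk>
      \<Longrightarrow> P (u \<oplus>\<^bsub>group_ring \<Z> G\<^esub> v)"
    and minus: "\<And>u. \<lbrakk>u \<in> carrier (group_ring \<Z> G); P u\<rbrakk> \<Longrightarrow> P (\<ominus>\<^bsub>group_ring \<Z> G\<^esub> u)"
  shows "P u"
proof -
  interpret std_group_ring \<Z> G by (rule std_group_ring_int) fact+
  interpret RG: ring RG by (rule gr_ring)
  define f where "f = (\<lambda>g (k::int). \<lambda>x\<in>carrier G. if x = g then k else 0)"
  have f: "f g k \<in> carrier RG" for g k by (auto simp: f_def gr_carrier)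
  have Pf: "P (f g k)" if g: "g \<in> carrier G" for g k
  proof (induction k rule: int_induct[where k = 0])
    case base
    have "f g 0 = \<zero>\<^bsub>RG\<^esub>"
      by (rule gr_ext) (auto simp: f gr_zero_closed, simp add: f_def gr_zero_apply)
    then show ?case using zero by simp
  next
    case (step1 k)
    have "f g (k + 1) = f g k \<oplus>\<^bsub>RG\<^esub> group_elt G g"
      by (rule gr_ext) (auto simp: f gr_add_closed group_elt_closed gr_add_apply, auto simp: f_def group_elt_def)
    then show ?case using add[OF f group_elt_closed step1(2) elt[OF g]] by simp
  next
    case (step2 k)
    have "f g (k - 1) = f g k \<oplus>\<^bsub>RG\<^esub> \<ominus>\<^bsub>RG\<^esub> group_elt G g"
      by (rule gr_ext)
        (auto simp: f gr_add_closed group_elt_closed gr_add_apply gr_minus_apply RG.a_inv_closed, auto simp: f_def group_elt_def)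
    then show ?case
      using add[OF f RG.a_inv_closed[OF group_elt_closed] step2(2) minus[OF group_elt_closed elt[OF g]]] by simp
  qed
  have "P (\<lambda>x\<in>carrier G. if x \<in> A then u x else 0)" if "finite A" "A \<subseteq> carrier G" for A
    using that
  proof (induction A)
    case empty
    have "(\<lambda>x\<in>carrier G. if x \<in> {} then u x else 0) = \<zero>\<^bsub>RG\<^esub>" by (simp add: group_ring_def)
    then show ?case using zero by simp
  next
    case (insert g A)
    let ?v = "\<lambda>x\<in>carrier G. if x \<in> A then u x else 0"
    have v: "?v \<in> carrier RG" by (auto simp: gr_carrier)
    have "(\<lambda>x\<in>carrier G. if x \<in> insert g A then u x else 0) = ?v \<oplus>\<^bsub>RG\<^esub> f g (u g)"
    proof (rule gr_ext)
      fix x assume "x \<in> carrier G"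
      then show "(\<lambda>x\<in>carrier G. if x \<in> insert g A then u x else 0) x = (?v \<oplus>\<^bsub>RG\<^esub> f g (u g)) x"
        using insert.hyps by (auto simp: gr_add_apply f_def)
    qed (use v f in \<open>auto simp: gr_carrier intro!: gr_add_closed[unfolded gr_carrier]\<close>)
    moreover have "P (?v \<oplus>\<^bsub>RG\<^esub> f g (u g))"
      by (intro add[OF v f] insert.IH Pf) (use insert.prems in auto)
    ultimately show ?case by (simp only:)
  qed
  from this[OF finite_G] have "P (\<lambda>x\<in>carrier G. if x \<in> carrier G then u x else 0)" by simp
  moreover have "(\<lambda>x\<in>carrier G. if x \<in> carrier G then u x else 0) = u"
    by (rule gr_ext) (use u in \<open>auto simp: gr_carrier\<close>)
  ultimately show ?thesis by simp
qed

locale group_ring_map = dom: std_group_ring R G + cod: std_group_ring R H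
  for R :: "('a::comm_ring_1, 'r) ring_scheme" and G :: "('g, 'm) monoid_scheme" and H :: "('h, 'n) monoid_scheme" +
  fixes \<pi> :: "'g \<Rightarrow> 'h"
  assumes hom: "\<pi> \<in> hom G H"
begin

interpretation group_hom G H \<pi>
  by (intro group_hom.intro group_hom_axioms.intro hom dom.G.group_axioms cod.G.group_axioms)

abbreviation push where "push \<equiv> group_ring_push R G H \<pi>"

lemma push_apply:
  "u \<in> carrier dom.RG \<Longrightarrow> y \<in> carrier H \<Longrightarrow> push u y = (\<Sum>g\<in>{g \<in> carrier G. \<pi> g = y}. u g)"
  unfolding group_ring_push_def by (auto intro!: dom.std_finsum dom.gr_closed)

lemma push_closed: "u \<in> carrier dom.RG \<Longrightarrow> push u \<in> carrier cod.RG"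
  unfolding cod.gr_carrier
proof (rule PiE_I)
  fix y assume "u \<in> carrier dom.RG" "y \<in> carrier H"
  then show "push u y \<in> carrier R"
    by (simp add: push_apply) (auto intro!: dom.std_sum_closed dom.gr_closed)
qed (simp add: group_ring_push_def)

lemma push_group_elt: "g \<in> carrier G \<Longrightarrow> push (group_elt G g) = group_elt H (\<pi> g)"
proof (rule cod.gr_ext)
  fix y assume g: "g \<in> carrier G" and y: "y \<in> carrier H"
  have "push (group_elt G g) y = (\<Sum>x\<in>{x \<in> carrier G. \<pi> x = y}. if x = g then 1 else 0)"
    unfolding push_apply[OF dom.group_elt_closed y] by (intro sum.cong) (auto simp: group_elt_def)
  also have "\<dots> = group_elt H (\<pi> g) y"
    using g y dom.finite_G by (auto simp: group_elt_def)
  finally show "push (group_elt G g) y = group_elt H (\<pi> g) y" .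
qed (auto intro!: push_closed dom.group_elt_closed cod.group_elt_closed)

lemma push_hom: "push \<in> ring_hom dom.RG cod.RG"
proof (rule ring_hom_memI)
  fix u v assume uv: "u \<in> carrier dom.RG" "v \<in> carrier dom.RG"
  show "push u \<in> carrier cod.RG" by (rule push_closed[OF uv(1)])
  show "push (u \<oplus>\<^bsub>dom.RG\<^esub> v) = push u \<oplus>\<^bsub>cod.RG\<^esub> push v"
    by (rule cod.gr_ext)
      (use uv in \<open>auto simp: push_closed dom.gr_add_closed cod.gr_add_closed push_apply cod.gr_add_apply
        dom.gr_add_apply sum.distrib\<close>)
  show "push (u \<otimes>\<^bsub>dom.RG\<^esub> v) = push u \<otimes>\<^bsub>cod.RG\<^esub> push v"
  proof (rule cod.gr_ext)
    fix y assume y: "y \<in> carrier H"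
    have shift: "(\<Sum>g\<in>{g \<in> carrier G. \<pi> g = y}. v (inv\<^bsub>G\<^esub> x \<otimes>\<^bsub>G\<^esub> g)) = push v (inv\<^bsub>H\<^esub> \<pi> x \<otimes>\<^bsub>H\<^esub> y)"
      if x: "x \<in> carrier G" for x
    proof -
      have "push v (inv\<^bsub>H\<^esub> \<pi> x \<otimes>\<^bsub>H\<^esub> y) = (\<Sum>g\<in>{g \<in> carrier G. \<pi> g = inv\<^bsub>H\<^esub> \<pi> x \<otimes>\<^bsub>H\<^esub> y}. v g)"
        using x y by (simp add: push_apply[OF uv(2)])
      also have "\<dots> = (\<Sum>g\<in>{g \<in> carrier G. \<pi> g = y}. v (inv\<^bsub>G\<^esub> x \<otimes>\<^bsub>G\<^esub> g))"
        by (rule sum.reindex_bij_witness[where i = "\<lambda>g. inv\<^bsub>G\<^esub> x \<otimes>\<^bsub>G\<^esub> g" and j = "\<lambda>g. x \<otimes>\<^bsub>G\<^esub> g"])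
          (use x y in \<open>auto simp: dom.G.m_assoc[symmetric] cod.G.m_assoc[symmetric]\<close>)
      finally show ?thesis by simp
    qed
    have "push (u \<otimes>\<^bsub>dom.RG\<^esub> v) y
        = (\<Sum>g\<in>{g \<in> carrier G. \<pi> g = y}. \<Sum>x\<in>carrier G. u x * v (inv\<^bsub>G\<^esub> x \<otimes>\<^bsub>G\<^esub> g))"
      unfolding push_apply[OF dom.gr_mult_closed[OF uv] y]
      by (intro sum.cong) (auto simp: dom.gr_mult_apply[OF uv])
    also have "\<dots> = (\<Sum>x\<in>carrier G. u x * push v (inv\<^bsub>H\<^esub> \<pi> x \<otimes>\<^bsub>H\<^esub> y))"
      by (subst sum.swap) (simp add: shift sum_distrib_left[symmetric])
    \<comment> \<open>The factor involving \<open>v\<close> depends on \<open>x\<close> only through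
      its image, so the elements \<open>x\<close> are collected by fibres.\<close>
    also have "\<dots> = (\<Sum>z\<in>carrier H. \<Sum>x\<in>{x \<in> carrier G. \<pi> x = z}. u x * push v (inv\<^bsub>H\<^esub> \<pi> x \<otimes>\<^bsub>H\<^esub> y))"
      by (rule sum.group[symmetric]) (use dom.finite_G cod.finite_G in auto)
    also have "\<dots> = (\<Sum>z\<in>carrier H. push u z * push v (inv\<^bsub>H\<^esub> z \<otimes>\<^bsub>H\<^esub> y))"
      by (rule sum.cong) (auto simp: push_apply[OF uv(1)] sum_distrib_right)
    also have "\<dots> = (push u \<otimes>\<^bsub>cod.RG\<^esub> push v) y"
      by (rule cod.gr_mult_apply[symmetric, OF push_closed[OF uv(1)] push_closed[OF uv(2)] y])
    finally show "push (u \<otimes>\<^bsub>dom.RG\<^esub> v) y = (push u \<otimes>\<^bsub>cod.RG\<^esub> push v) y" .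
  qed (use uv in \<open>auto intro!: push_closed dom.gr_mult_closed cod.gr_mult_closed\<close>)
next
  show "push \<one>\<^bsub>dom.RG\<^esub> = \<one>\<^bsub>cod.RG\<^esub>" by (simp add: dom.gr_one cod.gr_one push_group_elt)
qed

lemma augmentation_push:
  assumes "u \<in> carrier dom.RG"
  shows "augmentation R H (push u) = augmentation R G u"
proof -
  have "(\<Sum>y\<in>carrier H. push u y) = (\<Sum>y\<in>carrier H. \<Sum>g\<in>{g \<in> carrier G. \<pi> g = y}. u g)"
    by (rule sum.cong) (auto simp: push_apply[OF assms])
  also have "\<dots> = (\<Sum>g\<in>carrier G. u g)"
    by (rule sum.group) (use dom.finite_G cod.finite_G in auto)
  finally show ?thesis
    by (simp add: dom.augmentation_sum[OF assms] cod.augmentation_sum[OF push_closed[OF assms]])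
qed

end

section \<open>Matrices over Z_(p)[P], for a p-group P, whose augmentation is invertible\<close>

context finite_p_group
begin

interpretation Z: std_group_ring \<Z> G by (rule std_group_ring_int[OF is_group finite_G])
interpretation R: std_group_ring "Z_localized p" G by (rule std_group_ring_Zp[OF is_group finite_G])
interpretation RG: ring R.RG by (rule R.gr_ring)

lemma coeff_hom: "group_ring_coeff G rat_of_int \<in> ring_hom Z.RG R.RG"
proof (rule ring_hom_memI)
  have cl: "group_ring_coeff G rat_of_int u \<in> carrier R.RG" for u
    by (auto simp: group_ring_coeff_def R.gr_carrier)
  fix u v assume uv: "u \<in> carrier Z.RG" "v \<in> carrier Z.RG"
  show "group_ring_coeff G rat_of_int u \<in> carrier R.RG" by (rule cl)
  show "group_ring_coeff G rat_of_int (u \<oplus>\<^bsub>Z.RG\<^esub> v)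
      = group_ring_coeff G rat_of_int u \<oplus>\<^bsub>R.RG\<^esub> group_ring_coeff G rat_of_int v"
    by (rule R.gr_ext) (auto simp: cl R.gr_add_closed R.gr_add_apply, simp add: group_ring_coeff_def Z.gr_add_apply)
  show "group_ring_coeff G rat_of_int (u \<otimes>\<^bsub>Z.RG\<^esub> v)
      = group_ring_coeff G rat_of_int u \<otimes>\<^bsub>R.RG\<^esub> group_ring_coeff G rat_of_int v"
    by (rule R.gr_ext)
      (auto simp: cl R.gr_mult_closed R.gr_mult_apply[OF cl cl], simp add: group_ring_coeff_def Z.gr_mult_apply[OF uv])
next
  show "group_ring_coeff G rat_of_int \<one>\<^bsub>Z.RG\<^esub> = \<one>\<^bsub>R.RG\<^esub>"
    by (auto simp: group_ring_coeff_def Z.gr_one R.gr_one group_elt_def fun_eq_iff)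
qed

lemma augmentation_coeff:
  "u \<in> carrier Z.RG \<Longrightarrow> augmentation (Z_localized p) G (group_ring_coeff G rat_of_int u)
    = rat_of_int (augmentation \<Z> G u)"
  using ring_hom_closed[OF coeff_hom]
  by (simp add: R.augmentation_sum Z.augmentation_sum) (simp add: group_ring_coeff_def)

text \<open>The entries of \<open>X = 1 - M\<close> have augmentation zero, and the columns of the
  right inverse are the solutions of \<open>w - X w = e_k\<close> for the columns \<open>e_k\<close>
  of the identity.\<close>

lemma unimodular_right_inverse:
  assumes M: "M \<in> matrices R.RG n n"
    and aug: "\<And>i j. i < n \<Longrightarrow> j < n \<Longrightarrow> augmentation (Z_localized p) G (M i j) = (if i = j then 1 else 0)"
  shows "\<exists>W\<in>matrices R.RG n n. \<forall>i<n. \<forall>j<n. mat_prod R.RG n M W i j = mat_one R.RG i j"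
proof -
  define X where "X = (\<lambda>i j y. (if i = j \<and> y = \<one> then 1 else 0) - M i j y)"
  have Mc: "M i j y \<in> Zp p" if "i < n" "j < n" "y \<in> carrier G" for i j y
    using R.gr_closed[OF matricesD[OF M that(1,2)] that(3)] .
  have X: "X i j y \<in> Zp p" if "i < n" "j < n" "y \<in> carrier G" for i j y
    using Mc[OF that] unfolding X_def by (intro Zp_diff) auto
  have X0: "(\<Sum>y\<in>carrier G. X i j y) = 0" if "i < n" "j < n" for i j
    using aug[OF that] finite_G unfolding R.augmentation_sum[OF matricesD[OF M that]]
    by (simp add: X_def sum_subtractf)
  have "\<exists>w. \<forall>i<n. \<forall>x\<in>carrier G. w (i, x) \<in> Zp p \<and> w (i, x) - conv_op n X w i x = mat_one R.RG i k x"
    if "k < n" for k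
    using conv_op_solvable[OF X X0, where c = "\<lambda>z. mat_one R.RG (fst z) k (snd z)"]
      R.gr_closed[OF matricesD[OF RG.mat_one_closed[of n]]] that by simp
  then have "\<forall>k. \<exists>w. k < n \<longrightarrow> (\<forall>i<n. \<forall>x\<in>carrier G. w (i, x) \<in> Zp p \<and> w (i, x) - conv_op n X w i x = mat_one R.RG i k x)"
    by blast
  from choice[OF this] obtain w where w: "\<And>k i x. k < n \<Longrightarrow> i < n \<Longrightarrow> x \<in> carrier G \<Longrightarrow>
      w k (i, x) \<in> Zp p \<and> w k (i, x) - conv_op n X (w k) i x = mat_one R.RG i k x"
    by blast
  define W where "W = (\<lambda>j k. \<lambda>x\<in>carrier G. w k (j, x))"
  have W: "W \<in> matrices R.RG n n"
    using w by (auto simp: matrices_def W_def R.gr_carrier)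
  have "mat_prod R.RG n M W i k = mat_one R.RG i k" if ik: "i < n" "k < n" for i k
  proof (rule R.gr_ext)
    fix x assume x: "x \<in> carrier G"
    have "mat_prod R.RG n M W i k x = (\<Sum>j<n. (M i j \<otimes>\<^bsub>R.RG\<^esub> W j k) x)"
      unfolding mat_prod_def
      by (rule R.gr_finsum_apply) (use x ik matricesD[OF M] matricesD[OF W] in \<open>auto intro!: R.gr_mult_closed\<close>)
    also have "\<dots> = (\<Sum>j<n. \<Sum>y\<in>carrier G. M i j y * w k (j, inv y \<otimes> x))"
      by (intro sum.cong)
        (use x ik matricesD[OF M] matricesD[OF W] in \<open>auto simp: R.gr_mult_apply, simp add: W_def\<close>)
    also have "\<dots> = (\<Sum>j<n. \<Sum>y\<in>carrier G. (if i = j \<and> y = \<one> then w k (i, x) else 0)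
        - X i j y * w k (j, inv y \<otimes> x))"
      by (intro sum.cong) (use x in \<open>auto simp: X_def left_diff_distrib\<close>)
    also have "\<dots> = (\<Sum>j<n. if i = j then (\<Sum>y\<in>carrier G. if y = \<one> then w k (i, x) else 0) else 0)
        - conv_op n X (w k) i x"
      unfolding conv_op_def sum_subtractf[symmetric]
      by (rule sum.cong) (auto simp: sum_subtractf intro!: sum.neutral)
    also have "\<dots> = mat_one R.RG i k x"
      using w[OF ik(2,1) x] ik finite_G by simp
    finally show "mat_prod R.RG n M W i k x = mat_one R.RG i k x" .
  qed (use ik matricesD[OF RG.mat_prod_closed[OF M W]] matricesD[OF RG.mat_one_closed[of n]] in auto)
  then show ?thesis using W by blast
qed

lemma augmentation_mat_prod:
  assumes "M \<in> matrices R.RG m r" "N \<in> matrices R.RG r n" "i < m" "j < n"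
  shows "augmentation (Z_localized p) G (mat_prod R.RG r M N i j)
    = (\<Sum>l<r. augmentation (Z_localized p) G (M i l) * augmentation (Z_localized p) G (N l j))"
proof -
  have "augmentation (Z_localized p) G (mat_prod R.RG r M N i j)
    = mat_prod (Z_localized p) r (\<lambda>i j. augmentation (Z_localized p) G (M i j))
        (\<lambda>i j. augmentation (Z_localized p) G (N i j)) i j"
    by (rule ring_hom_mat_prod[OF RG.ring_axioms R.ring_axioms R.augmentation_hom assms])
  also have "\<dots> = (\<Sum>l<r. augmentation (Z_localized p) G (M i l) * augmentation (Z_localized p) G (N l j))"
    unfolding mat_prod_def
    by (subst R.std_finsum)
      (use assms ring_hom_closed[OF R.augmentation_hom] in \<open>auto simp: matrices_def R.std_mult intro!: R.std_closed\<close>)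
  finally show ?thesis .
qed

text \<open>The right inverse \<open>W\<close> again has augmentation the identity, so it has a
  right inverse itself; having \<open>M\<close> on its left and \<open>V\<close> on its right, it is
  invertible with inverse \<open>M\<close>.\<close>

lemma unimodular_inverse:
  assumes M: "M \<in> matrices R.RG n n"
    and aug: "\<And>i j. i < n \<Longrightarrow> j < n \<Longrightarrow> augmentation (Z_localized p) G (M i j) = (if i = j then 1 else 0)"
  obtains W where "W \<in> matrices R.RG n n" "mutually_inverse R.RG n n M W"
proof -
  let ?e = "augmentation (Z_localized p) G"
  obtain W where W: "W \<in> matrices R.RG n n"
    and MW: "\<And>i j. i < n \<Longrightarrow> j < n \<Longrightarrow> mat_prod R.RG n M W i j = mat_one R.RG i j"
    using unimodular_right_inverse[OF M aug] by blast
  have augW: "?e (W i j) = (if i = j then 1 else 0)" if "i < n" "j < n" for i j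
  proof -
    have "?e (W i j) = (\<Sum>l<n. if i = l then ?e (W l j) else 0)" using that by simp
    also have "\<dots> = (\<Sum>l<n. ?e (M i l) * ?e (W l j))"
      by (intro sum.cong) (use aug that in auto)
    also have "\<dots> = ?e (mat_one R.RG i j)"
      using augmentation_mat_prod[OF M W that] MW[OF that] by simp
    also have "\<dots> = mat_one (Z_localized p) i j"
      by (rule ring_hom_mat_one[OF RG.ring_axioms R.ring_axioms R.augmentation_hom])
    finally show ?thesis by (simp add: mat_one_def)
  qed
  obtain V where V: "V \<in> matrices R.RG n n"
    and WV: "\<And>i j. i < n \<Longrightarrow> j < n \<Longrightarrow> mat_prod R.RG n W V i j = mat_one R.RG i j"
    using unimodular_right_inverse[OF W augW] by blast
  have "mutually_inverse R.RG n n W M"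
    by (rule RG.mutually_inverse_of_left_right[OF M W V MW WV])
  then have "mutually_inverse R.RG n n M W" by (auto simp: mutually_inverse_iff)
  then show ?thesis using W that by blast
qed

text \<open>The integral inverse of the augmentation is lifted to a matrix \<open>C\<close> of
  scalars. Then \<open>C M\<close> and \<open>M C\<close> are square with augmentation the identity;
  from their inverses \<open>U\<close> and \<open>V\<close> one gets the left inverse
  \<open>U C\<close> and the right inverse \<open>C V\<close> of \<open>M\<close>.\<close>

lemma invertible_matrix_of_augmentation:
  assumes M: "M \<in> matrices R.RG m n"
    and aug: "\<And>i j. i < m \<Longrightarrow> j < n \<Longrightarrow> augmentation (Z_localized p) G (M i j) = rat_of_int (E i j)"
    and E: "invertible_matrix \<Z> m n E"
  shows "invertible_matrix R.RG m n M"
proof -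
  let ?e = "augmentation (Z_localized p) G"
  obtain F where F: "mutually_inverse \<Z> m n E F" using E by (auto simp: invertible_matrix_def)
  have EF: "(\<Sum>l<n. E i l * F l j) = (if i = j then 1 else 0)" if "i < m" "j < m" for i j
    using F that by (simp add: mutually_inverse_def int_finsum_eq)
  have FE: "(\<Sum>l<m. F i l * E l j) = (if i = j then 1 else 0)" if "i < n" "j < n" for i j
    using F that by (simp add: mutually_inverse_def int_finsum_eq)
  define C where "C = (\<lambda>i j. R.scalar (rat_of_int (F i j)))"
  have C: "C \<in> matrices R.RG n m" by (simp add: matrices_def C_def R.scalar_closed)
  have augC: "?e (C i j) = rat_of_int (F i j)" for i j
    by (simp add: C_def R.augmentation_scalar)
  have CM: "?e (mat_prod R.RG m C M i j) = (if i = j then 1 else 0)" if "i < n" "j < n" for i j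
  proof -
    have "?e (mat_prod R.RG m C M i j) = (\<Sum>l<m. rat_of_int (F i l * E l j))"
      unfolding augmentation_mat_prod[OF C M that] by (intro sum.cong) (use that aug augC in auto)
    also have "\<dots> = rat_of_int (\<Sum>l<m. F i l * E l j)" by simp
    finally show ?thesis unfolding FE[OF that] by simp
  qed
  have MC: "?e (mat_prod R.RG n M C i j) = (if i = j then 1 else 0)" if "i < m" "j < m" for i j
  proof -
    have "?e (mat_prod R.RG n M C i j) = (\<Sum>l<n. rat_of_int (E i l * F l j))"
      unfolding augmentation_mat_prod[OF M C that] by (intro sum.cong) (use that aug augC in auto)
    also have "\<dots> = rat_of_int (\<Sum>l<n. E i l * F l j)" by simp
    finally show ?thesis unfolding EF[OF that] by simp
  qed
  obtain U where U: "U \<in> matrices R.RG n n" "mutually_inverse R.RG n n (mat_prod R.RG m C M) U"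
    using unimodular_inverse[OF RG.mat_prod_closed[OF C M] CM] .
  obtain V where V: "V \<in> matrices R.RG m m" "mutually_inverse R.RG m m (mat_prod R.RG n M C) V"
    using unimodular_inverse[OF RG.mat_prod_closed[OF M C] MC] .
  let ?L = "mat_prod R.RG n U C" and ?K = "mat_prod R.RG m C V"
  have L: "?L \<in> matrices R.RG n m" by (rule RG.mat_prod_closed[OF U(1) C])
  have K: "?K \<in> matrices R.RG n m" by (rule RG.mat_prod_closed[OF C V(1)])
  have "mutually_inverse R.RG m n M ?L"
  proof (rule RG.mutually_inverse_of_left_right[OF L M K])
    show "mat_prod R.RG m ?L M i j = mat_one R.RG i j" if "i < n" "j < n" for i j
      using RG.mat_prod_assoc[OF U(1) C M that] U(2) that by (simp add: mutually_inverse_iff)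
    show "mat_prod R.RG n M ?K i j = mat_one R.RG i j" if "i < m" "j < m" for i j
      using RG.mat_prod_assoc[OF M C V(1) that] V(2) that by (simp add: mutually_inverse_iff)
  qed
  then show ?thesis using M L by (auto simp: invertible_matrix_def)
qed

end

section \<open>Integer multiples in rings\<close>

abbreviation zmult :: "('a, 'r) ring_scheme \<Rightarrow> int \<Rightarrow> 'a \<Rightarrow> 'a" (infixr \<open>\<bullet>\<index>\<close> 80) where
  "k \<bullet>\<^bsub>R\<^esub> x \<equiv> add_pow R k x"

context ring
begin

lemma zmult_closed [simp]: "x \<in> carrier R \<Longrightarrow> k \<bullet> x \<in> carrier R"
  unfolding add_pow_def using a_group group.int_pow_closed[OF a_group] by simp

lemma zmult_add_left: "x \<in> carrier R \<Longrightarrow> ((k + l :: int)) \<bullet> x = k \<bullet> x \<oplus> l \<bullet> x"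
  unfolding add_pow_def using group.int_pow_mult[OF a_group, of x k l] by simp

lemma zmult_assoc: "x \<in> carrier R \<Longrightarrow> k \<bullet> (l \<bullet> x) = (k * l) \<bullet> x"
  unfolding add_pow_def using group.int_pow_pow[OF a_group, of x l k] by (simp add: mult.commute)

lemma zmult_add_right: "x \<in> carrier R \<Longrightarrow> y \<in> carrier R \<Longrightarrow> k \<bullet> (x \<oplus> y) = k \<bullet> x \<oplus> k \<bullet> y"
  unfolding add_pow_def using comm_group.int_pow_distrib[OF a_comm_group, of x y k] by simp

lemma zmult_one [simp]: "x \<in> carrier R \<Longrightarrow> 1 \<bullet> x = x"
  unfolding add_pow_def using group.int_pow_1[OF a_group, of x] by simp

lemma zmult_zero_left [simp]: "0 \<bullet> x = \<zero>"
  unfolding add_pow_def by simp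

lemma zmult_zero_right [simp]: "k \<bullet> \<zero> = \<zero>"
  unfolding add_pow_def using group.int_pow_one[OF a_group, of k] by simp

lemma zmult_mult_left: "x \<in> carrier R \<Longrightarrow> y \<in> carrier R \<Longrightarrow> (k \<bullet> x) \<otimes> y = k \<bullet> (x \<otimes> y)"
  by (rule add_pow_ldistr_int)

lemma zmult_mult_right: "x \<in> carrier R \<Longrightarrow> y \<in> carrier R \<Longrightarrow> x \<otimes> (k \<bullet> y) = k \<bullet> (x \<otimes> y)"
  by (rule add_pow_rdistr_int)

lemma zmult_minus_right: "x \<in> carrier R \<Longrightarrow> k \<bullet> (\<ominus> x) = \<ominus> (k \<bullet> x)"
proof -
  assume x: "x \<in> carrier R"
  then have "k \<bullet> (\<ominus> x) \<oplus> k \<bullet> x = \<zero>" by (simp add: zmult_add_right[symmetric] l_neg)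
  then show ?thesis using x minus_equality[of "k \<bullet> (\<ominus> x)" "k \<bullet> x"] by simp
qed

lemma zmult_diff_right: "x \<in> carrier R \<Longrightarrow> y \<in> carrier R \<Longrightarrow> k \<bullet> (x \<ominus> y) = k \<bullet> x \<ominus> k \<bullet> y"
  by (simp add: a_minus_def zmult_add_right zmult_minus_right)

lemma zmult_of_nat: "(int k) \<bullet> x = add_pow R k x"
  by (simp add: add_pow_int_ge)

lemma minus_mult_left: "x \<in> carrier R \<Longrightarrow> y \<in> carrier R \<Longrightarrow> z \<in> carrier R \<Longrightarrow> (x \<ominus> y) \<otimes> z = x \<otimes> z \<ominus> y \<otimes> z"
  by (simp add: a_minus_def l_distr l_minus)

lemma minus_mult_right: "x \<in> carrier R \<Longrightarrow> y \<in> carrier R \<Longrightarrow> z \<in> carrier R \<Longrightarrow> z \<otimes> (x \<ominus> y) = z \<otimes> x \<ominus> z \<otimes> y"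
  by (simp add: a_minus_def r_distr r_minus)

lemma zmult_coprime_cancel:
  assumes "coprime k l" "x \<in> carrier R" "k \<bullet> x = \<zero>" "l \<bullet> x = \<zero>"
  shows "x = \<zero>"
proof -
  obtain a b where ab: "a * k + b * l = 1"
    using assms(1) by (metis bezout_int coprime_imp_gcd_eq_1)
  have "x = (a * k + b * l) \<bullet> x" using assms(2) by (simp add: ab)
  also have "\<dots> = a \<bullet> (k \<bullet> x) \<oplus> b \<bullet> (l \<bullet> x)"
    using assms(2) by (simp add: zmult_add_left zmult_assoc)
  also have "\<dots> = \<zero>" by (simp add: assms(3,4))
  finally show ?thesis .
qed

end

lemma ring_hom_zmult:
  assumes "ring R" "ring S" "h \<in> ring_hom R S" "x \<in> carrier R"
  shows "h (k \<bullet>\<^bsub>R\<^esub> x) = k \<bullet>\<^bsub>S\<^esub> h x"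
proof -
  interpret ring_hom_ring R S h by (rule ring_hom_ringI2[OF assms(1-3)])
  show ?thesis
    unfolding add_pow_def using group_hom.hom_int_pow[OF a_group_hom] assms(4) by simp
qed

lemma ring_hom_diff:
  assumes "ring R" "ring S" "h \<in> ring_hom R S" "x \<in> carrier R" "y \<in> carrier R"
  shows "h (x \<ominus>\<^bsub>R\<^esub> y) = h x \<ominus>\<^bsub>S\<^esub> h y"
proof -
  interpret ring_hom_ring R S h by (rule ring_hom_ringI2[OF assms(1-3)])
  show ?thesis using assms(4,5) by (simp add: a_minus_def)
qed

lemma (in std_group_ring) gr_zmult_apply:
  assumes "u \<in> carrier RG" "g \<in> carrier G"
  shows "(k \<bullet>\<^bsub>RG\<^esub> u) g = of_int k * u g"
proof -
  interpret RG: ring RG by (rule gr_ring)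
  show ?thesis
  proof (induction k rule: int_induct[where k = 0])
    case (step2 k)
    have "(k - 1) \<bullet>\<^bsub>RG\<^esub> u = k \<bullet>\<^bsub>RG\<^esub> u \<oplus>\<^bsub>RG\<^esub> \<ominus>\<^bsub>RG\<^esub> u"
      using RG.zmult_add_left[OF assms(1), of "k - 1" 1] assms(1) by (simp add: RG.a_assoc RG.r_neg)
    then show ?case using assms step2 by (simp add: gr_add_apply gr_minus_apply ring_distribs)
  qed (use assms in \<open>auto simp: gr_zero_apply RG.zmult_add_left gr_add_apply ring_distribs\<close>)
qed

section \<open>The localization of the integral group ring\<close>

locale finite_group_localization = group G for G :: "('g, 'm) monoid_scheme" (structure) +
  assumes finite_G: "finite (carrier G)"
begin

sublocale ZG: std_group_ring \<Z> G by (rule std_group_ring_int[OF is_group finite_G])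

abbreviation A where "A \<equiv> group_ring \<Z> G"
abbreviation aug where "aug \<equiv> augmentation \<Z> G"
abbreviation L where "L \<equiv> cohn_localization A \<Z> aug"
abbreviation emb where "emb \<equiv> cohn_map A \<Z> aug"
abbreviation delta :: "'g \<Rightarrow> 'g \<Rightarrow> int" where "delta \<equiv> group_elt G"

definition gam :: "'g \<Rightarrow> ('g \<Rightarrow> int) cohn_term set" where "gam g = emb (delta g)"

sublocale A: ring A by (rule ZG.gr_ring)
sublocale L: ring L by (rule cohn_localization_ring[OF A.ring_axioms])

lemma emb_hom: "emb \<in> ring_hom A L" by (rule cohn_map_ring_hom[OF A.ring_axioms])

sublocale emb: ring_hom_ring A L emb by (rule ring_hom_ringI2[OF A.ring_axioms L.ring_axioms emb_hom])

lemma aug_hom: "aug \<in> ring_hom A \<Z>" by (rule ZG.augmentation_hom)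

sublocale aug: ring_hom_ring A \<Z> aug by (rule ring_hom_ringI2[OF A.ring_axioms int.ring_axioms aug_hom])

lemma aug_simps:
  "u \<in> carrier A \<Longrightarrow> v \<in> carrier A \<Longrightarrow> aug (u \<oplus>\<^bsub>A\<^esub> v) = aug u + aug v"
  "u \<in> carrier A \<Longrightarrow> v \<in> carrier A \<Longrightarrow> aug (u \<otimes>\<^bsub>A\<^esub> v) = aug u * aug v"
  "aug \<one>\<^bsub>A\<^esub> = 1" "aug \<zero>\<^bsub>A\<^esub> = 0"
  "u \<in> carrier A \<Longrightarrow> aug (\<ominus>\<^bsub>A\<^esub> u) = - aug u"
  "u \<in> carrier A \<Longrightarrow> v \<in> carrier A \<Longrightarrow> aug (u \<ominus>\<^bsub>A\<^esub> v) = aug u - aug v"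
  using aug.hom_add[of u v] aug.hom_mult[of u v] aug.hom_one aug.hom_zero aug.hom_a_inv[of u] ring_hom_diff[OF A.ring_axioms int.ring_axioms aug_hom, of u v]
  by (auto simp: int_a_inv_eq int_a_minus_eq)

lemma aug_zmult: "u \<in> carrier A \<Longrightarrow> aug (k \<bullet>\<^bsub>A\<^esub> u) = k * aug u"
  by (simp add: ZG.augmentation_sum ZG.gr_zmult_apply sum_distrib_left)

lemma emb_diff: "u \<in> carrier A \<Longrightarrow> v \<in> carrier A \<Longrightarrow> emb (u \<ominus>\<^bsub>A\<^esub> v) = emb u \<ominus>\<^bsub>L\<^esub> emb v"
  by (rule ring_hom_diff[OF A.ring_axioms L.ring_axioms emb_hom])

lemma emb_zmult: "u \<in> carrier A \<Longrightarrow> emb (k \<bullet>\<^bsub>A\<^esub> u) = k \<bullet>\<^bsub>L\<^esub> emb u"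
  by (rule ring_hom_zmult[OF A.ring_axioms L.ring_axioms emb_hom])

lemma gam_closed [simp]: "gam g \<in> carrier L"
  by (simp add: gam_def ZG.group_elt_closed)

lemma gam_mult: "g \<in> carrier G \<Longrightarrow> h \<in> carrier G \<Longrightarrow> gam (g \<otimes> h) = gam g \<otimes>\<^bsub>L\<^esub> gam h"
  by (simp add: gam_def ZG.group_elt_closed flip: ZG.group_elt_mult)

lemma gam_one: "gam \<one> = \<one>\<^bsub>L\<^esub>"
  using emb.hom_one by (simp add: gam_def ZG.gr_one)

text \<open>The source of the explicit units: elements of augmentation one, and matrices congruent
  to the identity modulo the augmentation ideal.\<close>

lemma inverted_if_unimodular:
  assumes "M \<in> matrices A n n" "\<And>i j. i < n \<Longrightarrow> j < n \<Longrightarrow> aug (M i j) = (if i = j then 1 else 0)"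
  shows "M \<in> inverted_matrices A \<Z> aug n n"
proof -
  have "(\<Sum>k<n. aug (M i k) * (if k = j then 1 else 0)) = (if i = j then 1 else 0)"
    "(\<Sum>k<n. (if i = k then 1 else 0) * aug (M k j)) = (if i = j then 1 else 0)" if "i < n" "j < n" for i j
  proof -
    have "(\<Sum>k<n. aug (M i k) * (if k = j then 1 else 0)) = (\<Sum>k<n. if k = j then aug (M i k) else 0)"
      by (intro sum.cong) auto
    then show "(\<Sum>k<n. aug (M i k) * (if k = j then 1 else 0)) = (if i = j then 1 else 0)"
      using that assms(2) by simp
    have "(\<Sum>k<n. (if i = k then 1 else 0) * aug (M k j)) = (\<Sum>k<n. if i = k then aug (M k j) else 0)"
      by (intro sum.cong) auto
    then show "(\<Sum>k<n. (if i = k then 1 else 0) * aug (M k j)) = (if i = j then 1 else 0)"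
      using that assms(2) by simp
  qed
  then have "mutually_inverse \<Z> n n (\<lambda>i j. aug (M i j)) (\<lambda>i j. if i = j then 1 else 0)"
    unfolding mutually_inverse_def int_finsum_eq by simp
  then show ?thesis
    using assms(1) unfolding inverted_matrices_def invertible_matrix_def
    by (auto simp: matrices_def intro!: bexI[of _ "\<lambda>i j. if i = j then 1 else 0"])
qed

lemma emb_unit:
  assumes u: "u \<in> carrier A" "aug u = 1"
  obtains v where "v \<in> carrier L" "emb u \<otimes>\<^bsub>L\<^esub> v = \<one>\<^bsub>L\<^esub>" "v \<otimes>\<^bsub>L\<^esub> emb u = \<one>\<^bsub>L\<^esub>"
proof -
  have "(\<lambda>i j. u) \<in> inverted_matrices A \<Z> aug 1 1"
    by (rule inverted_if_unimodular) (use u in \<open>auto simp: matrices_def\<close>)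
  from cohn_map_inverts[OF A.ring_axioms this] obtain N
    where N: "N \<in> matrices L 1 1" "mutually_inverse L 1 1 (\<lambda>i j. emb u) N"
    by (auto simp: invertible_matrix_def)
  have "N 0 0 \<in> carrier L" using N(1) by (simp add: matrices_def)
  then show thesis
    using N(2) u(1) by (intro that[of "N 0 0"]) (auto simp: mutually_inverse_def lessThan_Suc)
qed

text \<open>A Nakayama lemma: a finitely generated \<open>A\<close>-submodule of the localization which equals its
  product with the augmentation ideal vanishes.\<close>

lemma perfect_family_zero:
  fixes n :: nat
  assumes t: "\<And>j. j < n \<Longrightarrow> t j \<in> carrier L"
    and X: "\<And>i j. i < n \<Longrightarrow> j < n \<Longrightarrow> X i j \<in> carrier A \<and> aug (X i j) = 0"
    and eq: "\<And>i. i < n \<Longrightarrow> t i = (\<Oplus>\<^bsub>L\<^esub>j\<in>{..<n}. emb (X i j) \<otimes>\<^bsub>L\<^esub> t j)"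
    and i: "i < n"
  shows "t i = \<zero>\<^bsub>L\<^esub>"
proof -
  \<comment> \<open>\<open>M = 1 - X\<close> becomes invertible in the localization, while the
    hypothesis says that it annihilates the column \<open>t\<close>.\<close>
  define M where "M = (\<lambda>i j. mat_one A i j \<ominus>\<^bsub>A\<^esub> X i j)"
  have one: "mat_one A i j \<in> carrier A" for i j by (simp add: mat_one_def)
  have M: "M \<in> matrices A n n" using X one by (auto simp: matrices_def M_def)
  have "aug (M i j) = (if i = j then 1 else 0)" if "i < n" "j < n" for i j
    using X[OF that] one by (simp add: M_def aug_simps) (simp add: mat_one_def aug_simps)
  from inverted_if_unimodular[OF M this]
  have "invertible_matrix L n n (\<lambda>i j. emb (M i j))" by (rule cohn_map_inverts[OF A.ring_axioms])
  then obtain N where N: "N \<in> matrices L n n" and NM: "mutually_inverse L n n (\<lambda>i j. emb (M i j)) N"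
    by (auto simp: invertible_matrix_def)
  let ?T = "\<lambda>i (j::nat). t i"
  have T: "?T \<in> matrices L n 1" using t by (simp add: matrices_def)
  have eM: "(\<lambda>i j. emb (M i j)) \<in> matrices L n n" by (rule ring_hom_matrices[OF emb_hom M])
  have zero: "mat_prod L n (\<lambda>i j. emb (M i j)) ?T k 0 = \<zero>\<^bsub>L\<^esub>" if k: "k < n" for k
  proof -
    have "mat_prod L n (\<lambda>i j. emb (M i j)) ?T k 0
        = (\<Oplus>\<^bsub>L\<^esub>j\<in>{..<n}. mat_one L k j \<otimes>\<^bsub>L\<^esub> t j \<oplus>\<^bsub>L\<^esub> \<ominus>\<^bsub>L\<^esub> (emb (X k j) \<otimes>\<^bsub>L\<^esub> t j))"
      unfolding mat_prod_def
    proof (rule L.finsum_cong')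
      fix j assume "j \<in> {..<n}"
      then have j: "j < n" by simp
      have "emb (M k j) = mat_one L k j \<ominus>\<^bsub>L\<^esub> emb (X k j)"
        using X[OF k j] one ring_hom_mat_one[OF A.ring_axioms L.ring_axioms emb_hom, of k j]
        by (simp add: M_def emb_diff)
      then show "emb (M k j) \<otimes>\<^bsub>L\<^esub> t j
          = mat_one L k j \<otimes>\<^bsub>L\<^esub> t j \<oplus>\<^bsub>L\<^esub> \<ominus>\<^bsub>L\<^esub> (emb (X k j) \<otimes>\<^bsub>L\<^esub> t j)"
        using X[OF k j] t[OF j] matricesD[OF L.mat_one_closed k j]
        by (simp add: L.minus_mult_left) (simp add: a_minus_def)
    qed (use X k t matricesD[OF L.mat_one_closed[of n]] in auto)
    also have "\<dots> = mat_prod L n (mat_one L) ?T k 0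
        \<oplus>\<^bsub>L\<^esub> (\<Oplus>\<^bsub>L\<^esub>j\<in>{..<n}. \<ominus>\<^bsub>L\<^esub> (emb (X k j) \<otimes>\<^bsub>L\<^esub> t j))"
      unfolding mat_prod_def
      by (rule L.finsum_addf) (use X k t matricesD[OF L.mat_one_closed[of n]] in auto)
    also have "mat_prod L n (mat_one L) ?T k 0 = t k"
      using L.mat_prod_one_left[OF T k, of 0] by simp
    also have "(\<Oplus>\<^bsub>L\<^esub>j\<in>{..<n}. \<ominus>\<^bsub>L\<^esub> (emb (X k j) \<otimes>\<^bsub>L\<^esub> t j))
        = (\<Oplus>\<^bsub>L\<^esub>j\<in>{..<n}. \<ominus>\<^bsub>L\<^esub> \<one>\<^bsub>L\<^esub> \<otimes>\<^bsub>L\<^esub> (emb (X k j) \<otimes>\<^bsub>L\<^esub> t j))"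
      by (rule L.finsum_cong') (use X k t in \<open>auto simp: L.l_minus\<close>)
    also have "\<dots> = \<ominus>\<^bsub>L\<^esub> \<one>\<^bsub>L\<^esub> \<otimes>\<^bsub>L\<^esub> (\<Oplus>\<^bsub>L\<^esub>j\<in>{..<n}. emb (X k j) \<otimes>\<^bsub>L\<^esub> t j)"
      by (rule L.finsum_rdistr[symmetric]) (use X k t in auto)
    also have "\<dots> = \<ominus>\<^bsub>L\<^esub> t k" using eq[OF k] t[OF k] by (simp add: L.l_minus)
    finally show ?thesis using t[OF k] by (simp add: L.r_neg)
  qed
  have "t i = mat_prod L n N (mat_prod L n (\<lambda>i j. emb (M i j)) ?T) i 0"
    by (rule L.mat_prod_left_cancel[OF N eM T _ i, symmetric]) (use NM in \<open>auto simp: mutually_inverse_iff\<close>)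
  also have "\<dots> = (\<Oplus>\<^bsub>L\<^esub>l\<in>{..<n}. \<zero>\<^bsub>L\<^esub>)"
    unfolding mat_prod_def[of L n N]
    by (rule L.finsum_cong') (use zero matricesD[OF N i] in auto)
  finally show ?thesis by simp
qed

subsection \<open>Norm elements\<close>

definition norm_elt :: "'g set \<Rightarrow> 'g \<Rightarrow> int" where
  "norm_elt H = (\<lambda>x\<in>carrier G. if x \<in> H then 1 else 0)"

lemma norm_elt_closed: "norm_elt H \<in> carrier A"
  by (auto simp: norm_elt_def ZG.gr_carrier)

lemma aug_norm_elt: "H \<subseteq> carrier G \<Longrightarrow> aug (norm_elt H) = int (card H)"
proof -
  assume H: "H \<subseteq> carrier G"
  have "aug (norm_elt H) = (\<Sum>x\<in>carrier G. if x \<in> H then 1 else 0)"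
    unfolding ZG.augmentation_sum[OF norm_elt_closed] by (simp add: norm_elt_def)
  also have "\<dots> = int (card (carrier G \<inter> H))"
    using finite_G by (simp add: sum.If_cases)
  also have "carrier G \<inter> H = H" using H by blast
  finally show ?thesis .
qed

lemma norm_elt_mult:
  assumes "subgroup H G" "h \<in> H"
  shows "delta h \<otimes>\<^bsub>A\<^esub> norm_elt H = norm_elt H" "norm_elt H \<otimes>\<^bsub>A\<^esub> delta h = norm_elt H"
proof -
  interpret H: subgroup H G by fact
  have h: "h \<in> carrier G" using assms(2) by (rule H.mem_carrier)
  have l: "inv h \<otimes> g \<in> H \<longleftrightarrow> g \<in> H" if g: "g \<in> carrier G" for g
  proof
    assume "inv h \<otimes> g \<in> H"
    then have "h \<otimes> (inv h \<otimes> g) \<in> H" using assms(2) by simp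
    then show "g \<in> H" using g h by (simp add: m_assoc[symmetric])
  qed (use assms(2) in simp)
  have r: "g \<otimes> inv h \<in> H \<longleftrightarrow> g \<in> H" if g: "g \<in> carrier G" for g
  proof
    assume "g \<otimes> inv h \<in> H"
    from H.m_closed[OF this assms(2)] have "(g \<otimes> inv h) \<otimes> h \<in> H" .
    then show "g \<in> H" using g h by (simp add: m_assoc)
  qed (use assms(2) in simp)
  show "delta h \<otimes>\<^bsub>A\<^esub> norm_elt H = norm_elt H"
    by (rule ZG.gr_ext)
      (use h l in \<open>auto simp: ZG.gr_mult_closed ZG.group_elt_closed norm_elt_closed ZG.group_elt_mult_apply,
        auto simp: norm_elt_def\<close>)
  show "norm_elt H \<otimes>\<^bsub>A\<^esub> delta h = norm_elt H"
  proof (rule ZG.gr_ext)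
    fix g assume g: "g \<in> carrier G"
    have "(norm_elt H \<otimes>\<^bsub>A\<^esub> delta h) g = (\<Sum>y\<in>carrier G. delta h y * norm_elt H (g \<otimes> inv y))"
      using g by (simp add: ZG.gr_mult_apply'[OF norm_elt_closed ZG.group_elt_closed] mult.commute)
    also have "\<dots> = norm_elt H (g \<otimes> inv h)" by (rule ZG.sum_group_elt[OF h])
    also have "\<dots> = norm_elt H g" using g h r[OF g] by (simp add: norm_elt_def)
    finally show "(norm_elt H \<otimes>\<^bsub>A\<^esub> delta h) g = norm_elt H g" .
  qed (auto simp: ZG.gr_mult_closed ZG.group_elt_closed norm_elt_closed)
qed

lemma emb_norm_elt:
  assumes "H \<subseteq> carrier G"
  shows "emb (norm_elt H) = (\<Oplus>\<^bsub>L\<^esub>h\<in>H. gam h)"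
proof -
  have fin: "finite H" using assms finite_G finite_subset by blast
  have "norm_elt H = (\<Oplus>\<^bsub>A\<^esub>h\<in>H. delta h)"
  proof (rule ZG.gr_ext)
    fix x assume x: "x \<in> carrier G"
    have "(\<Oplus>\<^bsub>A\<^esub>h\<in>H. delta h) x = (\<Sum>h\<in>H. delta h x)"
      by (rule ZG.gr_finsum_apply) (use x fin in \<open>auto simp: ZG.group_elt_closed\<close>)
    also have "\<dots> = norm_elt H x"
      using x fin by (simp add: norm_elt_def group_elt_def)
    finally show "norm_elt H x = (\<Oplus>\<^bsub>A\<^esub>h\<in>H. delta h) x" by simp
  qed (auto simp: norm_elt_closed ZG.group_elt_closed)
  then show ?thesis
    by (simp add: emb.hom_finsum ZG.group_elt_closed comp_def gam_def)
qed

lemma norm_elt_fixed: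
  assumes "H \<subseteq> carrier G" "x \<in> carrier L" "\<And>h. h \<in> H \<Longrightarrow> gam h \<otimes>\<^bsub>L\<^esub> x = x"
  shows "emb (norm_elt H) \<otimes>\<^bsub>L\<^esub> x = (int (card H)) \<bullet>\<^bsub>L\<^esub> x"
proof -
  have fin: "finite H" using assms finite_G finite_subset by blast
  have "emb (norm_elt H) \<otimes>\<^bsub>L\<^esub> x = (\<Oplus>\<^bsub>L\<^esub>h\<in>H. gam h \<otimes>\<^bsub>L\<^esub> x)"
    unfolding emb_norm_elt[OF assms(1)] by (rule L.finsum_ldistr) (use fin assms in auto)
  also have "\<dots> = (\<Oplus>\<^bsub>L\<^esub>h\<in>H. x)"
    by (rule L.finsum_cong') (use assms in auto)
  also have "\<dots> = add_pow L (card H) x" using assms(2) by (rule L.add.finprod_const)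
  finally show ?thesis by (simp add: L.zmult_of_nat)
qed

lemma cyclic_norm:
  assumes h: "h \<in> carrier G"
  obtains N where "N \<in> carrier A" "aug N = int (ord h)"
    "delta h \<otimes>\<^bsub>A\<^esub> N = N" "N \<otimes>\<^bsub>A\<^esub> delta h = N"
proof
  have sub: "subgroup (generate G {h}) G" using h by (intro generate_is_subgroup) simp
  have "h \<in> generate G {h}" by (rule generate.incl) simp
  then show "delta h \<otimes>\<^bsub>A\<^esub> norm_elt (generate G {h}) = norm_elt (generate G {h})"
    "norm_elt (generate G {h}) \<otimes>\<^bsub>A\<^esub> delta h = norm_elt (generate G {h})"
    using norm_elt_mult[OF sub] by auto
  show "aug (norm_elt (generate G {h})) = int (ord h)"
    using aug_norm_elt[OF subgroup.subset[OF sub]] generate_pow_card[OF h] by simp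
qed (rule norm_elt_closed)

text \<open>\<open>N\<close> is annihilated by \<open>1 - h\<close> on both sides, so
  \<open>u\<close> can be placed on either side of \<open>1 - h\<close>. With \<open>u\<close> on
  the right the formula yields divisibility of \<open>1 - h\<close>, with \<open>u\<close> on the
  left it controls the action of \<open>h\<close> on torsion.\<close>

lemma divisibility_unit:
  assumes h: "h \<in> carrier G" and cop: "coprime (int (ord h)) q"
  obtains u v b where "u \<in> carrier A" "v \<in> carrier L"
    "emb u \<otimes>\<^bsub>L\<^esub> v = \<one>\<^bsub>L\<^esub>" "v \<otimes>\<^bsub>L\<^esub> emb u = \<one>\<^bsub>L\<^esub>"
    "(\<one>\<^bsub>L\<^esub> \<ominus>\<^bsub>L\<^esub> gam h) \<otimes>\<^bsub>L\<^esub> emb u = (b * q) \<bullet>\<^bsub>L\<^esub> (\<one>\<^bsub>L\<^esub> \<ominus>\<^bsub>L\<^esub> gam h)"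
    "emb u \<otimes>\<^bsub>L\<^esub> (\<one>\<^bsub>L\<^esub> \<ominus>\<^bsub>L\<^esub> gam h) = (b * q) \<bullet>\<^bsub>L\<^esub> (\<one>\<^bsub>L\<^esub> \<ominus>\<^bsub>L\<^esub> gam h)"
proof -
  obtain a b where ab: "a * int (ord h) + b * q = 1"
    using cop by (metis bezout_int coprime_imp_gcd_eq_1)
  obtain N where N: "N \<in> carrier A" "aug N = int (ord h)"
    "delta h \<otimes>\<^bsub>A\<^esub> N = N" "N \<otimes>\<^bsub>A\<^esub> delta h = N"
    using cyclic_norm[OF h] .
  define u where "u = a \<bullet>\<^bsub>A\<^esub> N \<oplus>\<^bsub>A\<^esub> (b * q) \<bullet>\<^bsub>A\<^esub> \<one>\<^bsub>A\<^esub>"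
  have u: "u \<in> carrier A" using N by (simp add: u_def)
  have "aug u = 1" using N ab by (simp add: u_def aug_simps aug_zmult)
  then obtain v where v: "v \<in> carrier L" "emb u \<otimes>\<^bsub>L\<^esub> v = \<one>\<^bsub>L\<^esub>" "v \<otimes>\<^bsub>L\<^esub> emb u = \<one>\<^bsub>L\<^esub>"
    using emb_unit[OF u] by blast
  let ?d = "\<one>\<^bsub>A\<^esub> \<ominus>\<^bsub>A\<^esub> delta h"
  have d: "?d \<in> carrier A" by (simp add: ZG.group_elt_closed)
  have dN: "?d \<otimes>\<^bsub>A\<^esub> N = \<zero>\<^bsub>A\<^esub>" "N \<otimes>\<^bsub>A\<^esub> ?d = \<zero>\<^bsub>A\<^esub>"
    using N by (simp_all add: A.minus_mult_left A.minus_mult_right ZG.group_elt_closed)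
  have du: "?d \<otimes>\<^bsub>A\<^esub> u = (b * q) \<bullet>\<^bsub>A\<^esub> ?d" "u \<otimes>\<^bsub>A\<^esub> ?d = (b * q) \<bullet>\<^bsub>A\<^esub> ?d"
    using N(1) d dN by (simp_all add: u_def A.r_distr A.l_distr A.zmult_mult_left A.zmult_mult_right del: A.minus_closed)
  have ed: "emb ?d = \<one>\<^bsub>L\<^esub> \<ominus>\<^bsub>L\<^esub> gam h"
    by (simp add: ZG.group_elt_closed gam_def emb_diff)
  show thesis
    using arg_cong[OF du(1), of emb] arg_cong[OF du(2), of emb] u d
    by (intro that[OF u v, of b]) (simp_all only: emb.hom_mult emb_zmult ed)
qed

end

context finite_group_localization
begin

subsection \<open>The ideals generated by elements \<open>1 - h\<close>\<close>

text \<open>A right ideal; it is stable under multiplication by \<open>A\<close> on the left if \<open>H\<close> is closed under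
  conjugation.\<close>

inductive_set diff_ideal :: "'g set \<Rightarrow> ('g \<Rightarrow> int) cohn_term set set" for H :: "'g set" where
  zero: "\<zero>\<^bsub>L\<^esub> \<in> diff_ideal H"
| gen: "h \<in> H \<Longrightarrow> y \<in> carrier L \<Longrightarrow> (\<one>\<^bsub>L\<^esub> \<ominus>\<^bsub>L\<^esub> gam h) \<otimes>\<^bsub>L\<^esub> y \<in> diff_ideal H"
| add: "x \<in> diff_ideal H \<Longrightarrow> y \<in> diff_ideal H \<Longrightarrow> x \<oplus>\<^bsub>L\<^esub> y \<in> diff_ideal H"

lemma diff_ideal_closed: "x \<in> diff_ideal H \<Longrightarrow> x \<in> carrier L"
  by (induction rule: diff_ideal.induct) auto

lemma diff_ideal_mult_right:
  assumes "x \<in> diff_ideal H" "y \<in> carrier L"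
  shows "x \<otimes>\<^bsub>L\<^esub> y \<in> diff_ideal H"
  using assms(1)
proof (induction rule: diff_ideal.induct)
  case zero
  then show ?case using assms(2) diff_ideal.zero by simp
next
  case (gen h z)
  then show ?case using assms(2) diff_ideal.gen[of h H "z \<otimes>\<^bsub>L\<^esub> y"] by (simp add: L.m_assoc)
next
  case (add x1 x2)
  then show ?case using assms(2) diff_ideal.add diff_ideal_closed by (simp add: L.l_distr)
qed

lemma diff_ideal_zmult: "x \<in> diff_ideal H \<Longrightarrow> k \<bullet>\<^bsub>L\<^esub> x \<in> diff_ideal H"
  using diff_ideal_mult_right[of x H "k \<bullet>\<^bsub>L\<^esub> \<one>\<^bsub>L\<^esub>"] diff_ideal_closed[of x H]
  by (simp add: L.zmult_mult_right)

lemma diff_ideal_minus: "x \<in> diff_ideal H \<Longrightarrow> \<ominus>\<^bsub>L\<^esub> x \<in> diff_ideal H"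
  using diff_ideal_mult_right[of x H "\<ominus>\<^bsub>L\<^esub> \<one>\<^bsub>L\<^esub>"] diff_ideal_closed[of x H] by (simp add: L.r_minus)

lemma diff_ideal_finsum:
  assumes "finite I" "\<And>i. i \<in> I \<Longrightarrow> f i \<in> diff_ideal H"
  shows "(\<Oplus>\<^bsub>L\<^esub>i\<in>I. f i) \<in> diff_ideal H"
  using assms
proof (induction I)
  case (insert i I)
  then show ?case
    by (subst L.finsum_insert) (auto intro: diff_ideal.add diff_ideal_closed)
qed (simp add: diff_ideal.zero)

lemma diff_ideal_elt: "h \<in> H \<Longrightarrow> \<one>\<^bsub>L\<^esub> \<ominus>\<^bsub>L\<^esub> gam h \<in> diff_ideal H"
  using diff_ideal.gen[of h H "\<one>\<^bsub>L\<^esub>"] by simp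

text \<open>\<open>g (1 - h) = (1 - g h g^-1) g\<close>.\<close>

lemma diff_ideal_mult_left_gam:
  assumes H: "H \<subseteq> carrier G" and conj: "\<And>g h. g \<in> carrier G \<Longrightarrow> h \<in> H \<Longrightarrow> g \<otimes> h \<otimes> inv g \<in> H"
    and g: "g \<in> carrier G" and x: "x \<in> diff_ideal H"
  shows "gam g \<otimes>\<^bsub>L\<^esub> x \<in> diff_ideal H"
  using x
proof (induction rule: diff_ideal.induct)
  case (gen h y)
  have h: "h \<in> carrier G" using gen H by blast
  have "gam (g \<otimes> h \<otimes> inv g) \<otimes>\<^bsub>L\<^esub> gam g = gam g \<otimes>\<^bsub>L\<^esub> gam h"
    using g h by (simp add: m_assoc flip: gam_mult)
  then have "gam g \<otimes>\<^bsub>L\<^esub> ((\<one>\<^bsub>L\<^esub> \<ominus>\<^bsub>L\<^esub> gam h) \<otimes>\<^bsub>L\<^esub> y)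
      = (\<one>\<^bsub>L\<^esub> \<ominus>\<^bsub>L\<^esub> gam (g \<otimes> h \<otimes> inv g)) \<otimes>\<^bsub>L\<^esub> (gam g \<otimes>\<^bsub>L\<^esub> y)"
    using gen(2) by (simp add: L.minus_mult_left L.minus_mult_right L.m_assoc[symmetric])
  then show ?case using diff_ideal.gen[OF conj[OF g gen(1)], of "gam g \<otimes>\<^bsub>L\<^esub> y"] gen(2) by simp
next
  case (add x y)
  then show ?case using diff_ideal_closed by (simp add: L.r_distr diff_ideal.add)
qed (simp add: diff_ideal.zero)

lemma diff_ideal_mult_left:
  assumes H: "H \<subseteq> carrier G" and conj: "\<And>g h. g \<in> carrier G \<Longrightarrow> h \<in> H \<Longrightarrow> g \<otimes> h \<otimes> inv g \<in> H"
    and a: "a \<in> carrier A" and x: "x \<in> diff_ideal H"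
  shows "emb a \<otimes>\<^bsub>L\<^esub> x \<in> diff_ideal H"
proof -
  have xc: "x \<in> carrier L" by (rule diff_ideal_closed[OF x])
  show ?thesis
    using is_group finite_G a
  proof (induction a rule: int_group_ring_induct)
    case zero
    then show ?case using xc diff_ideal.zero by simp
  next
    case (elt g)
    then show ?case using diff_ideal_mult_left_gam[OF H conj elt x] by (simp add: gam_def)
  next
    case (add u v)
    then show ?case using xc by (simp add: L.l_distr diff_ideal.add)
  next
    case (minus u)
    then show ?case using xc by (simp add: L.l_minus diff_ideal_minus)
  qed
qed

text \<open>\<open>1 - a b = (1 - a) + a (1 - b)\<close> and
  \<open>1 - inv h = - inv h (1 - h)\<close>. Both formulas multiply on the left, which is where
  closure of \<open>H\<close> under conjugation enters.\<close>

lemma diff_ideal_generate: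
  assumes H: "H \<subseteq> carrier G" and conj: "\<And>g h. g \<in> carrier G \<Longrightarrow> h \<in> H \<Longrightarrow> g \<otimes> h \<otimes> inv g \<in> H"
    and k: "k \<in> generate G H"
  shows "\<one>\<^bsub>L\<^esub> \<ominus>\<^bsub>L\<^esub> gam k \<in> diff_ideal H"
proof -
  have mult: "\<one>\<^bsub>L\<^esub> \<ominus>\<^bsub>L\<^esub> gam (a \<otimes> b) = (\<one>\<^bsub>L\<^esub> \<ominus>\<^bsub>L\<^esub> gam a) \<oplus>\<^bsub>L\<^esub> gam a \<otimes>\<^bsub>L\<^esub> (\<one>\<^bsub>L\<^esub> \<ominus>\<^bsub>L\<^esub> gam b)"
    if "a \<in> carrier G" "b \<in> carrier G" for a b
    using that by (simp add: gam_mult L.minus_mult_right) (simp add: a_minus_def L.a_assoc[symmetric] L.r_neg2 L.r_neg L.a_ac)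
  have cl: "k \<in> carrier G" if "k \<in> generate G H" for k
    using generate_in_carrier[OF H that] .
  show ?thesis
    using k
  proof (induction rule: generate.induct)
    case one
    then show ?case by (simp add: gam_one a_minus_def L.r_neg diff_ideal.zero)
  next
    case (incl h)
    then show ?case by (rule diff_ideal_elt)
  next
    case (inv h)
    then have h: "h \<in> carrier G" using H by blast
    have "gam (inv h) \<otimes>\<^bsub>L\<^esub> gam h = \<one>\<^bsub>L\<^esub>" using h by (simp add: gam_one flip: gam_mult)
    then have "gam (inv h) \<otimes>\<^bsub>L\<^esub> (\<one>\<^bsub>L\<^esub> \<ominus>\<^bsub>L\<^esub> gam h) = gam (inv h) \<ominus>\<^bsub>L\<^esub> \<one>\<^bsub>L\<^esub>"
      by (simp add: L.minus_mult_right)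
    then have "\<one>\<^bsub>L\<^esub> \<ominus>\<^bsub>L\<^esub> gam (inv h) = \<ominus>\<^bsub>L\<^esub> (gam (inv h) \<otimes>\<^bsub>L\<^esub> (\<one>\<^bsub>L\<^esub> \<ominus>\<^bsub>L\<^esub> gam h))"
      by (simp add: a_minus_def L.minus_add L.a_comm)
    then show ?case
      using diff_ideal_minus[OF diff_ideal_mult_left_gam[OF H conj inv_closed[OF h] diff_ideal_elt[OF inv]]] by simp
  next
    case (eng a b)
    then show ?case
      using mult[OF cl[OF eng(1)] cl[OF eng(2)]]
        diff_ideal.add[OF eng.IH(1) diff_ideal_mult_left_gam[OF H conj cl[OF eng(1)] eng.IH(2)]] by simp
  qed
qed

lemma diff_ideal_annihilated:
  assumes w: "w \<in> carrier L" and "\<And>h. h \<in> H \<Longrightarrow> w \<otimes>\<^bsub>L\<^esub> gam h = w" and "x \<in> diff_ideal H"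
  shows "w \<otimes>\<^bsub>L\<^esub> x = \<zero>\<^bsub>L\<^esub>"
  using assms(3)
proof (induction rule: diff_ideal.induct)
  case (gen h y)
  then have "w \<otimes>\<^bsub>L\<^esub> (\<one>\<^bsub>L\<^esub> \<ominus>\<^bsub>L\<^esub> gam h) = \<zero>\<^bsub>L\<^esub>"
    using w assms(2) by (simp add: L.minus_mult_right)
  then have "w \<otimes>\<^bsub>L\<^esub> (\<one>\<^bsub>L\<^esub> \<ominus>\<^bsub>L\<^esub> gam h) \<otimes>\<^bsub>L\<^esub> y = \<zero>\<^bsub>L\<^esub>" using gen by simp
  then show ?case using w gen by (simp add: L.m_assoc)
next
  case (add x y)
  then show ?case using w diff_ideal_closed by (simp add: L.r_distr)
qed (use w in simp)

lemma diff_ideal_hom_zero: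
  assumes "ring S" "f \<in> ring_hom L S" "\<And>h. h \<in> H \<Longrightarrow> f (gam h) = \<one>\<^bsub>S\<^esub>" "x \<in> diff_ideal H"
  shows "f x = \<zero>\<^bsub>S\<^esub>"
proof -
  interpret f: ring_hom_ring L S f by (rule ring_hom_ringI2[OF L.ring_axioms assms(1,2)])
  show ?thesis
    using assms(4)
  proof (induction rule: diff_ideal.induct)
    case (gen h y)
    then show ?case
      using assms(3) ring_hom_diff[OF L.ring_axioms assms(1,2), of "\<one>\<^bsub>L\<^esub>" "gam h"]
      by (simp add: a_minus_def f.S.r_neg)
  next
    case (add x y)
    then show ?case using diff_ideal_closed by simp
  qed simp
qed

text \<open>With the unit \<open>u\<close> of \<open>divisibility_unit\<close> and its inverse
  \<open>v\<close>, one has \<open>(1 - h) y = (1 - h) u v y = q (1 - h) (b v y)\<close>. The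
  quotient is again in the ideal, where the norm can be applied to it.\<close>

lemma diff_ideal_divisible:
  assumes H: "H \<subseteq> carrier G" and cop: "\<And>h. h \<in> H \<Longrightarrow> coprime (int (ord h)) q"
    and "x \<in> diff_ideal H"
  shows "\<exists>y\<in>diff_ideal H. x = q \<bullet>\<^bsub>L\<^esub> y"
  using assms(3)
proof (induction rule: diff_ideal.induct)
  case zero
  show ?case by (rule bexI[OF _ diff_ideal.zero]) simp
next
  case (gen h y)
  have h: "h \<in> carrier G" using gen H by blast
  let ?d = "\<one>\<^bsub>L\<^esub> \<ominus>\<^bsub>L\<^esub> gam h"
  obtain u v b where u: "u \<in> carrier A" "v \<in> carrier L" "emb u \<otimes>\<^bsub>L\<^esub> v = \<one>\<^bsub>L\<^esub>"
    "?d \<otimes>\<^bsub>L\<^esub> emb u = (b * q) \<bullet>\<^bsub>L\<^esub> ?d"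
    using divisibility_unit[OF h cop[OF gen(1)]] by metis
  have d: "?d \<in> carrier L" by simp
  have "?d \<otimes>\<^bsub>L\<^esub> y = ?d \<otimes>\<^bsub>L\<^esub> (emb u \<otimes>\<^bsub>L\<^esub> v) \<otimes>\<^bsub>L\<^esub> y" using u d by simp
  also have "\<dots> = (?d \<otimes>\<^bsub>L\<^esub> emb u) \<otimes>\<^bsub>L\<^esub> v \<otimes>\<^bsub>L\<^esub> y"
    using u(1,2) d by (simp only: L.m_assoc emb.hom_closed)
  also have "\<dots> = q \<bullet>\<^bsub>L\<^esub> (?d \<otimes>\<^bsub>L\<^esub> (b \<bullet>\<^bsub>L\<^esub> (v \<otimes>\<^bsub>L\<^esub> y)))"
    unfolding u(4) using u(2) d gen(2)
    by (simp add: L.zmult_mult_left L.zmult_mult_right L.zmult_assoc L.m_assoc mult.commute del: L.minus_closed)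
  finally have "?d \<otimes>\<^bsub>L\<^esub> y = q \<bullet>\<^bsub>L\<^esub> (?d \<otimes>\<^bsub>L\<^esub> (b \<bullet>\<^bsub>L\<^esub> (v \<otimes>\<^bsub>L\<^esub> y)))" .
  moreover have "?d \<otimes>\<^bsub>L\<^esub> (b \<bullet>\<^bsub>L\<^esub> (v \<otimes>\<^bsub>L\<^esub> y)) \<in> diff_ideal H"
    using gen u by (intro diff_ideal.gen) auto
  ultimately show ?case by blast
next
  case (add x y)
  then obtain x' y' where "x' \<in> diff_ideal H" "y' \<in> diff_ideal H" "x = q \<bullet>\<^bsub>L\<^esub> x'" "y = q \<bullet>\<^bsub>L\<^esub> y'" by blast
  then show ?case
    using diff_ideal_closed by (intro bexI[of _ "x' \<oplus>\<^bsub>L\<^esub> y'"]) (auto simp: L.zmult_add_right diff_ideal.add)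
qed

text \<open>\<open>(1 - h) x = v u (1 - h) x = v (1 - h) (b q x) = 0\<close>.\<close>

lemma torsion_fixed:
  assumes h: "h \<in> carrier G" and cop: "coprime (int (ord h)) q"
    and x: "x \<in> carrier L" "q \<bullet>\<^bsub>L\<^esub> x = \<zero>\<^bsub>L\<^esub>"
  shows "gam h \<otimes>\<^bsub>L\<^esub> x = x"
proof -
  let ?d = "\<one>\<^bsub>L\<^esub> \<ominus>\<^bsub>L\<^esub> gam h"
  obtain u v b where u: "u \<in> carrier A" "v \<in> carrier L" "v \<otimes>\<^bsub>L\<^esub> emb u = \<one>\<^bsub>L\<^esub>"
    "emb u \<otimes>\<^bsub>L\<^esub> ?d = (b * q) \<bullet>\<^bsub>L\<^esub> ?d"
    using divisibility_unit[OF h cop] by metis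
  have d: "?d \<in> carrier L" by simp
  have "?d \<otimes>\<^bsub>L\<^esub> x = (v \<otimes>\<^bsub>L\<^esub> emb u) \<otimes>\<^bsub>L\<^esub> ?d \<otimes>\<^bsub>L\<^esub> x" using u d x by simp
  also have "\<dots> = v \<otimes>\<^bsub>L\<^esub> (emb u \<otimes>\<^bsub>L\<^esub> ?d) \<otimes>\<^bsub>L\<^esub> x"
    using u(1,2) d by (simp only: L.m_assoc emb.hom_closed)
  also have "\<dots> = v \<otimes>\<^bsub>L\<^esub> (?d \<otimes>\<^bsub>L\<^esub> (b \<bullet>\<^bsub>L\<^esub> (q \<bullet>\<^bsub>L\<^esub> x)))"
    unfolding u(4) using u(2) d x(1)
    by (simp add: L.zmult_mult_left L.zmult_mult_right L.zmult_assoc L.m_assoc del: L.minus_closed)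
  also have "\<dots> = \<zero>\<^bsub>L\<^esub>" using x(2) u(2) d by (simp del: L.minus_closed)
  finally have "x \<ominus>\<^bsub>L\<^esub> gam h \<otimes>\<^bsub>L\<^esub> x = \<zero>\<^bsub>L\<^esub>" using x(1) by (simp add: L.minus_mult_left)
  then show ?thesis using x(1) by simp
qed

end

section \<open>The quotient by the elements of order prime to p\<close>

locale localization_at_prime = finite_group_localization G + prime_nat p
  for G :: "('g, 'm) monoid_scheme" (structure) and p
begin

abbreviation prime_elts :: "'g set" where "prime_elts \<equiv> {g \<in> carrier G. coprime (ord g) p}"
abbreviation K :: "'g set" where "K \<equiv> prime_to_p_subgroup G p"
abbreviation Gp :: "'g set monoid" where "Gp \<equiv> p_quotient G p"

lemma ord_conj:
  assumes "g \<in> carrier G" "h \<in> carrier G"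
  shows "ord (g \<otimes> h \<otimes> inv g) = ord h"
proof -
  have pow: "(g \<otimes> h \<otimes> inv g) [^] n = g \<otimes> h [^] n \<otimes> inv g" for n :: nat
  proof (induction n)
    case (Suc n)
    have "inv g \<otimes> (g \<otimes> z) = z" if "z \<in> carrier G" for z
      using assms that by (simp add: m_assoc[symmetric])
    then show ?case using assms Suc by (simp add: m_assoc)
  qed (use assms in simp)
  have "(g \<otimes> h \<otimes> inv g) [^] n = \<one> \<longleftrightarrow> h [^] n = \<one>" for n :: nat
  proof
    assume "(g \<otimes> h \<otimes> inv g) [^] n = \<one>"
    then have "g \<otimes> h [^] n \<otimes> inv g = \<one>" by (simp add: pow)
    then have "inv g \<otimes> (g \<otimes> h [^] n \<otimes> inv g) \<otimes> g = inv g \<otimes> \<one> \<otimes> g" by simp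
    then show "h [^] n = \<one>" using assms by (simp add: m_assoc) (simp add: m_assoc[symmetric])
  qed (use assms pow in simp)
  then show ?thesis using assms ord_unique[of "g \<otimes> h \<otimes> inv g" "ord h"] by (simp add: pow_eq_id)
qed

lemma prime_elts_conj: "g \<in> carrier G \<Longrightarrow> h \<in> prime_elts \<Longrightarrow> g \<otimes> h \<otimes> inv g \<in> prime_elts"
  by (simp add: ord_conj)

lemma prime_elts_subset: "prime_elts \<subseteq> carrier G" by blast

lemma K_generate: "K = generate G prime_elts"
  by (simp add: prime_to_p_subgroup_def)

lemma K_normal: "K \<lhd> G"
  unfolding K_generate by (rule normal_generateI[OF prime_elts_subset prime_elts_conj])

sublocale K: normal K G by (rule K_normal)

lemma Gp_group: "group Gp"
  unfolding p_quotient_def by (rule K.factorgroup_is_group)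

lemma Gp_carrier: "carrier Gp = (\<lambda>g. K #> g) ` carrier G"
  unfolding p_quotient_def by (rule carrier_FactGroup)

lemma Gp_finite: "finite (carrier Gp)"
  unfolding Gp_carrier using finite_G by simp

lemma proj_hom: "(\<lambda>g. K #> g) \<in> hom G Gp"
  unfolding p_quotient_def by (rule K.r_coset_hom_Mod)

lemma Gp_one: "\<one>\<^bsub>Gp\<^esub> = K"
  by (simp add: p_quotient_def)

lemma proj_K: "h \<in> K \<Longrightarrow> K #> h = \<one>\<^bsub>Gp\<^esub>"
  unfolding Gp_one by (rule coset_join2[OF K.mem_carrier K.subgroup_axioms])

lemma prime_elts_K: "h \<in> prime_elts \<Longrightarrow> h \<in> K"
  unfolding K_generate by (rule generate.incl)

text \<open>Primary decomposition in the cyclic group of \<open>g\<close>: Bezout splits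
  \<open>g\<close> as \<open>y x\<close>, where \<open>x\<close> has \<open>p\<close>-power order
  and \<open>y\<close> has order prime to \<open>p\<close> and so lies in \<open>K\<close>. This
  shows that \<open>Gp\<close> is a \<open>p\<close>-group and supplies the representatives for
  surjectivity.\<close>

lemma coset_p_element:
  assumes g: "g \<in> carrier G"
  shows "\<exists>x\<in>carrier G. K #> x = K #> g \<and> (\<exists>i. ord x = p ^ i)"
proof -
  have o: "ord g > 0" using ord_ge_1[OF finite_G g] by simp
  obtain m where m: "ord g = p ^ multiplicity p (ord g) * m" "\<not> p dvd m"
    using multiplicity_decompose'[of "ord g" p] o p_gt_1 by auto
  define q where "q = p ^ multiplicity p (ord g)"
  have mp: "coprime m p"
    using prime_imp_coprime[OF prime_p m(2)] by (simp add: coprime_commute)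
  then have "coprime m q" by (simp add: q_def)
  then obtain u v where uv: "u * int m + v * int q = 1"
    by (metis bezout_int coprime_imp_gcd_eq_1 coprime_int_iff)
  have og: "int (ord g) = int q * int m" using m(1)[folded q_def] by (metis of_nat_mult)
  let ?x = "g [^] (u * int m)" and ?y = "g [^] (v * int q)"
  have "?x [^] q = \<one>"
  proof -
    have "?x [^] q = g [^] (int (ord g) * u)"
      using g by (simp add: int_pow_pow og ac_simps flip: int_pow_int)
    then show ?thesis using g by (simp add: int_pow_eq_id)
  qed
  then have "ord ?x dvd q" using g by (simp add: pow_eq_id)
  then obtain i where i: "ord ?x = p ^ i" unfolding q_def using divides_primepow_nat[OF prime_p] by blast
  have "?y [^] m = \<one>"
  proof -
    have "?y [^] m = g [^] (int (ord g) * v)"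
      using g by (simp add: int_pow_pow og ac_simps flip: int_pow_int)
    then show ?thesis using g by (simp add: int_pow_eq_id)
  qed
  then have "ord ?y dvd m" using g by (simp add: pow_eq_id)
  then have "?y \<in> prime_elts" using mp g coprime_divisors[of "ord ?y" m p p] by simp
  then have yK: "?y \<in> K" by (rule prime_elts_K)
  have "g = g [^] (v * int q + u * int m)" using g uv by (simp add: add.commute)
  also have "\<dots> = ?y \<otimes> ?x" using g by (rule int_pow_mult)
  finally have "K #> g = K #> (?y \<otimes> ?x)" by simp
  also have "\<dots> = (K #> ?y) #> ?x" using g by (simp add: coset_mult_assoc K.subset)
  also have "K #> ?y = K" using proj_K[OF yK] by (simp add: Gp_one)
  finally show ?thesis using i g by (intro bexI[of _ ?x]) auto
qed

text \<open>By \<open>coset_p_element\<close> every element has \<open>p\<close>-power order. A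
  Sylow subgroup for another prime divisor \<open>r\<close> would contain a nontrivial element whose
  order is also a power of \<open>r\<close>.\<close>

lemma Gp_order: "\<exists>k. order Gp = p ^ k"
proof -
  interpret Q: group Gp by (rule Gp_group)
  have pos: "order Gp > 0" using Q.order_gt_0_iff_finite Gp_finite by simp
  have elt: "\<exists>i. c [^]\<^bsub>Gp\<^esub> (p ^ i) = \<one>\<^bsub>Gp\<^esub>" if c: "c \<in> carrier Gp" for c
  proof -
    obtain g where g: "g \<in> carrier G" "c = K #> g" using c by (auto simp: Gp_carrier)
    obtain x i where x: "x \<in> carrier G" "K #> x = c" "ord x = p ^ i" using coset_p_element[OF g(1)] g(2) by blast
    have "c [^]\<^bsub>Gp\<^esub> (p ^ i) = K #> (x [^] (p ^ i))"
      using hom_nat_pow[OF proj_hom x(1) is_group Gp_group, of "p ^ i"] x(2) by simp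
    also have "\<dots> = \<one>\<^bsub>Gp\<^esub>" using pow_ord_eq_1[OF x(1)] x(3) proj_K[OF K.one_closed] by simp
    finally show ?thesis by blast
  qed
  have only_p: "r = p" if r: "Factorial_Ring.prime r" "r dvd order Gp" for r
  proof (rule ccontr)
    assume "r \<noteq> p"
    obtain m where "order Gp = r ^ multiplicity r (order Gp) * m"
      using multiplicity_dvd[of r "order Gp"] by (elim dvdE)
    from sylow_thm[OF r(1) Gp_group this Gp_finite] obtain H
      where H: "subgroup H Gp" "card H = r ^ multiplicity r (order Gp)" by blast
    have "multiplicity r (order Gp) > 0" using r pos by (simp add: prime_multiplicity_gt_zero_iff)
    then have "card H > 1" using H(2) prime_gt_1_nat[OF r(1)] by (metis one_less_power)
    then obtain c where c: "c \<in> H" "c \<noteq> \<one>\<^bsub>Gp\<^esub>"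
      by (metis card.empty card_1_singleton_iff finite.emptyI insertCI is_singletonI' is_singleton_altdef less_irrefl not_one_less_zero equals0I)
    have cG: "c \<in> carrier Gp" using H(1) c(1) by (rule subgroup.mem_carrier)
    obtain i where i: "c [^]\<^bsub>Gp\<^esub> (p ^ i) = \<one>\<^bsub>Gp\<^esub>" using elt[OF cG] by blast
    interpret S: group "Gp\<lparr>carrier := H\<rparr>" using H(1) Gp_group by (rule subgroup.subgroup_is_group)
    have "c [^]\<^bsub>Gp\<lparr>carrier := H\<rparr>\<^esub> order (Gp\<lparr>carrier := H\<rparr>) = \<one>\<^bsub>Gp\<^esub>"
      using S.pow_order_eq_1[of c] c(1) by simp
    then have "c [^]\<^bsub>Gp\<^esub> card H = \<one>\<^bsub>Gp\<^esub>"
      by (simp add: order_def Q.nat_pow_consistent[symmetric])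
    then have "Q.ord c dvd r ^ multiplicity r (order Gp)" "Q.ord c dvd p ^ i"
      using i cG H(2) by (simp_all add: Q.pow_eq_id)
    moreover have "coprime (r ^ multiplicity r (order Gp)) (p ^ i)"
      using r(1) prime_p \<open>r \<noteq> p\<close> by (simp add: primes_coprime)
    ultimately have "Q.ord c = 1" using coprime_common_divisor_nat by blast
    then show False using Q.ord_eq_1[OF cG] c(2) by simp
  qed
  obtain m where m: "order Gp = p ^ multiplicity p (order Gp) * m" "\<not> p dvd m"
    using multiplicity_decompose'[of "order Gp" p] pos p_gt_1 by auto
  have "m = 1"
  proof (rule ccontr)
    assume "m \<noteq> 1"
    then obtain r where "Factorial_Ring.prime r" "r dvd m" using prime_factor_nat by blast
    then show False using only_p[of r] m by (metis dvd_mult)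
  qed
  then show ?thesis using m(1) by auto
qed

end

context ring
begin

lemma add_eq_imp_eq_diff:
  assumes "a \<in> carrier R" "x \<in> carrier R" "a \<oplus> x = c"
  shows "x = c \<ominus> a"
proof -
  have "(a \<oplus> x) \<ominus> a = x \<oplus> (a \<oplus> \<ominus> a)"
    using assms(1,2) by (simp add: a_minus_def a_comm[of a x] a_assoc)
  then show ?thesis using assms by (simp add: r_neg)
qed

lemma mat_prod_diff:
  assumes "\<And>l. l < k \<Longrightarrow> M i l \<in> carrier R" "\<And>l. l < k \<Longrightarrow> M' i l \<in> carrier R" "\<And>l. l < k \<Longrightarrow> N l j \<in> carrier R"
  shows "mat_prod R k (\<lambda>i j. M i j \<ominus> M' i j) N i j = mat_prod R k M N i j \<ominus> mat_prod R k M' N i j"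
proof -
  have "mat_prod R k M' N i j \<oplus> mat_prod R k (\<lambda>i j. M i j \<ominus> M' i j) N i j
      = (\<Oplus>l\<in>{..<k}. M' i l \<otimes> N l j \<oplus> (M i l \<ominus> M' i l) \<otimes> N l j)"
    unfolding mat_prod_def by (rule finsum_addf[symmetric]) (use assms in auto)
  also have "\<dots> = mat_prod R k M N i j"
    unfolding mat_prod_def
    by (rule finsum_cong', simp)
      (use assms in \<open>auto simp: minus_mult_left, simp add: a_minus_def a_ac r_neg2 r_neg\<close>)
  finally show ?thesis
    by (intro add_eq_imp_eq_diff) (use assms in \<open>auto simp: mat_prod_def intro!: finsum_closed\<close>)
qed

lemma mat_prod_zmult_left:
  assumes "\<And>l. l < k \<Longrightarrow> M i l \<in> carrier R" "\<And>l. l < k \<Longrightarrow> N l j \<in> carrier R"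
  shows "mat_prod R k (\<lambda>i j. q \<bullet> M i j) N i j = q \<bullet> mat_prod R k M N i j"
proof -
  have c: "(\<Oplus>l\<in>{..<k}. M i l \<otimes> N l j) \<in> carrier R" using assms by (intro finsum_closed) auto
  have "mat_prod R k (\<lambda>i j. q \<bullet> M i j) N i j = (\<Oplus>l\<in>{..<k}. (q \<bullet> \<one>) \<otimes> (M i l \<otimes> N l j))"
    unfolding mat_prod_def
    by (rule finsum_cong', simp) (use assms in \<open>auto simp: zmult_mult_left\<close>)
  also have "\<dots> = (q \<bullet> \<one>) \<otimes> (\<Oplus>l\<in>{..<k}. M i l \<otimes> N l j)"
    by (rule finsum_rdistr[symmetric]) (use assms in auto)
  also have "\<dots> = q \<bullet> mat_prod R k M N i j"
    using c by (simp add: mat_prod_def zmult_mult_left)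
  finally show ?thesis .
qed

lemma diff_add_diff:
  "a \<in> carrier R \<Longrightarrow> b \<in> carrier R \<Longrightarrow> c \<in> carrier R \<Longrightarrow> d \<in> carrier R
    \<Longrightarrow> (a \<oplus> b) \<ominus> (c \<oplus> d) = (a \<ominus> c) \<oplus> (b \<ominus> d)"
  by (simp add: a_minus_def minus_add a_ac)

lemma minus_diff_minus:
  "a \<in> carrier R \<Longrightarrow> b \<in> carrier R \<Longrightarrow> (\<ominus> a) \<ominus> (\<ominus> b) = \<ominus> (a \<ominus> b)"
  by (simp add: a_minus_def minus_add)

lemma diff_add_cancel: "a \<in> carrier R \<Longrightarrow> b \<in> carrier R \<Longrightarrow> (a \<ominus> b) \<oplus> b = a"
  by (simp add: a_minus_def a_assoc l_neg)

end

lemma (in std_group_ring) gr_torsion_free: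
  assumes "(0::'a) \<noteq> of_int q" "\<And>x y :: 'a. x * y = 0 \<Longrightarrow> x = 0 \<or> y = 0" "y \<in> carrier RG" "q \<bullet>\<^bsub>RG\<^esub> y = \<zero>\<^bsub>RG\<^esub>"
  shows "y = \<zero>\<^bsub>RG\<^esub>"
proof (rule gr_ext[OF assms(3) gr_zero_closed])
  fix g assume g: "g \<in> carrier G"
  have "of_int q * y g = 0" using gr_zmult_apply[OF assms(3) g, of q] assms(4) g by (simp add: gr_zero_apply)
  then show "y g = \<zero>\<^bsub>RG\<^esub> g" using assms(1,2) g by (metis gr_zero_apply)
qed

section \<open>The map from Z[G] to Z_(p)[G_p] and its extension to the localization\<close>

context localization_at_prime
begin

abbreviation Rp :: "('g set \<Rightarrow> rat) ring" where "Rp \<equiv> group_ring (Z_localized p) Gp"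
abbreviation ZGp :: "('g set \<Rightarrow> int) ring" where "ZGp \<equiv> group_ring \<Z> Gp"
abbreviation top :: "('g \<Rightarrow> int) \<Rightarrow> 'g set \<Rightarrow> rat" where "top \<equiv> to_p_group_ring G p"
abbreviation push :: "('g \<Rightarrow> int) \<Rightarrow> 'g set \<Rightarrow> int" where "push \<equiv> group_ring_push \<Z> G Gp (\<lambda>g. K #> g)"
abbreviation coeff :: "('g set \<Rightarrow> int) \<Rightarrow> 'g set \<Rightarrow> rat" where "coeff \<equiv> group_ring_coeff Gp rat_of_int"
abbreviation D where "D \<equiv> diff_ideal prime_elts"

lemma finite_p_group_Gp: "\<exists>k. finite_p_group p Gp k"
  using Gp_order Gp_group Gp_finite prime_nat_axioms
  by (auto simp: finite_p_group_def finite_p_group_axioms_def)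

lemma group_ring_map_push: "group_ring_map \<Z> G Gp (\<lambda>g. K #> g)"
  by (intro group_ring_map.intro group_ring_map_axioms.intro proj_hom
      std_group_ring_int is_group finite_G Gp_group Gp_finite)

interpretation Q: std_group_ring \<Z> Gp by (rule std_group_ring_int[OF Gp_group Gp_finite])
interpretation P: std_group_ring "Z_localized p" Gp by (rule std_group_ring_Zp[OF Gp_group Gp_finite])
interpretation Qr: ring ZGp by (rule Q.gr_ring)
interpretation Rp: ring Rp by (rule P.gr_ring)

lemma Rp_ring: "ring Rp" by (rule P.gr_ring)

lemma top_eq: "top a = coeff (push a)"
  by (simp add: to_p_group_ring_def)

lemma coeff_ring_hom: "coeff \<in> ring_hom ZGp Rp"
  using finite_p_group_Gp finite_p_group.coeff_hom by blast

lemma push_ring_hom: "push \<in> ring_hom A ZGp"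
  by (rule group_ring_map.push_hom[OF group_ring_map_push])

lemma top_hom: "top \<in> ring_hom A Rp"
  using ring_hom_trans[OF push_ring_hom coeff_ring_hom] by (simp add: to_p_group_ring_def)

lemma top_delta: "g \<in> carrier G \<Longrightarrow> top (delta g) = group_elt Gp (K #> g)"
  unfolding top_eq group_ring_map.push_group_elt[OF group_ring_map_push]
  by (auto simp: group_ring_coeff_def group_elt_def fun_eq_iff)

lemma augmentation_top:
  assumes a: "a \<in> carrier A"
  shows "augmentation (Z_localized p) Gp (top a) = rat_of_int (aug a)"
proof -
  obtain k where "finite_p_group p Gp k" using finite_p_group_Gp by blast
  from finite_p_group.augmentation_coeff[OF this ring_hom_closed[OF push_ring_hom a]]
  show ?thesis unfolding top_eq group_ring_map.augmentation_push[OF group_ring_map_push a] .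
qed

text \<open>The map preserves augmentations, so the criterion for \<open>p\<close>-groups applies to
  the image of \<open>M\<close>; by universality the canonical map then exists.\<close>

lemma top_inverts:
  assumes M: "M \<in> inverted_matrices A \<Z> aug m n"
  shows "invertible_matrix Rp m n (\<lambda>i j. top (M i j))"
proof -
  obtain k where k: "finite_p_group p Gp k" using finite_p_group_Gp by blast
  have MA: "M \<in> matrices A m n" and inv: "invertible_matrix \<Z> m n (\<lambda>i j. aug (M i j))"
    using M by (auto simp: inverted_matrices_def)
  show ?thesis
    by (rule finite_p_group.invertible_matrix_of_augmentation[OF k ring_hom_matrices[OF top_hom MA] _ inv])
      (use augmentation_top matricesD[OF MA] in auto)
qed

lemma canonical_ex1: "\<exists>!b. cohn_factor A \<Z> aug Rp top b"
  by (rule cohn_localization_universal[OF A.ring_axioms Rp_ring top_hom top_inverts])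

lemma top_zero_iff:
  assumes "a \<in> carrier A"
  shows "top a = \<zero>\<^bsub>Rp\<^esub> \<longleftrightarrow> push a = \<zero>\<^bsub>ZGp\<^esub>"
proof
  assume t: "top a = \<zero>\<^bsub>Rp\<^esub>"
  show "push a = \<zero>\<^bsub>ZGp\<^esub>"
  proof (rule Q.gr_ext[OF ring_hom_closed[OF push_ring_hom assms] Q.gr_zero_closed])
    fix y assume y: "y \<in> carrier Gp"
    have "rat_of_int (push a y) = 0"
      using fun_cong[OF t, of y] y by (simp add: top_eq group_ring_coeff_def P.gr_zero_apply)
    then show "push a y = \<zero>\<^bsub>ZGp\<^esub> y" using y by (simp add: Q.gr_zero_apply)
  qed
next
  assume "push a = \<zero>\<^bsub>ZGp\<^esub>"
  then show "top a = \<zero>\<^bsub>Rp\<^esub>"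
    using ring_hom_zero[OF coeff_ring_hom Qr.ring_axioms Rp_ring] by (simp add: top_eq)
qed

definition section_elt :: "'g set \<Rightarrow> 'g" where
  "section_elt c = (SOME g. g \<in> carrier G \<and> K #> g = c)"

lemma section_elt: "c \<in> carrier Gp \<Longrightarrow> section_elt c \<in> carrier G \<and> K #> section_elt c = c"
  unfolding section_elt_def by (rule someI_ex) (auto simp: Gp_carrier)

text \<open>A section of \<open>push\<close>: the coefficient of a coset is moved to its chosen
  representative. It is additive but in general not multiplicative, and additivity is
  enough.\<close>

definition lift :: "('g set \<Rightarrow> int) \<Rightarrow> 'g \<Rightarrow> int" where
  "lift Y = (\<lambda>g\<in>carrier G. if g = section_elt (K #> g) then Y (K #> g) else 0)"

lemma proj_closed: "g \<in> carrier G \<Longrightarrow> K #> g \<in> carrier Gp"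
  by (auto simp: Gp_carrier)

lemma lift_closed: "lift Y \<in> carrier A"
  by (auto simp: lift_def ZG.gr_carrier)

lemma lift_zero: "lift \<zero>\<^bsub>ZGp\<^esub> = \<zero>\<^bsub>A\<^esub>"
  by (rule ZG.gr_ext[OF lift_closed ZG.gr_zero_closed])
    (simp add: lift_def ZG.gr_zero_apply Q.gr_zero_apply proj_closed)

lemma lift_add: "lift (Y \<oplus>\<^bsub>ZGp\<^esub> Z) = lift Y \<oplus>\<^bsub>A\<^esub> lift Z"
  by (rule ZG.gr_ext[OF lift_closed ZG.gr_add_closed[OF lift_closed lift_closed]])
    (simp add: lift_def ZG.gr_add_apply Q.gr_add_apply proj_closed)

lemma lift_minus: "Y \<in> carrier ZGp \<Longrightarrow> lift (\<ominus>\<^bsub>ZGp\<^esub> Y) = \<ominus>\<^bsub>A\<^esub> lift Y"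
  by (rule ZG.gr_ext[OF lift_closed A.a_inv_closed[OF lift_closed]])
    (simp add: ZG.gr_minus_apply lift_closed, simp add: lift_def Q.gr_minus_apply proj_closed)

lemma lift_elt:
  assumes c: "c \<in> carrier Gp"
  shows "lift (group_elt Gp c) = delta (section_elt c)"
proof (rule ZG.gr_ext[OF lift_closed ZG.group_elt_closed])
  fix g assume g: "g \<in> carrier G"
  have "g = section_elt (K #> g) \<and> K #> g = c \<longleftrightarrow> g = section_elt c"
    using section_elt[OF c] by metis
  then show "lift (group_elt Gp c) g = delta (section_elt c) g"
    using g proj_closed[OF g] by (auto simp: lift_def group_elt_def)
qed

lemma push_lift:
  assumes "Y \<in> carrier ZGp"
  shows "push (lift Y) = Y"
  using Gp_group Gp_finite assms
proof (induction Y rule: int_group_ring_induct)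
  case zero
  then show ?case using ring_hom_zero[OF push_ring_hom A.ring_axioms Qr.ring_axioms] by (simp add: lift_zero)
next
  case (elt c)
  then show ?case
    using section_elt[OF elt] by (simp add: lift_elt group_ring_map.push_group_elt[OF group_ring_map_push])
next
  case (add u v)
  then show ?case using ring_hom_add[OF push_ring_hom lift_closed lift_closed] by (simp add: lift_add)
next
  case (minus u)
  interpret h: ring_hom_ring A ZGp push
    by (rule ring_hom_ringI2[OF A.ring_axioms Qr.ring_axioms push_ring_hom])
  show ?case using minus by (simp add: lift_minus lift_closed)
qed

lemma D_generate: "k \<in> K \<Longrightarrow> \<one>\<^bsub>L\<^esub> \<ominus>\<^bsub>L\<^esub> gam k \<in> D"
  unfolding K_generate by (rule diff_ideal_generate[OF prime_elts_subset prime_elts_conj])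

lemma D_mult_left: "a \<in> carrier A \<Longrightarrow> x \<in> D \<Longrightarrow> emb a \<otimes>\<^bsub>L\<^esub> x \<in> D"
  by (rule diff_ideal_mult_left[OF prime_elts_subset prime_elts_conj])

text \<open>If \<open>g = k s\<close> with \<open>k\<close> in \<open>K\<close> and \<open>s\<close>
  the representative of its coset, then \<open>g - s = - (1 - k) s\<close>.\<close>

lemma emb_lift_push:
  assumes "a \<in> carrier A"
  shows "emb a \<ominus>\<^bsub>L\<^esub> emb (lift (push a)) \<in> D"
  using is_group finite_G assms
proof (induction a rule: int_group_ring_induct)
  case zero
  have "emb (lift (push \<zero>\<^bsub>A\<^esub>)) = \<zero>\<^bsub>L\<^esub>"
    using ring_hom_zero[OF push_ring_hom A.ring_axioms Qr.ring_axioms] by (simp add: lift_zero)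
  then show ?case by (simp add: a_minus_def diff_ideal.zero)
next
  case (elt g)
  let ?s = "section_elt (K #> g)"
  have s: "?s \<in> carrier G" "K #> ?s = K #> g" using section_elt[OF proj_closed[OF elt]] by auto
  have "g \<in> K #> ?s" using rcos_self[OF elt K.subgroup_axioms] s(2) by simp
  then obtain k where k: "k \<in> K" "g = k \<otimes> ?s" by (auto simp: r_coset_def)
  have kG: "k \<in> carrier G" using k(1) by (rule K.mem_carrier)
  have "gam g \<ominus>\<^bsub>L\<^esub> gam ?s = \<ominus>\<^bsub>L\<^esub> ((\<one>\<^bsub>L\<^esub> \<ominus>\<^bsub>L\<^esub> gam k) \<otimes>\<^bsub>L\<^esub> gam ?s)"
    using arg_cong[OF k(2), of gam] gam_mult[OF kG s(1)]
    by (simp add: L.minus_mult_left) (simp add: a_minus_def L.minus_add L.a_comm)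
  also have "\<dots> \<in> D" by (intro diff_ideal_minus diff_ideal_mult_right D_generate k gam_closed)
  finally show ?case
    using elt by (simp add: group_ring_map.push_group_elt[OF group_ring_map_push] lift_elt proj_closed gam_def)
next
  case (add u v)
  have "emb (u \<oplus>\<^bsub>A\<^esub> v) \<ominus>\<^bsub>L\<^esub> emb (lift (push (u \<oplus>\<^bsub>A\<^esub> v)))
      = (emb u \<ominus>\<^bsub>L\<^esub> emb (lift (push u))) \<oplus>\<^bsub>L\<^esub> (emb v \<ominus>\<^bsub>L\<^esub> emb (lift (push v)))"
    using add(1,2) by (simp add: ring_hom_add[OF push_ring_hom] lift_add lift_closed L.diff_add_diff)
  then show ?case using add by (simp add: diff_ideal.add)
next
  case (minus u)
  interpret h: ring_hom_ring A ZGp push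
    by (rule ring_hom_ringI2[OF A.ring_axioms Qr.ring_axioms push_ring_hom])
  have "emb (\<ominus>\<^bsub>A\<^esub> u) \<ominus>\<^bsub>L\<^esub> emb (lift (push (\<ominus>\<^bsub>A\<^esub> u))) = \<ominus>\<^bsub>L\<^esub> (emb u \<ominus>\<^bsub>L\<^esub> emb (lift (push u)))"
    using minus(1) by (simp add: lift_minus lift_closed L.minus_diff_minus)
  then show ?case using minus by (simp add: diff_ideal_minus)
qed

text \<open>Since \<open>top\<close> and \<open>push\<close> have the same kernel, the lift of the
  image is zero here.\<close>

lemma emb_top_zero:
  assumes "a \<in> carrier A" "top a = \<zero>\<^bsub>Rp\<^esub>"
  shows "emb a \<in> D"
  using emb_lift_push[OF assms(1)] assms top_zero_iff[OF assms(1)] by (simp add: lift_zero a_minus_def)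

text \<open>Up to integers prime to \<open>p\<close>, the localization is generated by \<open>A\<close> modulo \<open>D\<close>: if \<open>Y\<close> lifts
  \<open>q\<close> times the inverse of \<open>M\<close> over \<open>Z\<^sub>(\<^sub>p\<^sub>)[G\<^sub>p]\<close> and \<open>N\<close> is the inverse of \<open>M\<close> over the
  localization, then \<open>Y = (Y M) N\<close> is congruent to \<open>q N\<close>.\<close>

definition approximable :: "('g \<Rightarrow> int) cohn_term set \<Rightarrow> bool" where
  "approximable x \<longleftrightarrow> x \<in> carrier L \<and>
    (\<exists>q a. \<not> int p dvd q \<and> a \<in> carrier A \<and> q \<bullet>\<^bsub>L\<^esub> x \<ominus>\<^bsub>L\<^esub> emb a \<in> D)"

lemma approximable_inverse_entry:
  assumes M: "M \<in> inverted_matrices A \<Z> aug m n"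
    and N: "N \<in> matrices L n m" and MN: "mutually_inverse L m n (\<lambda>i j. emb (M i j)) N"
    and ij: "i < n" "j < m"
  shows "approximable (N i j)"
proof -
  have MA: "M \<in> matrices A m n" using M by (simp add: inverted_matrices_def)
  have tM: "(\<lambda>i j. top (M i j)) \<in> matrices Rp m n" by (rule ring_hom_matrices[OF top_hom MA])
  obtain T where T: "T \<in> matrices Rp n m" and MT: "mutually_inverse Rp m n (\<lambda>i j. top (M i j)) T"
    using top_inverts[OF M] by (auto simp: invertible_matrix_def)
  have "\<exists>q. \<not> int p dvd q \<and> (\<forall>z\<in>{..<n} \<times> {..<m} \<times> carrier Gp. \<exists>a. rat_of_int q * T (fst z) (fst (snd z)) (snd (snd z)) = rat_of_int a)"
    by (rule Zp_common_denominator) (use Gp_finite P.gr_closed[OF matricesD[OF T]] in auto)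
  then obtain q where q: "\<not> int p dvd q"
    and qT: "\<And>i j c. i < n \<Longrightarrow> j < m \<Longrightarrow> c \<in> carrier Gp \<Longrightarrow> \<exists>a. rat_of_int q * T i j c = rat_of_int a"
    by force
  \<comment> \<open>The numbers \<open>rat_of_int q * T i j c\<close> are integers, so the floor
    merely changes their type.\<close>
  define Y where "Y = (\<lambda>i j. lift (\<lambda>c\<in>carrier Gp. \<lfloor>rat_of_int q * T i j c\<rfloor>))"
  have YA: "Y \<in> matrices A n m" by (simp add: matrices_def Y_def lift_closed)
  have topY: "top (Y i j) = q \<bullet>\<^bsub>Rp\<^esub> T i j" if "i < n" "j < m" for i j
  proof (rule P.gr_ext)
    fix c assume c: "c \<in> carrier Gp"
    have "push (Y i j) = (\<lambda>c\<in>carrier Gp. \<lfloor>rat_of_int q * T i j c\<rfloor>)"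
      unfolding Y_def by (rule push_lift) (simp add: Q.gr_carrier)
    then have "top (Y i j) c = rat_of_int \<lfloor>rat_of_int q * T i j c\<rfloor>"
      using c by (simp add: top_eq group_ring_coeff_def)
    also have "\<dots> = rat_of_int q * T i j c" using qT[OF that c] by force
    finally show "top (Y i j) c = (q \<bullet>\<^bsub>Rp\<^esub> T i j) c"
      using P.gr_zmult_apply[OF matricesD[OF T that] c] by simp
  qed (use that matricesD[OF YA] matricesD[OF T] ring_hom_closed[OF top_hom] in auto)
  \<comment> \<open>Over Z_(p)[G_p] the matrix \<open>Y\<close> is \<open>q\<close> times the
    inverse of \<open>M\<close>, so \<open>E = Y M - q\<close> vanishes there and its entries lie in
    \<open>D\<close>. As \<open>D\<close> is a right ideal, so do those of
    \<open>E N = Y - q N\<close>.\<close>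
  define E where "E = (\<lambda>i l. mat_prod A m Y M i l \<ominus>\<^bsub>A\<^esub> q \<bullet>\<^bsub>A\<^esub> mat_one A i l)"
  have YM: "mat_prod A m Y M \<in> matrices A n n" by (rule A.mat_prod_closed[OF YA MA])
  have EA: "E i l \<in> carrier A" if "i < n" "l < n" for i l
    using that matricesD[OF YM] by (simp add: E_def mat_one_def)
  have ED: "emb (E i l) \<in> D" if il: "i < n" "l < n" for i l
  proof (rule emb_top_zero[OF EA[OF il]])
    have "top (mat_prod A m Y M i l) = mat_prod Rp m (\<lambda>i j. top (Y i j)) (\<lambda>i j. top (M i j)) i l"
      by (rule ring_hom_mat_prod[OF A.ring_axioms Rp_ring top_hom YA MA il])
    also have "\<dots> = mat_prod Rp m (\<lambda>i j. q \<bullet>\<^bsub>Rp\<^esub> T i j) (\<lambda>i j. top (M i j)) i l"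
      by (rule Rp.mat_prod_cong) (use topY il matricesD[OF T] matricesD[OF tM] in auto)
    also have "\<dots> = q \<bullet>\<^bsub>Rp\<^esub> mat_prod Rp m T (\<lambda>i j. top (M i j)) i l"
      by (rule Rp.mat_prod_zmult_left) (use il matricesD[OF T] matricesD[OF tM] in auto)
    also have "\<dots> = q \<bullet>\<^bsub>Rp\<^esub> mat_one Rp i l"
      using MT il by (simp add: mutually_inverse_iff)
    also have "\<dots> = top (q \<bullet>\<^bsub>A\<^esub> mat_one A i l)"
      using ring_hom_zmult[OF A.ring_axioms Rp_ring top_hom matricesD[OF A.mat_one_closed il], of q]
        ring_hom_mat_one[OF A.ring_axioms Rp_ring top_hom, of i l] by simp
    finally have "top (mat_prod A m Y M i l) = top (q \<bullet>\<^bsub>A\<^esub> mat_one A i l)" .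
    then show "top (E i l) = \<zero>\<^bsub>Rp\<^esub>"
      using matricesD[OF YM il] matricesD[OF A.mat_one_closed il] ring_hom_closed[OF top_hom]
      by (simp add: E_def ring_hom_diff[OF A.ring_axioms Rp_ring top_hom])
  qed
  have eY: "(\<lambda>i j. emb (Y i j)) \<in> matrices L n m" by (rule ring_hom_matrices[OF emb_hom YA])
  have eM: "(\<lambda>i j. emb (M i j)) \<in> matrices L m n" by (rule ring_hom_matrices[OF emb_hom MA])
  have eYM: "emb (mat_prod A m Y M i l) \<in> carrier L" if "l < n" for l
    using matricesD[OF YM ij(1) that] by simp
  have "emb (Y i j) = mat_prod L m (\<lambda>i j. emb (Y i j)) (mat_one L) i j"
    by (rule L.mat_prod_one_right[OF eY ij, symmetric])
  also have "\<dots> = mat_prod L m (\<lambda>i j. emb (Y i j)) (mat_prod L n (\<lambda>i j. emb (M i j)) N) i j"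
    by (rule L.mat_prod_cong)
      (use MN ij matricesD[OF eY] matricesD[OF L.mat_prod_closed[OF eM N]] in \<open>auto simp: mutually_inverse_iff\<close>)
  also have "\<dots> = mat_prod L n (mat_prod L m (\<lambda>i j. emb (Y i j)) (\<lambda>i j. emb (M i j))) N i j"
    by (rule L.mat_prod_assoc[OF eY eM N ij, symmetric])
  also have "\<dots> = mat_prod L n (\<lambda>i l. emb (mat_prod A m Y M i l)) N i j"
    by (rule L.mat_prod_cong)
      (use ij eYM matricesD[OF N] ring_hom_mat_prod[OF A.ring_axioms L.ring_axioms emb_hom YA MA] in auto)
  finally have Yij: "emb (Y i j) = mat_prod L n (\<lambda>i l. emb (mat_prod A m Y M i l)) N i j" .
  have qN: "mat_prod L n (\<lambda>i l. q \<bullet>\<^bsub>L\<^esub> mat_one L i l) N i j = q \<bullet>\<^bsub>L\<^esub> N i j"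
    using L.mat_prod_zmult_left[of n "mat_one L" i N j q] L.mat_prod_one_left[OF N ij]
      matricesD[OF L.mat_one_closed[of n] ij(1)] matricesD[OF N _ ij(2)] by simp
  have "emb (Y i j) \<ominus>\<^bsub>L\<^esub> q \<bullet>\<^bsub>L\<^esub> N i j
      = mat_prod L n (\<lambda>i l. emb (mat_prod A m Y M i l) \<ominus>\<^bsub>L\<^esub> q \<bullet>\<^bsub>L\<^esub> mat_one L i l) N i j"
    unfolding Yij qN[symmetric]
    by (rule L.mat_prod_diff[symmetric])
      (use eYM matricesD[OF L.mat_one_closed[of n] ij(1)] matricesD[OF N _ ij(2)] in auto)
  also have "\<dots> = mat_prod L n (\<lambda>i l. emb (E i l)) N i j"
  proof (rule L.mat_prod_cong)
    fix l assume l: "l < n"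
    show "emb (mat_prod A m Y M i l) \<ominus>\<^bsub>L\<^esub> q \<bullet>\<^bsub>L\<^esub> mat_one L i l = emb (E i l)"
      using matricesD[OF YM ij(1) l] matricesD[OF A.mat_one_closed ij(1) l]
        ring_hom_mat_one[OF A.ring_axioms L.ring_axioms emb_hom, of i l]
      by (simp add: E_def emb_diff emb_zmult)
    show "emb (E i l) \<in> carrier L" using EA[OF ij(1) l] by simp
    show "N l j \<in> carrier L" by (rule matricesD[OF N l ij(2)])
  qed auto
  also have "\<dots> \<in> D"
    unfolding mat_prod_def
    by (rule diff_ideal_finsum) (use ED ij matricesD[OF N] in \<open>auto intro: diff_ideal_mult_right\<close>)
  finally have "\<ominus>\<^bsub>L\<^esub> (emb (Y i j) \<ominus>\<^bsub>L\<^esub> q \<bullet>\<^bsub>L\<^esub> N i j) \<in> D" by (rule diff_ideal_minus)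
  moreover have "\<ominus>\<^bsub>L\<^esub> (emb (Y i j) \<ominus>\<^bsub>L\<^esub> q \<bullet>\<^bsub>L\<^esub> N i j) = q \<bullet>\<^bsub>L\<^esub> N i j \<ominus>\<^bsub>L\<^esub> emb (Y i j)"
    using matricesD[OF eY ij] matricesD[OF N ij] by (simp add: a_minus_def L.minus_add L.a_comm)
  ultimately show ?thesis
    unfolding approximable_def using q matricesD[OF N ij] matricesD[OF YA ij] by auto
qed

lemma approximable_add:
  assumes "approximable x" "approximable y"
  shows "approximable (x \<oplus>\<^bsub>L\<^esub> y)"
proof -
  obtain q a where x: "x \<in> carrier L" "\<not> int p dvd q" "a \<in> carrier A" "q \<bullet>\<^bsub>L\<^esub> x \<ominus>\<^bsub>L\<^esub> emb a \<in> D"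
    using assms(1) by (auto simp: approximable_def)
  obtain r b where y: "y \<in> carrier L" "\<not> int p dvd r" "b \<in> carrier A" "r \<bullet>\<^bsub>L\<^esub> y \<ominus>\<^bsub>L\<^esub> emb b \<in> D"
    using assms(2) by (auto simp: approximable_def)
  have "r \<bullet>\<^bsub>L\<^esub> (q \<bullet>\<^bsub>L\<^esub> x \<ominus>\<^bsub>L\<^esub> emb a) \<oplus>\<^bsub>L\<^esub> q \<bullet>\<^bsub>L\<^esub> (r \<bullet>\<^bsub>L\<^esub> y \<ominus>\<^bsub>L\<^esub> emb b) \<in> D"
    by (intro diff_ideal.add diff_ideal_zmult x y)
  also have "r \<bullet>\<^bsub>L\<^esub> (q \<bullet>\<^bsub>L\<^esub> x \<ominus>\<^bsub>L\<^esub> emb a) \<oplus>\<^bsub>L\<^esub> q \<bullet>\<^bsub>L\<^esub> (r \<bullet>\<^bsub>L\<^esub> y \<ominus>\<^bsub>L\<^esub> emb b)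
      = (q * r) \<bullet>\<^bsub>L\<^esub> (x \<oplus>\<^bsub>L\<^esub> y) \<ominus>\<^bsub>L\<^esub> emb (r \<bullet>\<^bsub>A\<^esub> a \<oplus>\<^bsub>A\<^esub> q \<bullet>\<^bsub>A\<^esub> b)"
    using x(1,3) y(1,3)
    by (simp add: L.zmult_diff_right L.zmult_assoc L.zmult_add_right emb_zmult L.diff_add_diff mult.commute)
  finally show ?thesis
    unfolding approximable_def using x(1,3) y(1,3) not_dvd_mult[OF x(2) y(2)]
    by (intro conjI exI[of _ "q * r"] exI[of _ "r \<bullet>\<^bsub>A\<^esub> a \<oplus>\<^bsub>A\<^esub> q \<bullet>\<^bsub>A\<^esub> b"]) auto
qed

text \<open>\<open>x' y' - a b = (x' - a) y' + a (y' - b)\<close> for \<open>x' = q x\<close> and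
  \<open>y' = r y\<close>: the first term uses that \<open>D\<close> is a right ideal, the second
  its stability under \<open>A\<close> on the left.\<close>

lemma approximable_mult:
  assumes "approximable x" "approximable y"
  shows "approximable (x \<otimes>\<^bsub>L\<^esub> y)"
proof -
  obtain q a where x: "x \<in> carrier L" "\<not> int p dvd q" "a \<in> carrier A" "q \<bullet>\<^bsub>L\<^esub> x \<ominus>\<^bsub>L\<^esub> emb a \<in> D"
    using assms(1) by (auto simp: approximable_def)
  obtain r b where y: "y \<in> carrier L" "\<not> int p dvd r" "b \<in> carrier A" "r \<bullet>\<^bsub>L\<^esub> y \<ominus>\<^bsub>L\<^esub> emb b \<in> D"
    using assms(2) by (auto simp: approximable_def)
  let ?x = "q \<bullet>\<^bsub>L\<^esub> x" and ?y = "r \<bullet>\<^bsub>L\<^esub> y"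
  have xy: "?x \<in> carrier L" "?y \<in> carrier L" using x(1) y(1) by simp_all
  have "(?x \<ominus>\<^bsub>L\<^esub> emb a) \<otimes>\<^bsub>L\<^esub> ?y \<oplus>\<^bsub>L\<^esub> emb a \<otimes>\<^bsub>L\<^esub> (?y \<ominus>\<^bsub>L\<^esub> emb b) \<in> D"
    by (intro diff_ideal.add diff_ideal_mult_right D_mult_left x y xy)
  also have "(?x \<ominus>\<^bsub>L\<^esub> emb a) \<otimes>\<^bsub>L\<^esub> ?y \<oplus>\<^bsub>L\<^esub> emb a \<otimes>\<^bsub>L\<^esub> (?y \<ominus>\<^bsub>L\<^esub> emb b)
      = ?x \<otimes>\<^bsub>L\<^esub> ?y \<ominus>\<^bsub>L\<^esub> emb a \<otimes>\<^bsub>L\<^esub> emb b"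
    using xy x(3) y(3) by (simp only: L.minus_mult_left L.minus_mult_right emb.hom_closed)
      (simp add: a_minus_def L.a_assoc L.r_neg1)
  also have "\<dots> = (q * r) \<bullet>\<^bsub>L\<^esub> (x \<otimes>\<^bsub>L\<^esub> y) \<ominus>\<^bsub>L\<^esub> emb (a \<otimes>\<^bsub>A\<^esub> b)"
    using x(1,3) y(1,3) by (simp add: L.zmult_mult_left L.zmult_mult_right L.zmult_assoc mult.commute)
  finally show ?thesis
    unfolding approximable_def using x(1,3) y(1,3) not_dvd_mult[OF x(2) y(2)]
    by (intro conjI exI[of _ "q * r"] exI[of _ "a \<otimes>\<^bsub>A\<^esub> b"]) auto
qed

lemma approximable_emb: "a \<in> carrier A \<Longrightarrow> approximable (emb a)"
  unfolding approximable_def using p_gt_1 diff_ideal.zero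
  by (auto intro!: exI[of _ 1] exI[of _ a] simp: zdvd1_eq a_minus_def L.r_neg)

text \<open>Induction over the terms that present the localization; negation is treated as
  multiplication by \<open>emb\<close> of minus one.\<close>

lemma approximable_all:
  assumes "x \<in> carrier L"
  shows "approximable x"
proof -
  have "approximable (cohn_class A \<Z> aug t)" if "t \<in> cohn_terms A \<Z> aug" for t
    using that
  proof (induction rule: cohn_terms.induct)
    case (Emb a)
    then show ?case using approximable_emb[of a] by (simp add: cohn_map_def)
  next
    case (InvEntry M m n i j)
    have "(\<lambda>i j. cohn_class A \<Z> aug (InvEntry m n M i j)) \<in> matrices L n m"
      using InvEntry(1) by (auto simp: matrices_def cohn_carrier intro: cohn_terms.InvEntry)
    from approximable_inverse_entry[OF InvEntry(1) this cohn_mutually_inverse[OF A.ring_axioms InvEntry(1)] InvEntry(2,3)]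
    show ?case .
  next
    case (Add s t)
    then show ?case using approximable_add cohn_add_class[OF Add(1,2)] by metis
  next
    case (Mul s t)
    then show ?case using approximable_mult cohn_mult_class[OF Mul(1,2)] by metis
  next
    case (Neg s)
    have cl: "cohn_class A \<Z> aug s \<in> carrier L" "cohn_class A \<Z> aug (Neg s) \<in> carrier L"
      using Neg(1) by (auto simp: cohn_carrier intro: cohn_terms.Neg)
    have "cohn_class A \<Z> aug (Neg s) \<oplus>\<^bsub>L\<^esub> cohn_class A \<Z> aug s = \<zero>\<^bsub>L\<^esub>"
      using Neg(1) cohn_class_eqI[OF cohn_eq.add_neg[OF Neg(1)]]
      by (simp add: cohn_add_class cohn_terms.Neg cohn_zero)
    then have "cohn_class A \<Z> aug (Neg s) = \<ominus>\<^bsub>L\<^esub> cohn_class A \<Z> aug s"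
      using cl L.minus_equality by metis
    also have "\<dots> = emb (\<ominus>\<^bsub>A\<^esub> \<one>\<^bsub>A\<^esub>) \<otimes>\<^bsub>L\<^esub> cohn_class A \<Z> aug s"
      using cl by (simp add: L.l_minus)
    also have "approximable \<dots>" by (intro approximable_mult approximable_emb Neg) simp
    finally show ?case .
  qed
  then show ?thesis using assms by (auto simp: cohn_carrier)
qed

lemma Rp_torsion_free: "q \<noteq> 0 \<Longrightarrow> y \<in> carrier Rp \<Longrightarrow> q \<bullet>\<^bsub>Rp\<^esub> y = \<zero>\<^bsub>Rp\<^esub> \<Longrightarrow> y = \<zero>\<^bsub>Rp\<^esub>"
  by (rule P.gr_torsion_free[of q]) auto

lemma K_fixed:
  assumes x: "x \<in> carrier L" and fixed: "\<And>h. h \<in> prime_elts \<Longrightarrow> gam h \<otimes>\<^bsub>L\<^esub> x = x" and k: "k \<in> K"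
  shows "gam k \<otimes>\<^bsub>L\<^esub> x = x"
  using k unfolding K_generate
proof (induction rule: generate.induct)
  case one
  then show ?case using x by (simp add: gam_one)
next
  case (incl h)
  then show ?case by (rule fixed)
next
  case (inv h)
  then have h: "h \<in> carrier G" by blast
  have "gam (inv h) \<otimes>\<^bsub>L\<^esub> x = gam (inv h) \<otimes>\<^bsub>L\<^esub> (gam h \<otimes>\<^bsub>L\<^esub> x)" using fixed[OF inv] by simp
  also have "\<dots> = x"
    using h x by (simp add: L.m_assoc[symmetric] gam_mult[symmetric] gam_one)
  finally show ?case .
next
  case (eng g h)
  have "g \<in> carrier G" "h \<in> carrier G"
    using eng generate_in_carrier[OF prime_elts_subset] by auto
  then show ?case using eng x by (simp add: gam_mult L.m_assoc)
qed

text \<open>The norm of \<open>K\<close> absorbs every \<open>h\<close> in \<open>K\<close> on the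
  right, hence kills \<open>1 - h\<close>.\<close>

lemma norm_K_D: "x \<in> D \<Longrightarrow> emb (norm_elt K) \<otimes>\<^bsub>L\<^esub> x = \<zero>\<^bsub>L\<^esub>"
proof (rule diff_ideal_annihilated)
  fix h assume "h \<in> prime_elts"
  then have "h \<in> K" by (rule prime_elts_K)
  then show "emb (norm_elt K) \<otimes>\<^bsub>L\<^esub> gam h = emb (norm_elt K)"
    using arg_cong[OF norm_elt_mult(2)[OF K.subgroup_axioms], of h emb]
    by (simp add: gam_def norm_elt_closed ZG.group_elt_closed)
qed (simp_all add: norm_elt_closed)

section \<open>Kernel and image of the canonical map at p\<close>

context
  fixes b
  assumes b: "cohn_factor A \<Z> aug Rp top b"
begin

lemma canonical_hom: "b \<in> ring_hom L Rp" and canonical_emb: "a \<in> carrier A \<Longrightarrow> b (emb a) = top a"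
  using b by (auto simp: cohn_factor_def)

interpretation b: ring_hom_ring L Rp b
  by (rule ring_hom_ringI2[OF L.ring_axioms Rp_ring canonical_hom])

lemma canonical_gam: "h \<in> prime_elts \<Longrightarrow> b (gam h) = \<one>\<^bsub>Rp\<^esub>"
  using proj_K[OF prime_elts_K] by (simp add: gam_def canonical_emb ZG.group_elt_closed top_delta P.gr_one)

lemma canonical_D: "x \<in> D \<Longrightarrow> b x = \<zero>\<^bsub>Rp\<^esub>"
  by (rule diff_ideal_hom_zero[OF Rp_ring canonical_hom canonical_gam])

lemma canonical_zmult: "x \<in> carrier L \<Longrightarrow> b (q \<bullet>\<^bsub>L\<^esub> x) = q \<bullet>\<^bsub>Rp\<^esub> b x"
  by (rule ring_hom_zmult[OF L.ring_axioms Rp_ring canonical_hom])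

text \<open>If \<open>q x\<close> is congruent to \<open>emb a\<close> modulo \<open>D\<close>, then
  \<open>top a = q b(x) = 0\<close>; this puts \<open>emb a\<close>, and with it \<open>q x\<close>,
  into \<open>D\<close>.\<close>

lemma canonical_kernel:
  assumes x: "x \<in> carrier L" "b x = \<zero>\<^bsub>Rp\<^esub>"
  obtains q where "\<not> int p dvd q" "q \<bullet>\<^bsub>L\<^esub> x \<in> D"
proof -
  obtain q a where q: "\<not> int p dvd q" "a \<in> carrier A" "q \<bullet>\<^bsub>L\<^esub> x \<ominus>\<^bsub>L\<^esub> emb a \<in> D"
    using approximable_all[OF x(1)] by (auto simp: approximable_def)
  have "b (q \<bullet>\<^bsub>L\<^esub> x) \<ominus>\<^bsub>Rp\<^esub> b (emb a) = \<zero>\<^bsub>Rp\<^esub>"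
    using canonical_D[OF q(3)] x(1) q(2)
      ring_hom_diff[OF L.ring_axioms Rp_ring canonical_hom, of "q \<bullet>\<^bsub>L\<^esub> x" "emb a"] by simp
  then have "top a = \<zero>\<^bsub>Rp\<^esub>"
    using x q(2) ring_hom_closed[OF top_hom] by (simp add: canonical_zmult canonical_emb)
  then have "emb a \<in> D" by (rule emb_top_zero[OF q(2)])
  then have "(q \<bullet>\<^bsub>L\<^esub> x \<ominus>\<^bsub>L\<^esub> emb a) \<oplus>\<^bsub>L\<^esub> emb a \<in> D" using q(3) by (intro diff_ideal.add)
  then show thesis using that q x(1) by (simp add: L.diff_add_cancel)
qed

text \<open>Commutativity of the square. Both composites vanish on \<open>D\<close> and agree on
  \<open>A\<close>, hence they agree on \<open>q x\<close>, and \<open>q\<close> cancels in the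
  rationals.\<close>

lemma augmentation_canonical:
  assumes x: "x \<in> carrier L" and a: "cohn_factor A \<Z> aug \<Z> aug a"
  shows "augmentation (Z_localized p) Gp (b x) = rat_of_int (a x)"
proof -
  let ?e = "augmentation (Z_localized p) Gp"
  have ah: "a \<in> ring_hom L \<Z>" and ae: "\<And>u. u \<in> carrier A \<Longrightarrow> a (emb u) = aug u"
    using a by (auto simp: cohn_factor_def)
  have eh: "?e \<in> ring_hom Rp (Z_localized p)" by (rule P.augmentation_hom)
  obtain q u where q: "\<not> int p dvd q" "u \<in> carrier A" "q \<bullet>\<^bsub>L\<^esub> x \<ominus>\<^bsub>L\<^esub> emb u \<in> D"
    using approximable_all[OF x(1)] by (auto simp: approximable_def)
  have "a (gam h) = \<one>\<^bsub>\<Z>\<^esub>" if "h \<in> prime_elts" for h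
    using that by (simp add: gam_def ae ZG.group_elt_closed ZG.augmentation_group_elt)
  from diff_ideal_hom_zero[OF int.ring_axioms ah this q(3)]
  have "a (q \<bullet>\<^bsub>L\<^esub> x) = aug u"
    using ring_hom_diff[OF L.ring_axioms int.ring_axioms ah, of "q \<bullet>\<^bsub>L\<^esub> x" "emb u"] x q(2) ae
    by (simp add: int_a_minus_eq)
  moreover have "a (q \<bullet>\<^bsub>L\<^esub> x) = q * a x"
  proof -
    have "a (q \<bullet>\<^bsub>L\<^esub> x) = a (emb (q \<bullet>\<^bsub>A\<^esub> \<one>\<^bsub>A\<^esub>) \<otimes>\<^bsub>L\<^esub> x)"
      using x by (simp add: emb_zmult L.zmult_mult_left)
    also have "\<dots> = q * a x"
      using ring_hom_mult[OF ah, of "emb (q \<bullet>\<^bsub>A\<^esub> \<one>\<^bsub>A\<^esub>)" x] x by (simp add: ae aug_zmult aug_simps)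
    finally show ?thesis .
  qed
  ultimately have au: "aug u = q * a x" by simp
  have bx: "b x \<in> carrier Rp" using x by simp
  have "b (q \<bullet>\<^bsub>L\<^esub> x) \<ominus>\<^bsub>Rp\<^esub> b (emb u) = \<zero>\<^bsub>Rp\<^esub>"
    using canonical_D[OF q(3)] x(1) q(2)
      ring_hom_diff[OF L.ring_axioms Rp_ring canonical_hom, of "q \<bullet>\<^bsub>L\<^esub> x" "emb u"] by simp
  then have "q \<bullet>\<^bsub>Rp\<^esub> b x = top u"
    using x q(2) ring_hom_closed[OF top_hom] by (simp add: canonical_zmult canonical_emb)
  then have "?e (q \<bullet>\<^bsub>Rp\<^esub> b x) = rat_of_int q * rat_of_int (a x)"
    using augmentation_top[OF q(2)] au by simp
  moreover have "?e (q \<bullet>\<^bsub>Rp\<^esub> b x) = rat_of_int q * ?e (b x)"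
    using bx by (simp add: P.augmentation_sum P.gr_zmult_apply sum_distrib_left)
  ultimately show ?thesis using q(1) by auto
qed

text \<open>A \<open>p\<close>-torsion element lies in \<open>D\<close>, which is \<open>p\<close>-divisible and annihilated by the norm of \<open>K\<close>;
  but \<open>K\<close> acts trivially on \<open>p\<close>-power torsion, so the norm is multiplication by the order of \<open>K\<close>.\<close>

lemma p_torsion_free:
  assumes x: "x \<in> carrier L" and px: "int p \<bullet>\<^bsub>L\<^esub> x = \<zero>\<^bsub>L\<^esub>"
  shows "x = \<zero>\<^bsub>L\<^esub>"
proof -
  have "int p \<bullet>\<^bsub>Rp\<^esub> b x = \<zero>\<^bsub>Rp\<^esub>" using canonical_zmult[OF x, of "int p"] px by simp
  then have "b x = \<zero>\<^bsub>Rp\<^esub>" using x p_gt_1 Rp_torsion_free[of "int p" "b x"] by simp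
  then obtain q where q: "\<not> int p dvd q" "q \<bullet>\<^bsub>L\<^esub> x \<in> D" using canonical_kernel[OF x] by blast
  have "coprime q (int p)" using prime_imp_coprime[OF prime_int_p q(1)] by (simp add: coprime_commute)
  \<comment> \<open>In \<open>x = u (q x) + v (p x)\<close> the second term vanishes and the first
    lies in \<open>D\<close>.\<close>
  then obtain u v where uv: "u * q + v * int p = 1" by (metis bezout_int coprime_imp_gcd_eq_1)
  have "x = (u * q + v * int p) \<bullet>\<^bsub>L\<^esub> x" using x uv by simp
  also have "\<dots> = u \<bullet>\<^bsub>L\<^esub> (q \<bullet>\<^bsub>L\<^esub> x) \<oplus>\<^bsub>L\<^esub> v \<bullet>\<^bsub>L\<^esub> (int p \<bullet>\<^bsub>L\<^esub> x)"
    using x by (simp add: L.zmult_add_left L.zmult_assoc)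
  also have "\<dots> = u \<bullet>\<^bsub>L\<^esub> (q \<bullet>\<^bsub>L\<^esub> x)" using px x by simp
  finally have e: "x = u \<bullet>\<^bsub>L\<^esub> (q \<bullet>\<^bsub>L\<^esub> x)" .
  have "u \<bullet>\<^bsub>L\<^esub> (q \<bullet>\<^bsub>L\<^esub> x) \<in> D" by (rule diff_ideal_zmult[OF q(2)])
  then have xD: "x \<in> D" by (simp only: e[symmetric])
  \<comment> \<open>Dividing \<open>x\<close> by exactly the power of \<open>p\<close> in
    \<open>card K\<close> makes \<open>card K\<close> times \<open>y\<close> equal to
    \<open>m x\<close> with \<open>m\<close> prime to \<open>p\<close>; and \<open>y\<close> is
    still \<open>p\<close>-power torsion, so \<open>K\<close> fixes it.\<close>
  define j where "j = multiplicity p (card K)"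
  have "finite K" using K.subset finite_G finite_subset by blast
  then have K0: "card K \<noteq> 0" using K.one_closed by (metis card_eq_0_iff empty_iff)
  then obtain m where m: "card K = p ^ j * m" "\<not> p dvd m"
    using multiplicity_decompose'[of "card K" p] K0 p_gt_1 unfolding j_def by auto
  have cop: "coprime (int (ord h)) (int p ^ i)" if "h \<in> prime_elts" for h i
    using that by (simp add: coprime_int_iff)
  obtain y where y: "y \<in> D" "x = (int p ^ j) \<bullet>\<^bsub>L\<^esub> y"
    using diff_ideal_divisible[OF prime_elts_subset cop xD] by blast
  have yL: "y \<in> carrier L" by (rule diff_ideal_closed[OF y(1)])
  have t0: "(int p ^ Suc j) \<bullet>\<^bsub>L\<^esub> y = \<zero>\<^bsub>L\<^esub>" using px yL by (simp add: y(2) L.zmult_assoc)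
  have fixed: "gam h \<otimes>\<^bsub>L\<^esub> y = y" if "h \<in> prime_elts" for h
    by (rule torsion_fixed[OF _ cop[OF that] yL t0]) (use that in simp)
  have "int (card K) \<bullet>\<^bsub>L\<^esub> y = emb (norm_elt K) \<otimes>\<^bsub>L\<^esub> y"
    by (rule norm_elt_fixed[OF K.subset yL K_fixed[OF yL fixed], symmetric])
  also have "\<dots> = \<zero>\<^bsub>L\<^esub>" by (rule norm_K_D[OF y(1)])
  finally have "int m \<bullet>\<^bsub>L\<^esub> x = \<zero>\<^bsub>L\<^esub>" using yL by (simp add: y(2) L.zmult_assoc m(1) mult.commute)
  moreover have "coprime (int m) (int p)"
    using prime_imp_coprime[OF prime_p m(2)] by (simp add: coprime_commute)
  ultimately show ?thesis using L.zmult_coprime_cancel[OF _ x _ px] by blast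
qed

text \<open>The preimage is required to lie in the ideal of the elements of \<open>p\<close>-power
  order because the map to the integers and the canonical maps at all other primes kill that ideal.
  The components can then be treated one prime at a time.\<close>

lemma canonical_surj:
  assumes y: "y \<in> carrier Rp" and aug_y: "augmentation (Z_localized p) Gp y = 0"
  obtains x where "x \<in> diff_ideal {g \<in> carrier G. \<exists>i. ord g = p ^ i}" "b x = y"
proof -
  let ?H = "{g \<in> carrier G. \<exists>i. ord g = p ^ i}"
  \<comment> \<open>\<open>Y\<close> minus its augmentation is a combination of differences
    \<open>c - 1\<close>, and each coset \<open>c\<close> contains an element of
    \<open>p\<close>-power order.\<close>
  have ex: "\<exists>a. a \<in> carrier A \<and> emb a \<in> diff_ideal ?H \<and> push a = Y \<ominus>\<^bsub>ZGp\<^esub> augmentation \<Z> Gp Y \<bullet>\<^bsub>ZGp\<^esub> \<one>\<^bsub>ZGp\<^esub>"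
    if "Y \<in> carrier ZGp" for Y
    using Gp_group Gp_finite that
  proof (induction Y rule: int_group_ring_induct)
    case zero
    have "augmentation \<Z> Gp \<zero>\<^bsub>ZGp\<^esub> = 0" by (simp add: Q.augmentation_sum Q.gr_zero_apply)
    then show ?case
      using diff_ideal.zero ring_hom_zero[OF push_ring_hom A.ring_axioms Qr.ring_axioms]
      by (intro exI[of _ "\<zero>\<^bsub>A\<^esub>"]) (simp add: a_minus_def)
  next
    case (elt c)
    obtain g where "g \<in> carrier G" "c = K #> g" using elt by (auto simp: Gp_carrier)
    then obtain x where x: "x \<in> carrier G" "K #> x = c" "x \<in> ?H" using coset_p_element by blast
    let ?a = "delta x \<ominus>\<^bsub>A\<^esub> \<one>\<^bsub>A\<^esub>"
    have "emb ?a = \<ominus>\<^bsub>L\<^esub> (\<one>\<^bsub>L\<^esub> \<ominus>\<^bsub>L\<^esub> gam x)"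
      by (simp add: emb_diff ZG.group_elt_closed flip: gam_def) (simp add: a_minus_def L.minus_add L.a_comm)
    then have "emb ?a \<in> diff_ideal ?H" using diff_ideal_minus[OF diff_ideal_elt[OF x(3)]] by simp
    moreover have "push ?a = group_elt Gp c \<ominus>\<^bsub>ZGp\<^esub> \<one>\<^bsub>ZGp\<^esub>"
      using x(1,2) ring_hom_one[OF push_ring_hom]
      by (simp add: ring_hom_diff[OF A.ring_axioms Qr.ring_axioms push_ring_hom] ZG.group_elt_closed
          group_ring_map.push_group_elt[OF group_ring_map_push])
    ultimately show ?case
      using elt by (intro exI[of _ ?a]) (simp add: ZG.group_elt_closed Q.augmentation_group_elt)
  next
    case (add u v)
    then obtain c d where "c \<in> carrier A" "emb c \<in> diff_ideal ?H" "push c = u \<ominus>\<^bsub>ZGp\<^esub> augmentation \<Z> Gp u \<bullet>\<^bsub>ZGp\<^esub> \<one>\<^bsub>ZGp\<^esub>"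
      "d \<in> carrier A" "emb d \<in> diff_ideal ?H" "push d = v \<ominus>\<^bsub>ZGp\<^esub> augmentation \<Z> Gp v \<bullet>\<^bsub>ZGp\<^esub> \<one>\<^bsub>ZGp\<^esub>" by blast
    moreover have "augmentation \<Z> Gp (u \<oplus>\<^bsub>ZGp\<^esub> v) = augmentation \<Z> Gp u + augmentation \<Z> Gp v"
      using ring_hom_add[OF Q.augmentation_hom add(1,2)] by simp
    ultimately show ?case
      using add(1,2)
      by (intro exI[of _ "c \<oplus>\<^bsub>A\<^esub> d"])
        (simp add: diff_ideal.add ring_hom_add[OF push_ring_hom] Qr.zmult_add_left Qr.diff_add_diff)
  next
    case (minus u)
    then obtain c where c: "c \<in> carrier A" "emb c \<in> diff_ideal ?H" "push c = u \<ominus>\<^bsub>ZGp\<^esub> augmentation \<Z> Gp u \<bullet>\<^bsub>ZGp\<^esub> \<one>\<^bsub>ZGp\<^esub>"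
      by blast
    interpret h: ring_hom_ring A ZGp push
      by (rule ring_hom_ringI2[OF A.ring_axioms Qr.ring_axioms push_ring_hom])
    have "augmentation \<Z> Gp (\<ominus>\<^bsub>ZGp\<^esub> u) = - augmentation \<Z> Gp u"
      using minus(1) by (simp add: Q.augmentation_sum Q.gr_minus_apply sum_negf)
    moreover have "(- k) \<bullet>\<^bsub>ZGp\<^esub> \<one>\<^bsub>ZGp\<^esub> = \<ominus>\<^bsub>ZGp\<^esub> (k \<bullet>\<^bsub>ZGp\<^esub> \<one>\<^bsub>ZGp\<^esub>)" for k
      by (rule Q.gr_ext) (auto simp: Q.gr_zmult_apply Q.gr_minus_apply)
    ultimately show ?case
      using c minus(1)
      by (intro exI[of _ "\<ominus>\<^bsub>A\<^esub> c"]) (simp add: diff_ideal_minus Qr.minus_diff_minus)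
  qed
  have "\<exists>q. \<not> int p dvd q \<and> (\<forall>c\<in>carrier Gp. \<exists>a. rat_of_int q * y c = rat_of_int a)"
    by (rule Zp_common_denominator) (use Gp_finite P.gr_closed[OF y] in auto)
  then obtain q where q: "\<not> int p dvd q" and qy: "\<And>c. c \<in> carrier Gp \<Longrightarrow> \<exists>a. rat_of_int q * y c = rat_of_int a"
    by blast
  define Y where "Y = (\<lambda>c\<in>carrier Gp. \<lfloor>rat_of_int q * y c\<rfloor>)"
  have YZ: "Y \<in> carrier ZGp" by (simp add: Y_def Q.gr_carrier)
  have Yc: "rat_of_int (Y c) = rat_of_int q * y c" if "c \<in> carrier Gp" for c
    using qy[OF that] that by (force simp: Y_def)
  have "rat_of_int (augmentation \<Z> Gp Y) = rat_of_int q * augmentation (Z_localized p) Gp y"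
    by (simp add: Q.augmentation_sum[OF YZ] P.augmentation_sum[OF y] Yc sum_distrib_left)
  then have augY: "augmentation \<Z> Gp Y = 0" using aug_y by simp
  obtain a where a: "a \<in> carrier A" "emb a \<in> diff_ideal ?H" "push a = Y"
    using ex[OF YZ] YZ by (auto simp: augY a_minus_def)
  have top_a: "top a = q \<bullet>\<^bsub>Rp\<^esub> y"
  proof (rule P.gr_ext)
    show "top a c = (q \<bullet>\<^bsub>Rp\<^esub> y) c" if "c \<in> carrier Gp" for c
      using that by (simp add: P.gr_zmult_apply[OF y that] top_eq a(3) group_ring_coeff_def Yc)
  qed (use y ring_hom_closed[OF top_hom a(1)] in auto)
  \<comment> \<open>The denominator \<open>q\<close> is prime to \<open>p\<close>, hence to all
    orders in \<open>?H\<close>; so \<open>emb a\<close> can be divided by it inside the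
    ideal.\<close>
  have cop: "coprime (int (ord h)) q" if "h \<in> ?H" for h
    using that prime_imp_coprime[OF prime_int_p q] by auto
  obtain x where x: "x \<in> diff_ideal ?H" "emb a = q \<bullet>\<^bsub>L\<^esub> x"
    using diff_ideal_divisible[OF _ cop a(2)] by auto
  have xL: "x \<in> carrier L" by (rule diff_ideal_closed[OF x(1)])
  have "q \<bullet>\<^bsub>Rp\<^esub> b x = q \<bullet>\<^bsub>Rp\<^esub> y"
    using canonical_zmult[OF xL, of q] canonical_emb[OF a(1)] top_a x(2) by simp
  then have "q \<bullet>\<^bsub>Rp\<^esub> (b x \<ominus>\<^bsub>Rp\<^esub> y) = \<zero>\<^bsub>Rp\<^esub>" using xL y by (simp add: Rp.zmult_diff_right)
  then have "b x \<ominus>\<^bsub>Rp\<^esub> y = \<zero>\<^bsub>Rp\<^esub>" using q xL y Rp_torsion_free[of q "b x \<ominus>\<^bsub>Rp\<^esub> y"] by auto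
  then show thesis using that[OF x(1)] xL y by simp
qed

end

end

lemma (in ring) finsum_zmult:
  assumes "finite I" "\<And>i. i \<in> I \<Longrightarrow> f i \<in> carrier R"
  shows "(\<Oplus>i\<in>I. k \<bullet> f i) = k \<bullet> (\<Oplus>i\<in>I. f i)"
  using assms by (induction I) (auto simp: zmult_add_right)

lemma (in ring) zmult_abs:
  assumes "x \<in> carrier R"
  shows "int (nat \<bar>q\<bar>) \<bullet> x = sgn q \<bullet> (q \<bullet> x)"
proof -
  have e: "int (nat \<bar>q\<bar>) = sgn q * q" by (cases "q < 0") (auto simp: sgn_if)
  show ?thesis unfolding e by (rule zmult_assoc[OF assms, symmetric])
qed

lemma (in ring) diff_add_diff_cancel:
  "a \<in> carrier R \<Longrightarrow> b \<in> carrier R \<Longrightarrow> c \<in> carrier R \<Longrightarrow> (a \<ominus> b) \<oplus> (b \<ominus> c) = a \<ominus> c"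
  by (simp add: a_minus_def a_assoc r_neg1)

section \<open>Torsion-freeness of the localization\<close>

context finite_group_localization
begin

lemma localization_at_primeI: "Factorial_Ring.prime p \<Longrightarrow> localization_at_prime G p"
  by (intro localization_at_prime.intro prime_nat.intro finite_group_localization_axioms)

text \<open>Peels off one prime factor at a time: for \<open>n = p * m\<close> the element
  \<open>m x\<close> is \<open>p\<close>-torsion, hence zero.\<close>

lemma localization_torsion_free_nat:
  assumes "0 < n" "x \<in> carrier L" "int n \<bullet>\<^bsub>L\<^esub> x = \<zero>\<^bsub>L\<^esub>"
  shows "x = \<zero>\<^bsub>L\<^esub>"
  using assms
proof (induction n arbitrary: x rule: less_induct)
  case (less n)
  show ?case
  proof (cases "n = 1")
    case True
    then show ?thesis using less.prems by simp
  next
    case False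
    then obtain p where p: "Factorial_Ring.prime p" "p dvd n" using prime_factor_nat by blast
    then obtain m where m: "n = p * m" by blast
    interpret localization_at_prime G p by (rule localization_at_primeI[OF p(1)])
    obtain b where b: "cohn_factor A \<Z> aug Rp top b" using canonical_ex1 by blast
    have "int p \<bullet>\<^bsub>L\<^esub> (int m \<bullet>\<^bsub>L\<^esub> x) = \<zero>\<^bsub>L\<^esub>" using less.prems m by (simp add: L.zmult_assoc)
    from p_torsion_free[OF b _ this] have "int m \<bullet>\<^bsub>L\<^esub> x = \<zero>\<^bsub>L\<^esub>"
      using less.prems(2) by simp
    moreover have "m < n" "0 < m" using m p_gt_1 less.prems(1) by auto
    ultimately show ?thesis using less.IH less.prems(2) by blast
  qed
qed

lemma localization_torsion_free:
  assumes "q \<noteq> 0" "x \<in> carrier L" "q \<bullet>\<^bsub>L\<^esub> x = \<zero>\<^bsub>L\<^esub>"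
  shows "x = \<zero>\<^bsub>L\<^esub>"
proof (rule localization_torsion_free_nat)
  show "0 < nat \<bar>q\<bar>" using assms(1) by simp
  show "int (nat \<bar>q\<bar>) \<bullet>\<^bsub>L\<^esub> x = \<zero>\<^bsub>L\<^esub>"
    unfolding L.zmult_abs[OF assms(2)] assms(3) by (rule L.zmult_zero_right)
qed (rule assms(2))

text \<open>Some \<open>q x\<close> with \<open>q\<close> prime to \<open>p\<close> lies in
  \<open>D\<close>, which the norm kills; torsion-freeness removes \<open>q\<close>.\<close>

lemma canonical_kernel_norm:
  assumes p: "Factorial_Ring.prime p"
    and b: "cohn_factor A \<Z> aug (group_ring (Z_localized p) (p_quotient G p)) (to_p_group_ring G p) b"
    and x: "x \<in> carrier L" "b x = \<zero>\<^bsub>group_ring (Z_localized p) (p_quotient G p)\<^esub>"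
  shows "emb (norm_elt (prime_to_p_subgroup G p)) \<otimes>\<^bsub>L\<^esub> x = \<zero>\<^bsub>L\<^esub>"
proof -
  interpret localization_at_prime G p by (rule localization_at_primeI[OF p])
  obtain q where q: "\<not> int p dvd q" "q \<bullet>\<^bsub>L\<^esub> x \<in> D" using canonical_kernel[OF b x] by blast
  have "q \<bullet>\<^bsub>L\<^esub> (emb (norm_elt K) \<otimes>\<^bsub>L\<^esub> x) = \<zero>\<^bsub>L\<^esub>"
    using norm_K_D[OF q(2)] x(1) by (simp add: L.zmult_mult_right norm_elt_closed)
  moreover have "q \<noteq> 0" using q(1) by auto
  moreover have "emb (norm_elt K) \<otimes>\<^bsub>L\<^esub> x \<in> carrier L" using x(1) by (simp add: norm_elt_closed)
  ultimately show ?thesis by (intro localization_torsion_free[of q "emb (norm_elt K) \<otimes>\<^bsub>L\<^esub> x"])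
qed

subsection \<open>Finitely generated submodules of the localization\<close>

text \<open>With \<open>I = carrier A\<close> this is the submodule generated by \<open>T\<close>,
  with \<open>I = aug_ideal\<close> the product of the augmentation ideal with that
  submodule.\<close>

inductive_set mspan :: "('g \<Rightarrow> int) set \<Rightarrow> ('g \<Rightarrow> int) cohn_term set set \<Rightarrow> ('g \<Rightarrow> int) cohn_term set set"
  for I T where
  zero: "\<zero>\<^bsub>L\<^esub> \<in> mspan I T"
| gen: "a \<in> I \<Longrightarrow> t \<in> T \<Longrightarrow> emb a \<otimes>\<^bsub>L\<^esub> t \<in> mspan I T"
| add: "x \<in> mspan I T \<Longrightarrow> y \<in> mspan I T \<Longrightarrow> x \<oplus>\<^bsub>L\<^esub> y \<in> mspan I T"

abbreviation aug_ideal :: "('g \<Rightarrow> int) set" where "aug_ideal \<equiv> {a \<in> carrier A. aug a = 0}"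

lemma mspan_closed: "x \<in> mspan I T \<Longrightarrow> I \<subseteq> carrier A \<Longrightarrow> T \<subseteq> carrier L \<Longrightarrow> x \<in> carrier L"
  by (induction rule: mspan.induct) (auto simp: subset_iff)

text \<open>Two coefficient sets \<open>I\<close> and \<open>I'\<close> are allowed because an
  element \<open>b\<close> of augmentation zero carries the submodule generated by \<open>T\<close>
  into its product with the augmentation ideal.\<close>

lemma mspan_mult_left:
  assumes T: "T \<subseteq> carrier L" and I: "I \<subseteq> carrier A" and b: "b \<in> carrier A"
    and bI: "\<And>a. a \<in> I \<Longrightarrow> b \<otimes>\<^bsub>A\<^esub> a \<in> I'" and x: "x \<in> mspan I T"
  shows "emb b \<otimes>\<^bsub>L\<^esub> x \<in> mspan I' T"
  using x
proof (induction rule: mspan.induct)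
  case zero
  then show ?case using b mspan.zero by simp
next
  case (gen a t)
  then have "emb b \<otimes>\<^bsub>L\<^esub> (emb a \<otimes>\<^bsub>L\<^esub> t) = emb (b \<otimes>\<^bsub>A\<^esub> a) \<otimes>\<^bsub>L\<^esub> t"
    using T I b by (simp add: L.m_assoc subset_iff)
  then show ?case using mspan.gen[OF bI[OF gen(1)] gen(2)] by simp
next
  case (add x y)
  then show ?case using b mspan_closed[OF _ I T] mspan.add by (simp add: L.r_distr)
qed

lemma mspan_zmult:
  assumes T: "T \<subseteq> carrier L" and I: "I = carrier A \<or> I = aug_ideal" and x: "x \<in> mspan I T"
  shows "k \<bullet>\<^bsub>L\<^esub> x \<in> mspan I T"
proof -
  have IA: "I \<subseteq> carrier A" using I by auto
  have "emb (k \<bullet>\<^bsub>A\<^esub> \<one>\<^bsub>A\<^esub>) \<otimes>\<^bsub>L\<^esub> x \<in> mspan I T"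
    by (rule mspan_mult_left[OF T IA _ _ x]) (use I in \<open>auto simp: aug_simps\<close>)
  then show ?thesis using mspan_closed[OF x IA T] by (simp add: emb_zmult L.zmult_mult_left)
qed

lemma mspan_finsum:
  assumes "finite J" "\<And>j. j \<in> J \<Longrightarrow> f j \<in> mspan I T" "T \<subseteq> carrier L" "I \<subseteq> carrier A"
  shows "(\<Oplus>\<^bsub>L\<^esub>j\<in>J. f j) \<in> mspan I T"
  using assms
proof (induction J)
  case (insert j J)
  then show ?case
    using mspan_closed[OF _ insert.prems(3,2)] by (subst L.finsum_insert) (auto intro: mspan.add)
qed (simp add: mspan.zero)

text \<open>Collects terms into one coefficient per generator, which gives the rows of the square
  matrix in \<open>perfect_family_zero\<close>.\<close>

lemma mspan_coeffs:
  fixes t :: "nat \<Rightarrow> ('g \<Rightarrow> int) cohn_term set"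
  assumes t: "t ` {..<m} \<subseteq> carrier L" and x: "x \<in> mspan aug_ideal (t ` {..<m})"
  shows "\<exists>a. (\<forall>j<m. a j \<in> aug_ideal) \<and> x = (\<Oplus>\<^bsub>L\<^esub>j\<in>{..<m}. emb (a j) \<otimes>\<^bsub>L\<^esub> t j)"
  using x
proof (induction rule: mspan.induct)
  case zero
  have "(\<Oplus>\<^bsub>L\<^esub>j\<in>{..<m}. emb \<zero>\<^bsub>A\<^esub> \<otimes>\<^bsub>L\<^esub> t j) = (\<Oplus>\<^bsub>L\<^esub>j\<in>{..<m}. \<zero>\<^bsub>L\<^esub>)"
    by (rule L.finsum_cong') (use t in auto)
  then show ?case by (intro exI[of _ "\<lambda>_. \<zero>\<^bsub>A\<^esub>"]) (simp add: aug_simps)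
next
  case (gen a s)
  then obtain i where i: "i < m" "s = t i" by auto
  have tc: "t j \<in> carrier L" if "j < m" for j using t that by auto
  let ?a = "\<lambda>j. if j = i then a else \<zero>\<^bsub>A\<^esub>"
  have "(\<Oplus>\<^bsub>L\<^esub>j\<in>{..<m}. emb (?a j) \<otimes>\<^bsub>L\<^esub> t j) = (\<Oplus>\<^bsub>L\<^esub>j\<in>{..<m}. if i = j then emb a \<otimes>\<^bsub>L\<^esub> t j else \<zero>\<^bsub>L\<^esub>)"
    by (rule L.finsum_cong') (use tc gen in auto)
  also have "\<dots> = emb a \<otimes>\<^bsub>L\<^esub> t i"
    using L.add.finprod_singleton[of i "{..<m}" "\<lambda>j. emb a \<otimes>\<^bsub>L\<^esub> t j"] tc i gen
    by (simp add: finsum_def Pi_def)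
  finally show ?case
    using gen i by (intro exI[of _ ?a]) (auto simp: aug_simps)
next
  case (add x y)
  then obtain a b where ab: "\<forall>j<m. a j \<in> aug_ideal" "x = (\<Oplus>\<^bsub>L\<^esub>j\<in>{..<m}. emb (a j) \<otimes>\<^bsub>L\<^esub> t j)"
    "\<forall>j<m. b j \<in> aug_ideal" "y = (\<Oplus>\<^bsub>L\<^esub>j\<in>{..<m}. emb (b j) \<otimes>\<^bsub>L\<^esub> t j)" by blast
  have tc: "t j \<in> carrier L" if "j < m" for j using t that by auto
  have "(\<Oplus>\<^bsub>L\<^esub>j\<in>{..<m}. emb (a j \<oplus>\<^bsub>A\<^esub> b j) \<otimes>\<^bsub>L\<^esub> t j)
      = (\<Oplus>\<^bsub>L\<^esub>j\<in>{..<m}. emb (a j) \<otimes>\<^bsub>L\<^esub> t j \<oplus>\<^bsub>L\<^esub> emb (b j) \<otimes>\<^bsub>L\<^esub> t j)"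
    by (rule L.finsum_cong') (use tc ab in \<open>auto simp: L.l_distr\<close>)
  also have "\<dots> = x \<oplus>\<^bsub>L\<^esub> y"
    unfolding ab(2,4) by (rule L.finsum_addf) (use tc ab in auto)
  finally show ?case
    using ab by (intro exI[of _ "\<lambda>j. a j \<oplus>\<^bsub>A\<^esub> b j"]) (auto simp: aug_simps)
qed

lemma perfect_mspan_zero:
  assumes "finite T" "T \<subseteq> carrier L" "T \<subseteq> mspan aug_ideal T"
  shows "T \<subseteq> {\<zero>\<^bsub>L\<^esub>}"
proof -
  obtain t and m :: nat where t: "T = t ` {..<m}"
    using assms(1) by (metis finite_imp_nat_seg_image_inj_on lessThan_def)
  have "\<forall>i. \<exists>a. i < m \<longrightarrow> (\<forall>j<m. a j \<in> aug_ideal) \<and> t i = (\<Oplus>\<^bsub>L\<^esub>j\<in>{..<m}. emb (a j) \<otimes>\<^bsub>L\<^esub> t j)"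
    using mspan_coeffs[of t m] assms(2,3) unfolding t by blast
  from choice[OF this] obtain X where X: "\<And>i. i < m \<Longrightarrow>
      (\<forall>j<m. X i j \<in> aug_ideal) \<and> t i = (\<Oplus>\<^bsub>L\<^esub>j\<in>{..<m}. emb (X i j) \<otimes>\<^bsub>L\<^esub> t j)" by blast
  have "t i = \<zero>\<^bsub>L\<^esub>" if "i < m" for i
    by (rule perfect_family_zero[of m t X]) (use X that assms(2) t in auto)
  then show ?thesis unfolding t by auto
qed

text \<open>The integers \<open>n\<close> with \<open>n x\<close> in the span form an ideal
  contained in no maximal ideal. This is carried out as a descent: for \<open>n = l * m\<close>,
  Bezout for \<open>l\<close> and the given \<open>q\<close> replaces \<open>n\<close> by
  \<open>m\<close>, until \<open>1\<close> is reached.\<close>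

lemma mspan_local:
  assumes T: "T \<subseteq> carrier L" and x: "x \<in> carrier L"
    and loc: "\<And>l. Factorial_Ring.prime l \<Longrightarrow> \<exists>q. \<not> int l dvd q \<and> q \<bullet>\<^bsub>L\<^esub> x \<in> mspan aug_ideal T"
  shows "x \<in> mspan aug_ideal T"
proof -
  have "x \<in> mspan aug_ideal T" if "0 < n" "int n \<bullet>\<^bsub>L\<^esub> x \<in> mspan aug_ideal T" for n :: nat
    using that
  proof (induction n rule: less_induct)
    case (less n)
    show ?case
    proof (cases "n = 1")
      case True
      then show ?thesis using less.prems x by simp
    next
      case False
      then obtain l where l: "Factorial_Ring.prime l" "l dvd n" using prime_factor_nat by blast
      then obtain m where m: "n = l * m" by blast
      obtain q where q: "\<not> int l dvd q" "q \<bullet>\<^bsub>L\<^esub> x \<in> mspan aug_ideal T" using loc[OF l(1)] by blast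
      have "coprime (int l) q" using l(1) q(1) by (simp add: prime_imp_coprime)
      then obtain u v where uv: "u * int l + v * q = 1" by (metis bezout_int coprime_imp_gcd_eq_1)
      have "int m = u * int n + (v * int m) * q"
        using arg_cong[OF uv, of "\<lambda>z. z * int m"] by (simp add: m algebra_simps)
      then have "int m \<bullet>\<^bsub>L\<^esub> x = (u * int n + (v * int m) * q) \<bullet>\<^bsub>L\<^esub> x" by (rule arg_cong)
      also have "\<dots> = u \<bullet>\<^bsub>L\<^esub> (int n \<bullet>\<^bsub>L\<^esub> x) \<oplus>\<^bsub>L\<^esub> (v * int m) \<bullet>\<^bsub>L\<^esub> (q \<bullet>\<^bsub>L\<^esub> x)"
        by (simp only: L.zmult_add_left[OF x] L.zmult_assoc[OF x])
      finally have e: "int m \<bullet>\<^bsub>L\<^esub> x = u \<bullet>\<^bsub>L\<^esub> (int n \<bullet>\<^bsub>L\<^esub> x) \<oplus>\<^bsub>L\<^esub> (v * int m) \<bullet>\<^bsub>L\<^esub> (q \<bullet>\<^bsub>L\<^esub> x)" .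
      have "int m \<bullet>\<^bsub>L\<^esub> x \<in> mspan aug_ideal T"
        unfolding e by (intro mspan.add mspan_zmult[OF T] q(2) less.prems(2)) auto
      moreover have "m < n" "0 < m" using m prime_gt_1_nat[OF l(1)] less.prems(1) by auto
      ultimately show ?thesis using less.IH by blast
    qed
  qed
  \<comment> \<open>Some nonzero multiple is needed to start the descent; the prime \<open>2\<close>
    is an arbitrary choice.\<close>
  moreover obtain q where q: "\<not> int 2 dvd q" "q \<bullet>\<^bsub>L\<^esub> x \<in> mspan aug_ideal T"
    using loc[of 2] two_is_prime_nat by blast
  moreover have "int (nat \<bar>q\<bar>) \<bullet>\<^bsub>L\<^esub> x \<in> mspan aug_ideal T"
    unfolding L.zmult_abs[OF x] by (rule mspan_zmult[OF T _ q(2)]) simp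
  moreover have "0 < nat \<bar>q\<bar>" using q(1) by auto
  ultimately show ?thesis by blast
qed

text \<open>The weight at \<open>p\<close>: for a prime \<open>p\<close> it is prime to
  \<open>p\<close>, yet it contains the full \<open>l\<close>-part of the order of \<open>G\<close>
  for every other prime \<open>l\<close>.\<close>

definition prime_cofactor :: "nat \<Rightarrow> int" where
  "prime_cofactor p = int (order G div p ^ multiplicity p (order G))"

lemma order_pos: "0 < order G"
  using finite_G order_gt_0_iff_finite by blast

lemma order_eq: "int (order G) = int p ^ multiplicity p (order G) * prime_cofactor p"
proof -
  have "order G = p ^ multiplicity p (order G) * (order G div p ^ multiplicity p (order G))"
    by (simp add: multiplicity_dvd)
  then show ?thesis unfolding prime_cofactor_def by (metis of_nat_mult of_nat_power)
qed

lemma prime_cofactor_not_dvd: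
  assumes "Factorial_Ring.prime p"
  shows "\<not> int p dvd prime_cofactor p"
proof -
  have "\<not> p dvd order G div p ^ multiplicity p (order G)"
    using order_pos assms by (intro multiplicity_decompose) auto
  then show ?thesis by (simp add: prime_cofactor_def)
qed

lemma prime_cofactor_nonzero: "prime_cofactor p \<noteq> 0"
  using order_eq[of p] order_pos by auto

lemma prime_power_dvd_cofactor:
  assumes "Factorial_Ring.prime p" "Factorial_Ring.prime l" "l \<noteq> p" "int l ^ j dvd int (order G)"
  shows "int l ^ j dvd prime_cofactor p"
proof -
  have "coprime l p" using assms by (simp add: primes_coprime)
  then have "coprime (int l ^ j) (int p ^ multiplicity p (order G))" by simp
  then show ?thesis using assms(4) unfolding order_eq[of p] by (simp add: coprime_dvd_mult_right_iff)
qed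

text \<open>As the norm of \<open>K\<^sub>p\<close> annihilates \<open>A x\<close>, the augmentation ideal of \<open>K\<^sub>p\<close> times \<open>A x\<close> has finite
  index in \<open>A x\<close>.  The elements \<open>t p h g\<close> below generate the submodule which locally at each \<open>p\<close> is
  this product, and which is therefore equal to the augmentation ideal times itself.\<close>

lemma norms_annihilate_imp_zero:
  assumes x: "x \<in> carrier L"
    and norm: "\<And>p. Factorial_Ring.prime p \<Longrightarrow> emb (norm_elt (prime_to_p_subgroup G p)) \<otimes>\<^bsub>L\<^esub> x = \<zero>\<^bsub>L\<^esub>"
  shows "x = \<zero>\<^bsub>L\<^esub>"
proof -
  let ?c = prime_cofactor
  let ?K = "prime_to_p_subgroup G"
  \<comment> \<open>The prime \<open>2\<close> is added so that a prime is available for the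
    conclusion even if the order of \<open>G\<close> is odd or one.\<close>
  define S where "S = insert 2 (prime_factors (order G))"
  have S: "finite S" "2 \<in> S" "\<And>p. p \<in> S \<Longrightarrow> Factorial_Ring.prime p" by (auto simp: S_def)
  define H where "H = (\<lambda>p. {h \<in> carrier G. coprime (ord h) p})"
  have HG: "H p \<subseteq> carrier G" for p by (auto simp: H_def)
  define t where "t = (\<lambda>p h g. ?c p \<bullet>\<^bsub>L\<^esub> ((\<one>\<^bsub>L\<^esub> \<ominus>\<^bsub>L\<^esub> gam h) \<otimes>\<^bsub>L\<^esub> (gam g \<otimes>\<^bsub>L\<^esub> x)))"
  define T where "T = (\<lambda>(p, h, g). t p h g) ` (SIGMA p:S. H p \<times> carrier G)"
  have finT: "finite T"
    unfolding T_def using S(1) finite_subset[OF HG finite_G] finite_G by auto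
  have tL: "t p h g \<in> carrier L" for p h g using x by (simp add: t_def)
  have TL: "T \<subseteq> carrier L" by (auto simp: T_def tL)
  let ?N = "mspan (carrier A) T"
  have N_mult: "emb a \<otimes>\<^bsub>L\<^esub> y \<in> ?N" if "a \<in> carrier A" "y \<in> ?N" for a y
    by (rule mspan_mult_left[OF TL _ that(1) _ that(2)]) (use that in auto)
  have N_gam: "gam g \<otimes>\<^bsub>L\<^esub> y \<in> ?N" if "y \<in> ?N" for g y
    unfolding gam_def by (rule N_mult[OF ZG.group_elt_closed that])
  have N_zmult: "k \<bullet>\<^bsub>L\<^esub> y \<in> ?N" if "y \<in> ?N" for k y
    by (rule mspan_zmult[OF TL _ that]) simp
  have N_t: "t p h g \<in> ?N" if "p \<in> S" "h \<in> H p" "g \<in> carrier G" for p h g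
    using mspan.gen[of "\<one>\<^bsub>A\<^esub>" "carrier A" "t p h g" T] that tL by (auto simp: T_def)
  \<comment> \<open>Extends the generators from the elements of order prime to \<open>p\<close> to
    all of \<open>?K p\<close>, by \<open>1 - k l = (1 - k) + k (1 - l)\<close>.\<close>
  have N_K: "?c p \<bullet>\<^bsub>L\<^esub> ((\<one>\<^bsub>L\<^esub> \<ominus>\<^bsub>L\<^esub> gam k) \<otimes>\<^bsub>L\<^esub> (gam g \<otimes>\<^bsub>L\<^esub> x)) \<in> ?N"
    if p: "p \<in> S" and k: "k \<in> ?K p" and g: "g \<in> carrier G" for p k g
    using k[unfolded prime_to_p_subgroup_def] g
  proof (induction arbitrary: g rule: generate.induct)
    case one
    then show ?case using x by (simp add: gam_one a_minus_def L.r_neg mspan.zero)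
  next
    case (incl h)
    then show ?case using N_t[OF p] by (simp add: t_def H_def)
  next
    case (inv h)
    then have h: "h \<in> carrier G" "h \<in> H p" by (auto simp: H_def)
    have "inv h \<in> H p" using h by (simp add: H_def)
    then show ?case using N_t[OF p _ inv(2)] by (simp add: t_def)
  next
    case (eng k l)
    have kl: "k \<in> carrier G" "l \<in> carrier G"
      by (rule generate_in_carrier[OF _ eng(1)], blast) (rule generate_in_carrier[OF _ eng(2)], blast)
    let ?y = "gam g \<otimes>\<^bsub>L\<^esub> x"
    have y: "?y \<in> carrier L" using x by simp
    have "gam (k \<otimes> l) \<otimes>\<^bsub>L\<^esub> ?y = gam k \<otimes>\<^bsub>L\<^esub> (gam l \<otimes>\<^bsub>L\<^esub> ?y)"
      unfolding gam_mult[OF kl] by (rule L.m_assoc[OF gam_closed gam_closed y])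
    then have "(\<one>\<^bsub>L\<^esub> \<ominus>\<^bsub>L\<^esub> gam (k \<otimes> l)) \<otimes>\<^bsub>L\<^esub> ?y = ?y \<ominus>\<^bsub>L\<^esub> gam k \<otimes>\<^bsub>L\<^esub> (gam l \<otimes>\<^bsub>L\<^esub> ?y)"
      using y by (simp only: L.minus_mult_left L.one_closed gam_closed L.l_one)
    also have "\<dots> = (?y \<ominus>\<^bsub>L\<^esub> gam k \<otimes>\<^bsub>L\<^esub> ?y) \<oplus>\<^bsub>L\<^esub> (gam k \<otimes>\<^bsub>L\<^esub> ?y \<ominus>\<^bsub>L\<^esub> gam k \<otimes>\<^bsub>L\<^esub> (gam l \<otimes>\<^bsub>L\<^esub> ?y))"
      by (rule L.diff_add_diff_cancel[symmetric]) (use y in auto)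
    also have "\<dots> = (\<one>\<^bsub>L\<^esub> \<ominus>\<^bsub>L\<^esub> gam k) \<otimes>\<^bsub>L\<^esub> ?y \<oplus>\<^bsub>L\<^esub> gam k \<otimes>\<^bsub>L\<^esub> ((\<one>\<^bsub>L\<^esub> \<ominus>\<^bsub>L\<^esub> gam l) \<otimes>\<^bsub>L\<^esub> ?y)"
      using y by (simp only: L.minus_mult_left L.minus_mult_right L.one_closed gam_closed L.m_closed L.l_one)
    finally have e: "?c p \<bullet>\<^bsub>L\<^esub> ((\<one>\<^bsub>L\<^esub> \<ominus>\<^bsub>L\<^esub> gam (k \<otimes> l)) \<otimes>\<^bsub>L\<^esub> ?y)
        = ?c p \<bullet>\<^bsub>L\<^esub> ((\<one>\<^bsub>L\<^esub> \<ominus>\<^bsub>L\<^esub> gam k) \<otimes>\<^bsub>L\<^esub> ?y)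
          \<oplus>\<^bsub>L\<^esub> gam k \<otimes>\<^bsub>L\<^esub> (?c p \<bullet>\<^bsub>L\<^esub> ((\<one>\<^bsub>L\<^esub> \<ominus>\<^bsub>L\<^esub> gam l) \<otimes>\<^bsub>L\<^esub> ?y))"
      using y by (simp add: L.zmult_add_right L.zmult_mult_right)
    show ?case unfolding e by (rule mspan.add[OF eng.IH(1)[OF eng.prems] N_gam[OF eng.IH(2)[OF eng.prems]]])
  qed
  have KG: "?K p \<subseteq> carrier G" for p
    unfolding prime_to_p_subgroup_def by (rule subgroup.subset, rule generate_is_subgroup) auto
  have finK: "finite (?K p)" for p using KG finite_G finite_subset by blast
  \<comment> \<open>Finite index: the norm kills \<open>x\<close>, so it may be added to the sum of
    the \<open>(1 - k) x\<close>, and the terms \<open>(1 - k) x + k x\<close> are all equal to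
    \<open>x\<close>.\<close>
  have N_x: "(?c p * int (card (?K p))) \<bullet>\<^bsub>L\<^esub> x \<in> ?N" if p: "p \<in> S" for p
  proof -
    let ?f = "\<lambda>k. (\<one>\<^bsub>L\<^esub> \<ominus>\<^bsub>L\<^esub> gam k) \<otimes>\<^bsub>L\<^esub> x"
    have "(\<Oplus>\<^bsub>L\<^esub>k\<in>?K p. ?f k) = (\<Oplus>\<^bsub>L\<^esub>k\<in>?K p. ?f k) \<oplus>\<^bsub>L\<^esub> emb (norm_elt (?K p)) \<otimes>\<^bsub>L\<^esub> x"
      using norm[OF S(3)[OF p]] x by (simp add: L.finsum_closed)
    also have "emb (norm_elt (?K p)) \<otimes>\<^bsub>L\<^esub> x = (\<Oplus>\<^bsub>L\<^esub>k\<in>?K p. gam k \<otimes>\<^bsub>L\<^esub> x)"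
      unfolding emb_norm_elt[OF KG] by (rule L.finsum_ldistr) (use finK x in auto)
    also have "(\<Oplus>\<^bsub>L\<^esub>k\<in>?K p. ?f k) \<oplus>\<^bsub>L\<^esub> (\<Oplus>\<^bsub>L\<^esub>k\<in>?K p. gam k \<otimes>\<^bsub>L\<^esub> x)
        = (\<Oplus>\<^bsub>L\<^esub>k\<in>?K p. ?f k \<oplus>\<^bsub>L\<^esub> gam k \<otimes>\<^bsub>L\<^esub> x)"
      by (rule L.finsum_addf[symmetric]) (use x in auto)
    also have "\<dots> = (\<Oplus>\<^bsub>L\<^esub>k\<in>?K p. x)"
      by (rule L.finsum_cong') (use x in \<open>auto simp: L.minus_mult_left L.diff_add_cancel\<close>)
    also have "\<dots> = add_pow L (card (?K p)) x" using x by (rule L.add.finprod_const)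
    finally have "?c p \<bullet>\<^bsub>L\<^esub> (int (card (?K p)) \<bullet>\<^bsub>L\<^esub> x) = (\<Oplus>\<^bsub>L\<^esub>k\<in>?K p. ?c p \<bullet>\<^bsub>L\<^esub> ?f k)"
      using finK x by (simp add: L.finsum_zmult L.zmult_of_nat)
    also have "\<dots> \<in> ?N"
      by (rule mspan_finsum[OF finK _ TL]) (use N_K[OF p _ one_closed] x in \<open>auto simp: gam_one\<close>)
    finally show ?thesis using x by (simp add: L.zmult_assoc)
  qed
  have card_dvd: "card (?K p) dvd order G" for p
  proof -
    have "subgroup (?K p) G" unfolding prime_to_p_subgroup_def by (rule generate_is_subgroup) auto
    from lagrange[OF this] show ?thesis by (metis dvd_triv_right)
  qed
  have "T \<subseteq> mspan aug_ideal T"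
  proof
    fix y assume "y \<in> T"
    then obtain p h g where p: "p \<in> S" and h: "h \<in> H p" and g: "g \<in> carrier G" and y: "y = t p h g"
      by (auto simp: T_def)
    have pp: "Factorial_Ring.prime p" by (rule S(3)[OF p])
    have hG: "h \<in> carrier G" and cop: "coprime (ord h) p" using h by (auto simp: H_def)
    \<comment> \<open>\<open>q y\<close> is \<open>1 - h\<close>, of augmentation zero, applied to
      \<open>gam g\<close> times \<open>(q * ?c p)\<close> times \<open>x\<close>, which lies in
      \<open>?N\<close>.\<close>
    have from_N: "q \<bullet>\<^bsub>L\<^esub> y \<in> mspan aug_ideal T" if "(q * ?c p) \<bullet>\<^bsub>L\<^esub> x \<in> ?N" for q
    proof -
      have "emb (\<one>\<^bsub>A\<^esub> \<ominus>\<^bsub>A\<^esub> delta h) \<otimes>\<^bsub>L\<^esub> (gam g \<otimes>\<^bsub>L\<^esub> ((q * ?c p) \<bullet>\<^bsub>L\<^esub> x)) \<in> mspan aug_ideal T"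
        by (rule mspan_mult_left[OF TL _ _ _ N_gam[OF that]])
          (use hG in \<open>auto simp: aug_simps ZG.group_elt_closed ZG.augmentation_group_elt\<close>)
      then show ?thesis
        using x by (simp add: y t_def L.zmult_assoc L.zmult_mult_right emb_diff ZG.group_elt_closed gam_def[symmetric])
    qed
    show "y \<in> mspan aug_ideal T"
    proof (rule mspan_local[OF TL])
      show "y \<in> carrier L" by (simp add: y tL)
      fix l :: nat assume l: "Factorial_Ring.prime l"
      consider "l = p" | "l \<noteq> p" "l \<in> S" | "l \<noteq> p" "l \<notin> S" by blast
      then show "\<exists>q. \<not> int l dvd q \<and> q \<bullet>\<^bsub>L\<^esub> y \<in> mspan aug_ideal T"
      proof cases
        case 1
        \<comment> \<open>Since \<open>N (1 - h) = 0\<close>, the element \<open>ord h - N\<close>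
          of augmentation zero multiplies \<open>y\<close> by \<open>ord h\<close>, which is prime
          to \<open>p\<close>.\<close>
        obtain N where N: "N \<in> carrier A" "aug N = int (ord h)" "N \<otimes>\<^bsub>A\<^esub> delta h = N"
          using cyclic_norm[OF hG] by metis
        let ?d = "int (ord h) \<bullet>\<^bsub>A\<^esub> \<one>\<^bsub>A\<^esub> \<ominus>\<^bsub>A\<^esub> N"
        have eN: "emb N \<otimes>\<^bsub>L\<^esub> (\<one>\<^bsub>L\<^esub> \<ominus>\<^bsub>L\<^esub> gam h) = \<zero>\<^bsub>L\<^esub>"
          using arg_cong[OF N(3), of emb] N(1)
          by (simp add: L.minus_mult_right gam_def ZG.group_elt_closed)
        have "emb N \<otimes>\<^bsub>L\<^esub> y = ?c p \<bullet>\<^bsub>L\<^esub> ((emb N \<otimes>\<^bsub>L\<^esub> (\<one>\<^bsub>L\<^esub> \<ominus>\<^bsub>L\<^esub> gam h)) \<otimes>\<^bsub>L\<^esub> (gam g \<otimes>\<^bsub>L\<^esub> x))"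
          using N(1) x by (simp add: y t_def L.zmult_mult_right L.m_assoc del: L.minus_mult_right)
        then have "emb N \<otimes>\<^bsub>L\<^esub> y = \<zero>\<^bsub>L\<^esub>" using eN x by simp
        then have "emb ?d \<otimes>\<^bsub>L\<^esub> y = int (ord h) \<bullet>\<^bsub>L\<^esub> y"
          using N(1) tL by (simp add: y emb_diff emb_zmult L.minus_mult_left L.zmult_mult_left) (simp add: a_minus_def)
        moreover have "emb ?d \<otimes>\<^bsub>L\<^esub> y \<in> mspan aug_ideal T"
          using \<open>y \<in> T\<close> N by (intro mspan.gen) (auto simp: aug_simps aug_zmult)
        moreover have "\<not> l dvd ord h"
          using cop 1 pp by (metis coprime_common_divisor_nat dvd_refl not_prime_1)
        ultimately show ?thesis by (intro exI[of _ "int (ord h)"]) auto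
      next
        case 2
        \<comment> \<open>The \<open>l\<close>-part of \<open>card (?K l)\<close> divides the order
          of \<open>G\<close> and hence the weight \<open>?c p\<close>. So \<open>?q * ?c p\<close>
          is a multiple of \<open>?c l * int (card (?K l))\<close>, whereas \<open>?q\<close> itself
          is prime to \<open>l\<close>.\<close>
        define j where "j = multiplicity l (card (?K l))"
        have K0: "card (?K l) \<noteq> 0"
          using card_dvd[of l] order_pos by auto
        then obtain m where m: "card (?K l) = l ^ j * m" "\<not> l dvd m"
          using multiplicity_decompose'[of "card (?K l)" l] prime_gt_1_nat[OF l] unfolding j_def by auto
        let ?q = "?c l * int m"
        have "l ^ j dvd order G" using m(1) card_dvd[of l] by (metis dvd_mult_left)
        then have "int l ^ j dvd int (order G)" by (metis of_nat_dvd_iff of_nat_power)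
        then obtain s where s: "?c p = int l ^ j * s"
          using prime_power_dvd_cofactor[OF pp l 2(1)] by blast
        have "?q * ?c p = s * (?c l * int (card (?K l)))" by (simp add: s m(1))
        then have "(?q * ?c p) \<bullet>\<^bsub>L\<^esub> x = s \<bullet>\<^bsub>L\<^esub> ((?c l * int (card (?K l))) \<bullet>\<^bsub>L\<^esub> x)"
          using x by (simp only: L.zmult_assoc)
        then have "(?q * ?c p) \<bullet>\<^bsub>L\<^esub> x \<in> ?N" using N_zmult[OF N_x[OF 2(2)], of s] by simp
        from from_N[OF this] have "?q \<bullet>\<^bsub>L\<^esub> y \<in> mspan aug_ideal T" .
        moreover have "\<not> int l dvd ?q"
          using prime_cofactor_not_dvd[OF l] m(2) l by (simp add: prime_dvd_mult_iff)
        ultimately show ?thesis by blast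
      next
        case 3
        \<comment> \<open>Here \<open>l\<close> does not divide the order of \<open>G\<close>, so
          the order of \<open>?K p\<close> already serves as \<open>q\<close>.\<close>
        have "\<not> l dvd order G" using 3(2) l order_pos by (auto simp: S_def in_prime_factors_iff)
        then have "\<not> int l dvd int (card (?K p))" using card_dvd[of p] dvd_trans by auto
        moreover have "(int (card (?K p)) * ?c p) \<bullet>\<^bsub>L\<^esub> x \<in> ?N"
          using N_x[OF p] by (simp add: mult.commute)
        ultimately show ?thesis using from_N by blast
      qed
    qed
  qed
  then have T0: "T \<subseteq> {\<zero>\<^bsub>L\<^esub>}" by (rule perfect_mspan_zero[OF finT TL])
  \<comment> \<open>All generators vanish, and after cancelling the weight \<open>?c 2\<close> the
    group \<open>?K 2\<close> fixes \<open>x\<close>. Its norm then acts on \<open>x\<close> as the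
    order of \<open>?K 2\<close>, but also as zero.\<close>
  interpret two: localization_at_prime G 2 by (rule localization_at_primeI[OF two_is_prime_nat])
  have fixed: "gam h \<otimes>\<^bsub>L\<^esub> x = x" if h: "h \<in> {h \<in> carrier G. coprime (ord h) 2}" for h
  proof -
    have "t 2 h \<one> \<in> T" using S(2) h unfolding T_def by (intro image_eqI[of _ _ "(2, h, \<one>)"]) (auto simp: H_def)
    then have "?c 2 \<bullet>\<^bsub>L\<^esub> ((\<one>\<^bsub>L\<^esub> \<ominus>\<^bsub>L\<^esub> gam h) \<otimes>\<^bsub>L\<^esub> x) = \<zero>\<^bsub>L\<^esub>"
      using T0 x by (auto simp: t_def gam_one)
    from localization_torsion_free[OF prime_cofactor_nonzero _ this]
    have "x \<ominus>\<^bsub>L\<^esub> gam h \<otimes>\<^bsub>L\<^esub> x = \<zero>\<^bsub>L\<^esub>" using x by (simp add: L.minus_mult_left)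
    then show ?thesis using x by simp
  qed
  have "int (card (?K 2)) \<bullet>\<^bsub>L\<^esub> x = emb (norm_elt (?K 2)) \<otimes>\<^bsub>L\<^esub> x"
    by (rule norm_elt_fixed[OF KG x two.K_fixed[OF x fixed], symmetric])
  also have "\<dots> = \<zero>\<^bsub>L\<^esub>" by (rule norm[OF two_is_prime_nat])
  finally have "int (card (?K 2)) \<bullet>\<^bsub>L\<^esub> x = \<zero>\<^bsub>L\<^esub>" .
  moreover have "0 < card (?K 2)" using card_dvd[of 2] order_pos by (auto intro: Nat.gr0I)
  ultimately show ?thesis by (intro localization_torsion_free_nat[OF _ x])
qed

end

section \<open>The pull-back square\<close>

lemma product_ring_simps:
  "carrier (product_ring I R) = (\<Pi>\<^sub>E i\<in>I. carrier (R i))"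
  "u \<otimes>\<^bsub>product_ring I R\<^esub> v = (\<lambda>i\<in>I. u i \<otimes>\<^bsub>R i\<^esub> v i)"
  "u \<oplus>\<^bsub>product_ring I R\<^esub> v = (\<lambda>i\<in>I. u i \<oplus>\<^bsub>R i\<^esub> v i)"
  "\<one>\<^bsub>product_ring I R\<^esub> = (\<lambda>i\<in>I. \<one>\<^bsub>R i\<^esub>)"
  "\<zero>\<^bsub>product_ring I R\<^esub> = (\<lambda>i\<in>I. \<zero>\<^bsub>R i\<^esub>)"
  by (simp_all add: product_ring_def)

lemma product_ring_eqI:
  "u \<in> carrier (product_ring I R) \<Longrightarrow> v \<in> carrier (product_ring I R) \<Longrightarrow> (\<And>i. i \<in> I \<Longrightarrow> u i = v i) \<Longrightarrow> u = v"
  unfolding product_ring_simps by (rule PiE_ext)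

lemma product_ring_ring:
  assumes R: "\<And>i. i \<in> I \<Longrightarrow> ring (R i)"
  shows "ring (product_ring I R)"
proof -
  let ?P = "product_ring I R"
  note r = ring.ring_simprules[OF R]
  have cl: "u i \<in> carrier (R i)" if "u \<in> carrier ?P" "i \<in> I" for u i
    using that by (auto simp: product_ring_simps)
  have closed: "u \<oplus>\<^bsub>?P\<^esub> v \<in> carrier ?P" "u \<otimes>\<^bsub>?P\<^esub> v \<in> carrier ?P"
    if "u \<in> carrier ?P" "v \<in> carrier ?P" for u v
    using cl[OF that(1)] cl[OF that(2)] r by (auto simp: product_ring_simps)
  have const: "\<zero>\<^bsub>?P\<^esub> \<in> carrier ?P" "\<one>\<^bsub>?P\<^esub> \<in> carrier ?P"
    using r by (auto simp: product_ring_simps)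
  have distr: "(x \<oplus>\<^bsub>R i\<^esub> y) \<otimes>\<^bsub>R i\<^esub> z = x \<otimes>\<^bsub>R i\<^esub> z \<oplus>\<^bsub>R i\<^esub> y \<otimes>\<^bsub>R i\<^esub> z"
    "z \<otimes>\<^bsub>R i\<^esub> (x \<oplus>\<^bsub>R i\<^esub> y) = z \<otimes>\<^bsub>R i\<^esub> x \<oplus>\<^bsub>R i\<^esub> z \<otimes>\<^bsub>R i\<^esub> y"
    if "i \<in> I" "x \<in> carrier (R i)" "y \<in> carrier (R i)" "z \<in> carrier (R i)" for i x y z
  proof -
    interpret ring "R i" by (rule R[OF that(1)])
    show "(x \<oplus>\<^bsub>R i\<^esub> y) \<otimes>\<^bsub>R i\<^esub> z = x \<otimes>\<^bsub>R i\<^esub> z \<oplus>\<^bsub>R i\<^esub> y \<otimes>\<^bsub>R i\<^esub> z"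
      using that by (simp add: l_distr)
    show "z \<otimes>\<^bsub>R i\<^esub> (x \<oplus>\<^bsub>R i\<^esub> y) = z \<otimes>\<^bsub>R i\<^esub> x \<oplus>\<^bsub>R i\<^esub> z \<otimes>\<^bsub>R i\<^esub> y"
      using that by (simp add: r_distr)
  qed
  note app = product_ring_simps(2-5) restrict_apply'
  show ?thesis
  proof (rule ringI)
    show "abelian_group ?P"
    proof (rule abelian_groupI)
      fix u v w assume u: "u \<in> carrier ?P" and v: "v \<in> carrier ?P" and w: "w \<in> carrier ?P"
      show "u \<oplus>\<^bsub>?P\<^esub> v \<oplus>\<^bsub>?P\<^esub> w = u \<oplus>\<^bsub>?P\<^esub> (v \<oplus>\<^bsub>?P\<^esub> w)"
        by (rule product_ring_eqI[OF closed(1)[OF closed(1)[OF u v] w] closed(1)[OF u closed(1)[OF v w]]])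
          (simp add: app r cl[OF u] cl[OF v] cl[OF w])
    next
      fix u v assume u: "u \<in> carrier ?P" and v: "v \<in> carrier ?P"
      show "u \<oplus>\<^bsub>?P\<^esub> v = v \<oplus>\<^bsub>?P\<^esub> u"
        by (rule product_ring_eqI[OF closed(1)[OF u v] closed(1)[OF v u]]) (simp add: app r cl[OF u] cl[OF v])
      show "u \<oplus>\<^bsub>?P\<^esub> v \<in> carrier ?P" by (rule closed[OF u v])
    next
      fix u assume u: "u \<in> carrier ?P"
      show "\<zero>\<^bsub>?P\<^esub> \<oplus>\<^bsub>?P\<^esub> u = u"
        by (rule product_ring_eqI[OF closed(1)[OF const(1) u] u]) (simp add: app r cl[OF u])
      have m: "(\<lambda>i\<in>I. \<ominus>\<^bsub>R i\<^esub> u i) \<in> carrier ?P"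
        using cl[OF u] r by (auto simp: product_ring_simps)
      have "(\<lambda>i\<in>I. \<ominus>\<^bsub>R i\<^esub> u i) \<oplus>\<^bsub>?P\<^esub> u = \<zero>\<^bsub>?P\<^esub>"
        by (rule product_ring_eqI[OF closed(1)[OF m u] const(1)]) (simp add: app r cl[OF u])
      with m show "\<exists>v\<in>carrier ?P. v \<oplus>\<^bsub>?P\<^esub> u = \<zero>\<^bsub>?P\<^esub>" by blast
    qed (rule const)
    show "monoid ?P"
    proof (rule monoidI)
      fix u v w assume u: "u \<in> carrier ?P" and v: "v \<in> carrier ?P" and w: "w \<in> carrier ?P"
      show "u \<otimes>\<^bsub>?P\<^esub> v \<otimes>\<^bsub>?P\<^esub> w = u \<otimes>\<^bsub>?P\<^esub> (v \<otimes>\<^bsub>?P\<^esub> w)"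
        by (rule product_ring_eqI[OF closed(2)[OF closed(2)[OF u v] w] closed(2)[OF u closed(2)[OF v w]]])
          (simp add: app r cl[OF u] cl[OF v] cl[OF w])
    next
      fix u assume u: "u \<in> carrier ?P"
      show "\<one>\<^bsub>?P\<^esub> \<otimes>\<^bsub>?P\<^esub> u = u"
        by (rule product_ring_eqI[OF closed(2)[OF const(2) u] u]) (simp add: app r cl[OF u])
      show "u \<otimes>\<^bsub>?P\<^esub> \<one>\<^bsub>?P\<^esub> = u"
        by (rule product_ring_eqI[OF closed(2)[OF u const(2)] u])
          (simp add: app cl[OF u] monoid.r_one[OF ring.is_monoid[OF R]])
    qed (rule closed const; assumption)+
  next
    fix u v w assume u: "u \<in> carrier ?P" and v: "v \<in> carrier ?P" and w: "w \<in> carrier ?P"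
    show "(u \<oplus>\<^bsub>?P\<^esub> v) \<otimes>\<^bsub>?P\<^esub> w = u \<otimes>\<^bsub>?P\<^esub> w \<oplus>\<^bsub>?P\<^esub> v \<otimes>\<^bsub>?P\<^esub> w"
      by (rule product_ring_eqI[OF closed(2)[OF closed(1)[OF u v] w] closed(1)[OF closed(2)[OF u w] closed(2)[OF v w]]])
        (simp add: app cl[OF u] cl[OF v] cl[OF w] distr)
    show "w \<otimes>\<^bsub>?P\<^esub> (u \<oplus>\<^bsub>?P\<^esub> v) = w \<otimes>\<^bsub>?P\<^esub> u \<oplus>\<^bsub>?P\<^esub> w \<otimes>\<^bsub>?P\<^esub> v"
      by (rule product_ring_eqI[OF closed(2)[OF w closed(1)[OF u v]] closed(1)[OF closed(2)[OF w u] closed(2)[OF w v]]])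
        (simp add: app cl[OF u] cl[OF v] cl[OF w] distr)
  qed
qed

lemma product_ring_hom:
  assumes "\<And>i. i \<in> I \<Longrightarrow> f i \<in> ring_hom S (R i)"
  shows "(\<lambda>x. \<lambda>i\<in>I. f i x) \<in> ring_hom S (product_ring I R)"
  by (rule ring_hom_memI)
    (auto simp: product_ring_simps ring_hom_closed[OF assms] ring_hom_mult[OF assms]
      ring_hom_add[OF assms] ring_hom_one[OF assms] fun_eq_iff)

lemma product_ring_map_hom:
  assumes "\<And>i. i \<in> I \<Longrightarrow> f i \<in> ring_hom (R i) (S i)"
  shows "(\<lambda>u. \<lambda>i\<in>I. f i (u i)) \<in> ring_hom (product_ring I R) (product_ring I S)"
proof (rule ring_hom_memI)
  have cl: "u i \<in> carrier (R i)" if "u \<in> carrier (product_ring I R)" "i \<in> I" for u i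
    using that by (auto simp: product_ring_simps)
  fix u v assume uv: "u \<in> carrier (product_ring I R)" "v \<in> carrier (product_ring I R)"
  show "(\<lambda>i\<in>I. f i (u i)) \<in> carrier (product_ring I S)"
    using cl[OF uv(1)] ring_hom_closed[OF assms] by (auto simp: product_ring_simps)
  show "(\<lambda>i\<in>I. f i ((u \<otimes>\<^bsub>product_ring I R\<^esub> v) i)) = (\<lambda>i\<in>I. f i (u i)) \<otimes>\<^bsub>product_ring I S\<^esub> (\<lambda>i\<in>I. f i (v i))"
    using cl[OF uv(1)] cl[OF uv(2)] ring_hom_mult[OF assms] by (auto simp: product_ring_simps fun_eq_iff)
  show "(\<lambda>i\<in>I. f i ((u \<oplus>\<^bsub>product_ring I R\<^esub> v) i)) = (\<lambda>i\<in>I. f i (u i)) \<oplus>\<^bsub>product_ring I S\<^esub> (\<lambda>i\<in>I. f i (v i))"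
    using cl[OF uv(1)] cl[OF uv(2)] ring_hom_add[OF assms] by (auto simp: product_ring_simps fun_eq_iff)
qed (use ring_hom_one[OF assms] in \<open>auto simp: product_ring_simps fun_eq_iff\<close>)

lemma fibre_product_iso:
  assumes "a \<in> ring_hom P V" "b \<in> ring_hom P W" "inj_on (\<lambda>x. (a x, b x)) (carrier P)"
    and comm: "\<And>x. x \<in> carrier P \<Longrightarrow> f (a x) = g (b x)"
    and surj: "\<And>v w. v \<in> carrier V \<Longrightarrow> w \<in> carrier W \<Longrightarrow> f v = g w \<Longrightarrow> \<exists>x\<in>carrier P. a x = v \<and> b x = w"
  shows "(\<lambda>x. (a x, b x)) \<in> ring_iso P (fibre_product V W f g)"
proof (rule ring_iso_memI)
  have ops: "carrier (fibre_product V W f g) = {(x, y). x \<in> carrier V \<and> y \<in> carrier W \<and> f x = g y}"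
    "(x, y) \<otimes>\<^bsub>fibre_product V W f g\<^esub> (x', y') = (x \<otimes>\<^bsub>V\<^esub> x', y \<otimes>\<^bsub>W\<^esub> y')"
    "(x, y) \<oplus>\<^bsub>fibre_product V W f g\<^esub> (x', y') = (x \<oplus>\<^bsub>V\<^esub> x', y \<oplus>\<^bsub>W\<^esub> y')"
    "\<one>\<^bsub>fibre_product V W f g\<^esub> = (\<one>\<^bsub>V\<^esub>, \<one>\<^bsub>W\<^esub>)" for x y x' y'
    by (simp_all add: fibre_product_def RDirProd_def DirProd_def monoid.defs)
  note hom = ring_hom_closed[OF assms(1)] ring_hom_closed[OF assms(2)]
  show "(a x, b x) \<in> carrier (fibre_product V W f g)" if "x \<in> carrier P" for x
    using that hom comm by (simp add: ops)
  then have "(\<lambda>x. (a x, b x)) ` carrier P \<subseteq> carrier (fibre_product V W f g)" by blast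
  moreover have "carrier (fibre_product V W f g) \<subseteq> (\<lambda>x. (a x, b x)) ` carrier P"
  proof
    fix z assume "z \<in> carrier (fibre_product V W f g)"
    then obtain v w where z: "z = (v, w)" "v \<in> carrier V" "w \<in> carrier W" "f v = g w" by (auto simp: ops)
    then obtain x where "x \<in> carrier P" "a x = v" "b x = w" using surj by blast
    then show "z \<in> (\<lambda>x. (a x, b x)) ` carrier P" using z(1) by blast
  qed
  ultimately show "bij_betw (\<lambda>x. (a x, b x)) (carrier P) (carrier (fibre_product V W f g))"
    using assms(3) by (simp add: bij_betw_def)
qed (use assms in \<open>auto simp: fibre_product_def RDirProd_def DirProd_def monoid.defs ring_hom_mult ring_hom_add ring_hom_one\<close>)

section \<open>The square formed by the canonical maps\<close>

context finite_group_localization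
begin

lemma canonical_Z_ex1: "\<exists>!a. cohn_factor A \<Z> aug \<Z> aug a"
  by (rule cohn_localization_universal[OF A.ring_axioms int.ring_axioms aug_hom])
    (simp add: inverted_matrices_def)

text \<open>If \<open>p\<close> does not divide the order of \<open>G\<close>, all elements have
  order prime to \<open>p\<close> and \<open>K\<close> is the whole group. Hence there are only
  finitely many relevant primes, and corrections at them can be summed.\<close>

lemma relevant_primes_dvd:
  assumes "p \<in> relevant_primes G"
  shows "Factorial_Ring.prime p" "p dvd order G"
proof -
  show p: "Factorial_Ring.prime p" using assms by (simp add: relevant_primes_def)
  interpret localization_at_prime G p by (rule localization_at_primeI[OF p])
  show "p dvd order G"
  proof (rule ccontr)
    assume "\<not> p dvd order G"
    from prime_imp_coprime[OF p this] have cop: "coprime (order G) p" by (simp add: coprime_commute)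
    have "K #> g = \<one>\<^bsub>Gp\<^esub>" if g: "g \<in> carrier G" for g
    proof (rule proj_K[OF prime_elts_K])
      show "g \<in> prime_elts" using g cop coprime_divisors[OF ord_dvd_group_order[OF g] dvd_refl] by simp
    qed
    then have "carrier Gp = {\<one>\<^bsub>Gp\<^esub>}" unfolding Gp_carrier using one_closed by auto
    then show False using assms by (simp add: relevant_primes_def)
  qed
qed

lemma finite_relevant_primes: "finite (relevant_primes G)"
  by (rule finite_subset[of _ "{p. p dvd order G}"]) (use relevant_primes_dvd order_pos in auto)

context
  fixes a b
  assumes a: "cohn_factor A \<Z> aug \<Z> aug a"
    and b: "\<And>p. p \<in> relevant_primes G \<Longrightarrow>
      cohn_factor A \<Z> aug (group_ring (Z_localized p) (p_quotient G p)) (to_p_group_ring G p) (b p)"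
begin

lemma canonical_Z_hom: "a \<in> ring_hom L \<Z>"
  using a by (simp add: cohn_factor_def)

lemma canonical_p_hom: "p \<in> relevant_primes G \<Longrightarrow> b p \<in> ring_hom L (group_ring (Z_localized p) (p_quotient G p))"
  using b by (simp add: cohn_factor_def)

text \<open>\<open>norms_annihilate_imp_zero\<close> asks for the norms at all primes. At a prime
  that is not relevant \<open>Gp\<close> is trivial, an element of Z_(p)[G_p] is determined by its
  augmentation, and that of the image of \<open>x\<close> is the image of
  \<open>a x = 0\<close>.\<close>

lemma joint_kernel_trivial:
  assumes x: "x \<in> carrier L" and ax: "a x = 0"
    and bx: "\<And>p. p \<in> relevant_primes G \<Longrightarrow> b p x = \<zero>\<^bsub>group_ring (Z_localized p) (p_quotient G p)\<^esub>"
  shows "x = \<zero>\<^bsub>L\<^esub>"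
proof (rule norms_annihilate_imp_zero[OF x])
  fix p :: nat assume p: "Factorial_Ring.prime p"
  interpret localization_at_prime G p by (rule localization_at_primeI[OF p])
  interpret P: std_group_ring "Z_localized p" Gp by (rule std_group_ring_Zp[OF Gp_group Gp_finite])
  obtain c where c: "cohn_factor A \<Z> aug Rp top c" using canonical_ex1 by blast
  have "c x = \<zero>\<^bsub>Rp\<^esub>"
  proof (cases "p \<in> relevant_primes G")
    case True
    then have "c = b p" using canonical_ex1 c b by blast
    then show ?thesis using bx True by simp
  next
    case False
    then have triv: "carrier Gp = {\<one>\<^bsub>Gp\<^esub>}" using p by (simp add: relevant_primes_def)
    have cx: "c x \<in> carrier Rp" using ring_hom_closed[OF canonical_hom[OF c] x] .
    have "c x \<one>\<^bsub>Gp\<^esub> = 0"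
      using augmentation_canonical[OF c x a] ax P.augmentation_sum[OF cx] triv by simp
    then show ?thesis
      using triv by (intro P.gr_ext[OF cx P.gr_zero_closed]) (simp add: P.gr_zero_apply)
  qed
  from canonical_kernel_norm[OF p c x this]
  show "emb (norm_elt (prime_to_p_subgroup G p)) \<otimes>\<^bsub>L\<^esub> x = \<zero>\<^bsub>L\<^esub>" .
qed

lemma canonical_maps_inj:
  "inj_on (\<lambda>x. (a x, \<lambda>p\<in>relevant_primes G. b p x)) (carrier L)"
proof (rule inj_onI)
  fix x y assume xy: "x \<in> carrier L" "y \<in> carrier L"
    and eq: "(a x, \<lambda>p\<in>relevant_primes G. b p x) = (a y, \<lambda>p\<in>relevant_primes G. b p y)"
  have "x \<ominus>\<^bsub>L\<^esub> y = \<zero>\<^bsub>L\<^esub>"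
  proof (rule joint_kernel_trivial)
    show "a (x \<ominus>\<^bsub>L\<^esub> y) = 0"
      using ring_hom_diff[OF L.ring_axioms int.ring_axioms canonical_Z_hom xy] eq by (simp add: int_a_minus_eq)
  next
    fix p assume p: "p \<in> relevant_primes G"
    interpret localization_at_prime G p by (rule localization_at_primeI[OF relevant_primes_dvd(1)[OF p]])
    interpret Rp: ring Rp by (rule Rp_ring)
    have "b p x = b p y" using fun_cong[OF conjunct2[OF eq[unfolded prod.inject]], of p] p by simp
    then show "b p (x \<ominus>\<^bsub>L\<^esub> y) = \<zero>\<^bsub>Rp\<^esub>"
      using ring_hom_diff[OF L.ring_axioms Rp_ring canonical_p_hom[OF p] xy] ring_hom_closed[OF canonical_p_hom[OF p] xy(2)]
      by simp
  qed (use xy in simp)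
  then show "x = y" using xy by simp
qed

text \<open>Corrects the constant \<open>k\<close> to \<open>u\<close> in the component at
  \<open>p\<close> and leaves the others alone: \<open>u - k\<close> has augmentation zero, so
  \<open>canonical_surj\<close> applies.\<close>

lemma p_component:
  assumes p: "p \<in> relevant_primes G"
    and u: "u \<in> carrier (group_ring (Z_localized p) (p_quotient G p))"
    and aug_u: "augmentation (Z_localized p) (p_quotient G p) u = rat_of_int k"
  shows "\<exists>x\<in>carrier L. a x = 0 \<and>
    k \<bullet>\<^bsub>group_ring (Z_localized p) (p_quotient G p)\<^esub> \<one>\<^bsub>group_ring (Z_localized p) (p_quotient G p)\<^esub>
      \<oplus>\<^bsub>group_ring (Z_localized p) (p_quotient G p)\<^esub> b p x = u \<and>
    (\<forall>r\<in>relevant_primes G. r \<noteq> p \<longrightarrow> b r x = \<zero>\<^bsub>group_ring (Z_localized r) (p_quotient G r)\<^esub>)"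
proof -
  interpret localization_at_prime G p by (rule localization_at_primeI[OF relevant_primes_dvd(1)[OF p]])
  interpret P: std_group_ring "Z_localized p" Gp by (rule std_group_ring_Zp[OF Gp_group Gp_finite])
  interpret Rp: ring Rp by (rule Rp_ring)
  let ?H = "{g \<in> carrier G. \<exists>i. ord g = p ^ i}"
  let ?y = "u \<ominus>\<^bsub>Rp\<^esub> k \<bullet>\<^bsub>Rp\<^esub> \<one>\<^bsub>Rp\<^esub>"
  have y: "?y \<in> carrier Rp" using u by simp
  have k1: "k \<bullet>\<^bsub>Rp\<^esub> \<one>\<^bsub>Rp\<^esub> \<in> carrier Rp" by simp
  have "augmentation (Z_localized p) Gp (k \<bullet>\<^bsub>Rp\<^esub> \<one>\<^bsub>Rp\<^esub>) = rat_of_int k * augmentation (Z_localized p) Gp \<one>\<^bsub>Rp\<^esub>"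
    by (simp add: P.augmentation_sum[OF k1] P.augmentation_sum P.gr_zmult_apply sum_distrib_left)
  then have "augmentation (Z_localized p) Gp (k \<bullet>\<^bsub>Rp\<^esub> \<one>\<^bsub>Rp\<^esub>) = rat_of_int k"
    using ring_hom_one[OF P.augmentation_hom] by simp
  moreover have "augmentation (Z_localized p) Gp (?y \<oplus>\<^bsub>Rp\<^esub> k \<bullet>\<^bsub>Rp\<^esub> \<one>\<^bsub>Rp\<^esub>)
      = augmentation (Z_localized p) Gp ?y + augmentation (Z_localized p) Gp (k \<bullet>\<^bsub>Rp\<^esub> \<one>\<^bsub>Rp\<^esub>)"
    using ring_hom_add[OF P.augmentation_hom y k1] by simp
  moreover have y_add: "?y \<oplus>\<^bsub>Rp\<^esub> k \<bullet>\<^bsub>Rp\<^esub> \<one>\<^bsub>Rp\<^esub> = u" by (rule Rp.diff_add_cancel[OF u k1])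
  ultimately have "augmentation (Z_localized p) Gp ?y = 0" using aug_u by simp
  from canonical_surj[OF b[OF p] y this] obtain x where x: "x \<in> diff_ideal ?H" "b p x = ?y" by blast
  have a_emb: "\<And>v. v \<in> carrier A \<Longrightarrow> a (emb v) = aug v" using a by (simp add: cohn_factor_def)
  have "a x = \<zero>\<^bsub>\<Z>\<^esub>"
    by (rule diff_ideal_hom_zero[OF int.ring_axioms canonical_Z_hom _ x(1)])
      (simp add: gam_def a_emb ZG.group_elt_closed ZG.augmentation_group_elt)
  moreover have "b r x = \<zero>\<^bsub>group_ring (Z_localized r) (p_quotient G r)\<^esub>"
    if r: "r \<in> relevant_primes G" "r \<noteq> p" for r
  proof -
    have rp: "Factorial_Ring.prime r" by (rule relevant_primes_dvd(1)[OF r(1)])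
    interpret r: localization_at_prime G r by (rule localization_at_primeI[OF rp])
    \<comment> \<open>An element of \<open>p\<close>-power order has order prime to
      \<open>r\<close>, so the canonical map at \<open>r\<close> sends it to one and kills the
      ideal.\<close>
    have "h \<in> r.prime_elts" if h: "h \<in> ?H" for h
    proof -
      have "coprime p r" using prime_p rp r(2) by (simp add: primes_coprime)
      then show ?thesis using h by auto
    qed
    then show ?thesis
      by (intro diff_ideal_hom_zero[OF r.Rp_ring canonical_p_hom[OF r(1)] r.canonical_gam[OF b[OF r(1)]] x(1)])
  qed
  moreover have "k \<bullet>\<^bsub>Rp\<^esub> \<one>\<^bsub>Rp\<^esub> \<oplus>\<^bsub>Rp\<^esub> b p x = u"
    using y_add x(2) Rp.a_comm[OF y k1] by simp
  ultimately show ?thesis using diff_ideal_closed[OF x(1)] by auto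
qed

text \<open>The preimage is \<open>k\<close> plus the sum of the corrections at the relevant primes;
  in the component at \<open>r\<close> only the correction for \<open>r\<close> survives.\<close>

lemma canonical_maps_surj:
  assumes u: "\<And>p. p \<in> relevant_primes G \<Longrightarrow> u p \<in> carrier (group_ring (Z_localized p) (p_quotient G p))"
    and aug_u: "\<And>p. p \<in> relevant_primes G \<Longrightarrow>
      augmentation (Z_localized p) (p_quotient G p) (u p) = rat_of_int k"
  shows "\<exists>x\<in>carrier L. a x = k \<and> (\<forall>p\<in>relevant_primes G. b p x = u p)"
proof -
  let ?I = "relevant_primes G"
  let ?R = "\<lambda>p. group_ring (Z_localized p) (p_quotient G p)"
  have "\<forall>p\<in>?I. \<exists>x. x \<in> carrier L \<and> a x = 0 \<and> k \<bullet>\<^bsub>?R p\<^esub> \<one>\<^bsub>?R p\<^esub> \<oplus>\<^bsub>?R p\<^esub> b p x = u p \<and>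
      (\<forall>r\<in>?I. r \<noteq> p \<longrightarrow> b r x = \<zero>\<^bsub>?R r\<^esub>)"
    using p_component[OF _ u aug_u] by blast
  from bchoice[OF this] obtain x where x: "\<And>p. p \<in> ?I \<Longrightarrow> x p \<in> carrier L"
    "\<And>p. p \<in> ?I \<Longrightarrow> a (x p) = 0" "\<And>p. p \<in> ?I \<Longrightarrow> k \<bullet>\<^bsub>?R p\<^esub> \<one>\<^bsub>?R p\<^esub> \<oplus>\<^bsub>?R p\<^esub> b p (x p) = u p"
    "\<And>p r. p \<in> ?I \<Longrightarrow> r \<in> ?I \<Longrightarrow> r \<noteq> p \<Longrightarrow> b r (x p) = \<zero>\<^bsub>?R r\<^esub>"
    by blast
  let ?s = "\<Oplus>\<^bsub>L\<^esub>p\<in>?I. x p"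
  let ?z = "k \<bullet>\<^bsub>L\<^esub> \<one>\<^bsub>L\<^esub> \<oplus>\<^bsub>L\<^esub> ?s"
  have s: "?s \<in> carrier L" using x(1) by (intro L.finsum_closed) auto
  interpret ha: ring_hom_ring L \<Z> a by (rule ring_hom_ringI2[OF L.ring_axioms int.ring_axioms canonical_Z_hom])
  have "a ?s = (\<Sum>p\<in>?I. a (x p))" using ha.hom_finsum[of x ?I] x(1) by (simp add: comp_def)
  also have "\<dots> = 0" using x(2) by simp
  finally have "a ?s = 0" .
  moreover have "a (k \<bullet>\<^bsub>L\<^esub> \<one>\<^bsub>L\<^esub>) = k"
  proof -
    have "a (emb (k \<bullet>\<^bsub>A\<^esub> \<one>\<^bsub>A\<^esub>)) = k"
      using a by (simp add: cohn_factor_def aug_zmult aug_simps del: emb.hom_one)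
    then show ?thesis by (simp add: emb_zmult)
  qed
  ultimately have "a ?z = k" using ring_hom_add[OF canonical_Z_hom _ s, of "k \<bullet>\<^bsub>L\<^esub> \<one>\<^bsub>L\<^esub>"] by simp
  moreover have "b r ?z = u r" if r: "r \<in> ?I" for r
  proof -
    interpret localization_at_prime G r by (rule localization_at_primeI[OF relevant_primes_dvd(1)[OF r]])
    interpret hb: ring_hom_ring L "?R r" "b r" by (rule ring_hom_ringI2[OF L.ring_axioms Rp_ring canonical_p_hom[OF r]])
    have "b r ?s = finsum (?R r) (b r \<circ> x) ?I" by (rule hb.hom_finsum) (use x(1) in auto)
    also have "\<dots> = (\<Oplus>\<^bsub>?R r\<^esub>p\<in>?I. if r = p then b r (x r) else \<zero>\<^bsub>?R r\<^esub>)"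
      by (rule hb.S.finsum_cong') (use x r in auto)
    also have "\<dots> = b r (x r)"
      using hb.S.add.finprod_singleton[of r ?I "\<lambda>_. b r (x r)"] finite_relevant_primes r x(1)
      by (simp add: finsum_def Pi_def)
    finally have bs: "b r ?s = b r (x r)" .
    have "b r ?z = b r (k \<bullet>\<^bsub>L\<^esub> \<one>\<^bsub>L\<^esub>) \<oplus>\<^bsub>?R r\<^esub> b r ?s" using s by simp
    also have "b r (k \<bullet>\<^bsub>L\<^esub> \<one>\<^bsub>L\<^esub>) = k \<bullet>\<^bsub>?R r\<^esub> \<one>\<^bsub>?R r\<^esub>"
      using ring_hom_zmult[OF L.ring_axioms Rp_ring canonical_p_hom[OF r] L.one_closed, of k] by simp
    finally show ?thesis using bs x(3)[OF r] by simp
  qed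
  ultimately show ?thesis using s by (intro bexI[of _ ?z]) auto
qed

lemma canonical_pullback_square:
  "pullback_square L \<Z>
    (product_ring (relevant_primes G) (\<lambda>p. group_ring (Z_localized p) (p_quotient G p)))
    (product_ring (relevant_primes G) Z_localized)
    a (\<lambda>x. \<lambda>p\<in>relevant_primes G. b p x) (\<lambda>n. \<lambda>p\<in>relevant_primes G. rat_of_int n)
    (\<lambda>u. \<lambda>p\<in>relevant_primes G. augmentation (Z_localized p) (p_quotient G p) (u p))"
proof -
  let ?I = "relevant_primes G"
  let ?R = "\<lambda>p. group_ring (Z_localized p) (p_quotient G p)"
  let ?e = "\<lambda>p. augmentation (Z_localized p) (p_quotient G p)"
  have loc: "localization_at_prime G p" if "p \<in> ?I" for p
    by (rule localization_at_primeI[OF relevant_primes_dvd(1)[OF that]])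
  have R: "ring (?R p)" if "p \<in> ?I" for p
    by (rule localization_at_prime.Rp_ring[OF loc[OF that]])
  have std: "std_group_ring (Z_localized p) (p_quotient G p)" if "p \<in> ?I" for p
  proof -
    interpret localization_at_prime G p by (rule loc[OF that])
    show ?thesis by (rule std_group_ring_Zp[OF Gp_group Gp_finite])
  qed
  have Z: "ring (Z_localized p)" and e: "?e p \<in> ring_hom (?R p) (Z_localized p)" if "p \<in> ?I" for p
  proof -
    interpret P: std_group_ring "Z_localized p" "p_quotient G p" by (rule std[OF that])
    show "ring (Z_localized p)" by (rule P.ring_axioms)
    show "?e p \<in> ring_hom (?R p) (Z_localized p)" by (rule P.augmentation_hom)
  qed
  have i: "rat_of_int \<in> ring_hom \<Z> (Z_localized p)" if "p \<in> ?I" for p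
  proof -
    interpret localization_at_prime G p by (rule loc[OF that])
    show ?thesis by (rule ring_hom_memI) auto
  qed
  have hom: "(\<lambda>x. \<lambda>p\<in>?I. b p x) \<in> ring_hom L (product_ring ?I ?R)"
    by (rule product_ring_hom[OF canonical_p_hom])
  have comm: "(\<lambda>p\<in>?I. rat_of_int (a x)) = (\<lambda>p\<in>?I. ?e p ((\<lambda>p\<in>?I. b p x) p))" if x: "x \<in> carrier L" for x
  proof (rule restrict_ext)
    fix p assume p: "p \<in> ?I"
    show "rat_of_int (a x) = ?e p ((\<lambda>p\<in>?I. b p x) p)"
      using localization_at_prime.augmentation_canonical[OF loc[OF p] b[OF p] x a] p by simp
  qed
  have surj: "\<exists>x\<in>carrier L. a x = k \<and> (\<lambda>p\<in>?I. b p x) = u"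
    if u: "u \<in> carrier (product_ring ?I ?R)" and eq: "(\<lambda>p\<in>?I. rat_of_int k) = (\<lambda>p\<in>?I. ?e p (u p))" for k u
  proof -
    have "u p \<in> carrier (?R p)" if "p \<in> ?I" for p
      using u that by (auto simp: product_ring_simps)
    moreover have "?e p (u p) = rat_of_int k" if "p \<in> ?I" for p
      using fun_cong[OF eq, of p] that by simp
    ultimately obtain x where x: "x \<in> carrier L" "a x = k" "\<forall>p\<in>?I. b p x = u p"
      using canonical_maps_surj[of u k] by blast
    have "(\<lambda>p\<in>?I. b p x) = u"
      by (rule product_ring_eqI[OF ring_hom_closed[OF hom x(1)] u]) (use x(3) in simp)
    then show ?thesis using x by blast
  qed
  have iso: "(\<lambda>x. (a x, \<lambda>p\<in>?I. b p x)) \<in> ring_iso L (fibre_product \<Z> (product_ring ?I ?R)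
      (\<lambda>n. \<lambda>p\<in>?I. rat_of_int n) (\<lambda>u. \<lambda>p\<in>?I. ?e p (u p)))"
    by (rule fibre_product_iso[where f = "\<lambda>n. \<lambda>p\<in>?I. rat_of_int n" and g = "\<lambda>u. \<lambda>p\<in>?I. ?e p (u p)",
        OF canonical_Z_hom hom canonical_maps_inj comm surj])
  show ?thesis
    unfolding pullback_square_def
    by (intro conjI L.ring_axioms int.ring_axioms product_ring_ring[OF R] product_ring_ring[OF Z] canonical_Z_hom hom
        product_ring_hom[OF i] product_ring_map_hom[OF e] iso)
qed

end

end

text \<open>Existence and uniqueness of the canonical maps are part of the claim, so that the
  quantification over them in the last conjunct is neither vacuous nor ambiguous.\<close>

theorem theoremA:
  fixes G :: "('g, 'm) monoid_scheme"
  assumes "group G" and "finite (carrier G)"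
  shows "let
      ZG = group_ring \<Z> G;
      \<epsilon> = augmentation \<Z> G;
      \<Lambda> = cohn_localization ZG \<Z> \<epsilon>;
      I = relevant_primes G;
      R = (\<lambda>p. group_ring (Z_localized p) (p_quotient G p));
      canonical_Z = cohn_factor ZG \<Z> \<epsilon> \<Z> \<epsilon>;
      canonical = (\<lambda>p. cohn_factor ZG \<Z> \<epsilon> (R p) (to_p_group_ring G p))
    in
      (\<exists>!\<alpha>. canonical_Z \<alpha>) \<and>
      (\<forall>p\<in>I. \<exists>!\<beta>. canonical p \<beta>) \<and>
      (\<forall>\<alpha> \<beta>. canonical_Z \<alpha> \<and> (\<forall>p\<in>I. canonical p (\<beta> p)) \<longrightarrow>
        pullback_square \<Lambda> \<Z> (product_ring I R) (product_ring I Z_localized)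
          \<alpha>
          (\<lambda>x. \<lambda>p\<in>I. \<beta> p x)
          (\<lambda>n. \<lambda>p\<in>I. rat_of_int n)
          (\<lambda>u. \<lambda>p\<in>I. augmentation (Z_localized p) (p_quotient G p) (u p)))"
proof -
  interpret finite_group_localization G
    by (intro finite_group_localization.intro finite_group_localization_axioms.intro assms)
  show ?thesis
    unfolding Let_def
  proof (intro conjI ballI allI impI)
    show "\<exists>!a. cohn_factor A \<Z> aug \<Z> aug a" by (rule canonical_Z_ex1)
    show "\<exists>!b. cohn_factor A \<Z> aug (group_ring (Z_localized p) (p_quotient G p)) (to_p_group_ring G p) b"
      if "p \<in> relevant_primes G" for p
      by (rule localization_at_prime.canonical_ex1[OF localization_at_primeI[OF relevant_primes_dvd(1)[OF that]]])
  next
    fix a b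
    assume *: "cohn_factor A \<Z> aug \<Z> aug a \<and> (\<forall>p\<in>relevant_primes G.
      cohn_factor A \<Z> aug (group_ring (Z_localized p) (p_quotient G p)) (to_p_group_ring G p) (b p))"
    show "pullback_square L \<Z>
      (product_ring (relevant_primes G) (\<lambda>p. group_ring (Z_localized p) (p_quotient G p)))
      (product_ring (relevant_primes G) Z_localized)
      a (\<lambda>x. \<lambda>p\<in>relevant_primes G. b p x) (\<lambda>n. \<lambda>p\<in>relevant_primes G. rat_of_int n)
      (\<lambda>u. \<lambda>p\<in>relevant_primes G. augmentation (Z_localized p) (p_quotient G p) (u p))"
      by (rule canonical_pullback_square) (use * in auto)
  qed
qed

end
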